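(* Let $(\mathcal{M},+,0)$ be a small symmetric monoidal category whose unit $0$ is an initial object and which satisfies $(P_0)$, let $\mathcal{A}$ be a Grothendieck category and let $F:\mathcal{M}\to\mathcal{A}$ be a strongly polynomial and pointwise noetherian functor. Then $F$ is noetherian.
   Context: **$(P_0)$:** there is a finite set $T$ of objects of $\mathcal{M}$ such that every object of $\mathcal{M}$ is a direct factor (i.e. a retract) of a finite sum (for $+$) of elements of $T$. **Strongly polynomial.** For an object $x$ of $\mathcal{M}$, $\tau_x$ is the endofunctor of the category $\mathrm{Fct}(\mathcal{M},\mathcal{A})$ of functors $\mathcal{M}\to\mathcal{A}$ given by precomposition with $x+-$, and $\delta_x$ is the cokernel of the natural transformation $\mathrm{Id}\to\tau_x$ induced by $0\to x$. $F$ is strongly polynomial if there is $d\in\mathbb{N}$ with $\delta_{a_0}\cdots\delta_{a_d}(F)=0$ for all objects $a_0,\dots,a_d$ of $\mathcal{M}$. **Noetherian:** every increasing sequence of subobjects stabilizes; for $F$, this is in $\mathrm{Fct}(\mathcal{M},\mathcal{A})$. $F$ is pointwise noetherian if $F(c)$ is a noetherian object of $\mathcal{A}$ for every object $c$ of $\mathcal{M}$. *)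

theory Defs
  imports "HOL-Algebra.Group"
begin

section \<open>Categories\<close>

text \<open>Composition is in applicative order: \<open>g \<cdot>\<^bsub>C\<^esub> f\<close> is \<open>f\<close> followed by \<open>g\<close>. It and the identities
  are only constrained on arrows of the category that are composable, and on its objects.\<close>

record ('o, 'm) cat =
  Obj :: "'o set"
  Arr :: "'m set"
  Dom :: "'m \<Rightarrow> 'o"
  Cod :: "'m \<Rightarrow> 'o"
  Idt :: "'o \<Rightarrow> 'm"
  Comp :: "'m \<Rightarrow> 'm \<Rightarrow> 'm"  (infixr "\<cdot>\<index>" 70)

definition Hom :: "('o, 'm, 'z) cat_scheme \<Rightarrow> 'o \<Rightarrow> 'o \<Rightarrow> 'm set" where
  "Hom C a b = {f \<in> Arr C. Dom C f = a \<and> Cod C f = b}"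

locale category =
  fixes C :: "('o, 'm, 'z) cat_scheme"
  assumes dom_obj: "f \<in> Arr C \<Longrightarrow> Dom C f \<in> Obj C"
    and cod_obj: "f \<in> Arr C \<Longrightarrow> Cod C f \<in> Obj C"
    and idt_hom: "a \<in> Obj C \<Longrightarrow> Idt C a \<in> Hom C a a"
    and comp_hom: "f \<in> Hom C a b \<Longrightarrow> g \<in> Hom C b c \<Longrightarrow> g \<cdot>\<^bsub>C\<^esub> f \<in> Hom C a c"
    and comp_idt: "f \<in> Hom C a b \<Longrightarrow> f \<cdot>\<^bsub>C\<^esub> Idt C a = f"
    and idt_comp: "f \<in> Hom C a b \<Longrightarrow> Idt C b \<cdot>\<^bsub>C\<^esub> f = f"
    and comp_assoc: "f \<in> Hom C a b \<Longrightarrow> g \<in> Hom C b c \<Longrightarrow> h \<in> Hom C c d \<Longrightarrow>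
      (h \<cdot>\<^bsub>C\<^esub> g) \<cdot>\<^bsub>C\<^esub> f = h \<cdot>\<^bsub>C\<^esub> (g \<cdot>\<^bsub>C\<^esub> f)"

definition inverse_arrows :: "('o, 'm, 'z) cat_scheme \<Rightarrow> 'm \<Rightarrow> 'm \<Rightarrow> bool" where
  "inverse_arrows C f g \<longleftrightarrow> f \<in> Arr C \<and> g \<in> Hom C (Cod C f) (Dom C f) \<and>
    g \<cdot>\<^bsub>C\<^esub> f = Idt C (Dom C f) \<and> f \<cdot>\<^bsub>C\<^esub> g = Idt C (Cod C f)"

definition isomorphism :: "('o, 'm, 'z) cat_scheme \<Rightarrow> 'm \<Rightarrow> bool" where
  "isomorphism C f \<longleftrightarrow> (\<exists>g. inverse_arrows C f g)"

definition inverse_arr :: "('o, 'm, 'z) cat_scheme \<Rightarrow> 'm \<Rightarrow> 'm" where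
  "inverse_arr C f = (THE g. inverse_arrows C f g)"

definition monic :: "('o, 'm, 'z) cat_scheme \<Rightarrow> 'm \<Rightarrow> bool" where
  "monic C f \<longleftrightarrow> f \<in> Arr C \<and>
    (\<forall>a. \<forall>g \<in> Hom C a (Dom C f). \<forall>h \<in> Hom C a (Dom C f). f \<cdot>\<^bsub>C\<^esub> g = f \<cdot>\<^bsub>C\<^esub> h \<longrightarrow> g = h)"

definition epic :: "('o, 'm, 'z) cat_scheme \<Rightarrow> 'm \<Rightarrow> bool" where
  "epic C f \<longleftrightarrow> f \<in> Arr C \<and>
    (\<forall>a. \<forall>g \<in> Hom C (Cod C f) a. \<forall>h \<in> Hom C (Cod C f) a. g \<cdot>\<^bsub>C\<^esub> f = h \<cdot>\<^bsub>C\<^esub> f \<longrightarrow> g = h)"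

definition retract :: "('o, 'm, 'z) cat_scheme \<Rightarrow> 'o \<Rightarrow> 'o \<Rightarrow> bool" where
  "retract C a b \<longleftrightarrow> (\<exists>s \<in> Hom C a b. \<exists>r \<in> Hom C b a. r \<cdot>\<^bsub>C\<^esub> s = Idt C a)"

definition initial_object :: "('o, 'm, 'z) cat_scheme \<Rightarrow> 'o \<Rightarrow> bool" where
  "initial_object C z \<longleftrightarrow> z \<in> Obj C \<and> (\<forall>a \<in> Obj C. \<exists>!f. f \<in> Hom C z a)"

definition terminal_object :: "('o, 'm, 'z) cat_scheme \<Rightarrow> 'o \<Rightarrow> bool" where
  "terminal_object C z \<longleftrightarrow> z \<in> Obj C \<and> (\<forall>a \<in> Obj C. \<exists>!f. f \<in> Hom C a z)"

definition zero_object :: "('o, 'm, 'z) cat_scheme \<Rightarrow> 'o \<Rightarrow> bool" where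
  "zero_object C z \<longleftrightarrow> initial_object C z \<and> terminal_object C z"

definition zero_arrow :: "('o, 'm, 'z) cat_scheme \<Rightarrow> 'm \<Rightarrow> bool" where
  "zero_arrow C f \<longleftrightarrow>
    (\<exists>z. zero_object C z \<and> (\<exists>g \<in> Hom C (Dom C f) z. \<exists>h \<in> Hom C z (Cod C f). f = h \<cdot>\<^bsub>C\<^esub> g))"

definition is_kernel :: "('o, 'm, 'z) cat_scheme \<Rightarrow> 'm \<Rightarrow> 'm \<Rightarrow> bool" where
  "is_kernel C f k \<longleftrightarrow> f \<in> Arr C \<and> k \<in> Arr C \<and> Cod C k = Dom C f \<and> zero_arrow C (f \<cdot>\<^bsub>C\<^esub> k) \<and>
    (\<forall>g \<in> Arr C. Cod C g = Dom C f \<and> zero_arrow C (f \<cdot>\<^bsub>C\<^esub> g) \<longrightarrow>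
      (\<exists>!h. h \<in> Hom C (Dom C g) (Dom C k) \<and> k \<cdot>\<^bsub>C\<^esub> h = g))"

definition is_cokernel :: "('o, 'm, 'z) cat_scheme \<Rightarrow> 'm \<Rightarrow> 'm \<Rightarrow> bool" where
  "is_cokernel C f p \<longleftrightarrow> f \<in> Arr C \<and> p \<in> Arr C \<and> Dom C p = Cod C f \<and> zero_arrow C (p \<cdot>\<^bsub>C\<^esub> f) \<and>
    (\<forall>g \<in> Arr C. Dom C g = Cod C f \<and> zero_arrow C (g \<cdot>\<^bsub>C\<^esub> f) \<longrightarrow>
      (\<exists>!h. h \<in> Hom C (Cod C p) (Cod C g) \<and> h \<cdot>\<^bsub>C\<^esub> p = g))"

text \<open>\<open>0 \<rightarrow> a \<rightarrow> b \<rightarrow> c \<rightarrow> 0\<close> with arrows \<open>f\<close> and \<open>g\<close>.\<close>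

definition short_exact :: "('o, 'm, 'z) cat_scheme \<Rightarrow> 'm \<Rightarrow> 'm \<Rightarrow> bool" where
  "short_exact C f g \<longleftrightarrow> is_kernel C g f \<and> is_cokernel C f g"


section \<open>Noetherian objects\<close>

text \<open>A subobject of \<open>x\<close> is represented by a monomorphism with codomain \<open>x\<close>; two of them represent
  the same subobject iff each factors through the other.\<close>

definition sub_le :: "('o, 'm, 'z) cat_scheme \<Rightarrow> 'm \<Rightarrow> 'm \<Rightarrow> bool" where
  "sub_le C m m' \<longleftrightarrow> (\<exists>h \<in> Hom C (Dom C m) (Dom C m'). m = m' \<cdot>\<^bsub>C\<^esub> h)"

definition noetherian_object :: "('o, 'm, 'z) cat_scheme \<Rightarrow> 'o \<Rightarrow> bool" where
  "noetherian_object C x \<longleftrightarrow> x \<in> Obj C \<and>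
    (\<forall>m :: nat \<Rightarrow> 'm.
      (\<forall>n. monic C (m n) \<and> Cod C (m n) = x) \<and> (\<forall>n. sub_le C (m n) (m (Suc n))) \<longrightarrow>
      (\<exists>N. \<forall>n \<ge> N. sub_le C (m n) (m N) \<and> sub_le C (m N) (m n)))"


section \<open>Functors and functor categories\<close>

record ('o, 'm, 'p, 'n) ftor =
  FObj :: "'o \<Rightarrow> 'p"
  FArr :: "'m \<Rightarrow> 'n"

locale cat_functor =
  fixes C :: "('o, 'm, 'z) cat_scheme" and D :: "('p, 'n, 'y) cat_scheme"
    and F :: "('o, 'm, 'p, 'n) ftor"
  assumes dom_category: "category C"
    and cod_category: "category D"
    and map_obj: "a \<in> Obj C \<Longrightarrow> FObj F a \<in> Obj D"
    and map_hom: "f \<in> Hom C a b \<Longrightarrow> FArr F f \<in> Hom D (FObj F a) (FObj F b)"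
    and map_idt: "a \<in> Obj C \<Longrightarrow> FArr F (Idt C a) = Idt D (FObj F a)"
    and map_comp: "f \<in> Hom C a b \<Longrightarrow> g \<in> Hom C b c \<Longrightarrow> FArr F (g \<cdot>\<^bsub>C\<^esub> f) = FArr F g \<cdot>\<^bsub>D\<^esub> FArr F f"

record ('o, 'm, 'p, 'n) ntrans =
  NDom :: "('o, 'm, 'p, 'n) ftor"
  NCod :: "('o, 'm, 'p, 'n) ftor"
  NComp :: "'o \<Rightarrow> 'n"

text \<open>Components are normalised to \<^const>\<open>undefined\<close> outside \<open>Obj C\<close>, so that natural transformations
  are equal iff they agree on the objects of \<open>C\<close>. Functors are not normalised: functors agreeing
  on \<open>C\<close> but not off it are distinct, isomorphic objects of the functor category.\<close>

definition natural_transformation ::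
  "('o, 'm, 'z) cat_scheme \<Rightarrow> ('p, 'n, 'y) cat_scheme \<Rightarrow> ('o, 'm, 'p, 'n) ntrans \<Rightarrow> bool" where
  "natural_transformation C D t \<longleftrightarrow>
    cat_functor C D (NDom t) \<and> cat_functor C D (NCod t) \<and> NComp t \<in> extensional (Obj C) \<and>
    (\<forall>a \<in> Obj C. NComp t a \<in> Hom D (FObj (NDom t) a) (FObj (NCod t) a)) \<and>
    (\<forall>a \<in> Obj C. \<forall>b \<in> Obj C. \<forall>f \<in> Hom C a b.
      NComp t b \<cdot>\<^bsub>D\<^esub> FArr (NDom t) f = FArr (NCod t) f \<cdot>\<^bsub>D\<^esub> NComp t a)"

definition Fct :: "('o, 'm, 'z) cat_scheme \<Rightarrow> ('p, 'n, 'y) cat_scheme \<Rightarrow>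
    (('o, 'm, 'p, 'n) ftor, ('o, 'm, 'p, 'n) ntrans) cat" where
  "Fct C D =
    \<lparr>Obj = {F. cat_functor C D F},
     Arr = {t. natural_transformation C D t},
     Dom = NDom,
     Cod = NCod,
     Idt = (\<lambda>F. \<lparr>NDom = F, NCod = F, NComp = (\<lambda>a \<in> Obj C. Idt D (FObj F a))\<rparr>),
     Comp = (\<lambda>s t. \<lparr>NDom = NDom t, NCod = NCod s,
       NComp = (\<lambda>a \<in> Obj C. NComp s a \<cdot>\<^bsub>D\<^esub> NComp t a)\<rparr>)\<rparr>"


section \<open>Abelian categories\<close>

text \<open>Since the arrows of a category know their domain and codomain, one function \<open>add\<close> carries the
  additions of all the groups \<open>Hom C a b\<close>.\<close>

definition preadditive ::
  "('o, 'm, 'z) cat_scheme \<Rightarrow> ('m \<Rightarrow> 'm \<Rightarrow> 'm) \<Rightarrow> ('o \<Rightarrow> 'o \<Rightarrow> 'm) \<Rightarrow> bool" where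
  "preadditive C add zero \<longleftrightarrow>
    (\<forall>a \<in> Obj C. \<forall>b \<in> Obj C.
      comm_group \<lparr>carrier = Hom C a b, monoid.mult = add, monoid.one = zero a b\<rparr>) \<and>
    (\<forall>a b c f f' g g'. f \<in> Hom C a b \<and> f' \<in> Hom C a b \<and> g \<in> Hom C b c \<and> g' \<in> Hom C b c \<longrightarrow>
      g \<cdot>\<^bsub>C\<^esub> add f f' = add (g \<cdot>\<^bsub>C\<^esub> f) (g \<cdot>\<^bsub>C\<^esub> f') \<and>
      add g g' \<cdot>\<^bsub>C\<^esub> f = add (g \<cdot>\<^bsub>C\<^esub> f) (g' \<cdot>\<^bsub>C\<^esub> f))"

definition has_binary_biproducts :: "('o, 'm, 'z) cat_scheme \<Rightarrow> ('m \<Rightarrow> 'm \<Rightarrow> 'm) \<Rightarrow> bool" where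
  "has_binary_biproducts C add \<longleftrightarrow>
    (\<forall>a \<in> Obj C. \<forall>b \<in> Obj C. \<exists>s \<in> Obj C.
      \<exists>i \<in> Hom C a s. \<exists>j \<in> Hom C b s. \<exists>p \<in> Hom C s a. \<exists>q \<in> Hom C s b.
        p \<cdot>\<^bsub>C\<^esub> i = Idt C a \<and> q \<cdot>\<^bsub>C\<^esub> j = Idt C b \<and> add (i \<cdot>\<^bsub>C\<^esub> p) (j \<cdot>\<^bsub>C\<^esub> q) = Idt C s)"

definition abelian_category :: "('o, 'm, 'z) cat_scheme \<Rightarrow> bool" where
  "abelian_category C \<longleftrightarrow> category C \<and>
    (\<exists>add zero. preadditive C add zero \<and> has_binary_biproducts C add) \<and>
    (\<exists>z. zero_object C z) \<and>
    (\<forall>f \<in> Arr C. (\<exists>k. is_kernel C f k) \<and> (\<exists>p. is_cokernel C f p)) \<and>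
    (\<forall>f. monic C f \<longrightarrow> (\<exists>g. is_kernel C g f)) \<and>
    (\<forall>f. epic C f \<longrightarrow> (\<exists>g. is_cokernel C g f))"


section \<open>Smallness and Grothendieck categories\<close>

text \<open>HOL cannot quantify over all index types inside a formula. Smallness is therefore relative to
  a type \<open>'u\<close>, meant to be infinite: the small sets are those that embed in \<open>'u\<close>, and a Grothendieck
  category has, and has exactness of, the colimits indexed by categories with objects and arrows
  in \<open>'u\<close>. As \<open>'u\<close> is a free type variable, it can be chosen arbitrarily large. There is no
  smallness condition on the hom-sets of a Grothendieck category: relative to one fixed \<open>'u\<close> it
  would be incompatible with the existence of coproducts indexed by \<open>'u\<close>.\<close>

definition small_category :: "'u itself \<Rightarrow> ('o, 'm, 'z) cat_scheme \<Rightarrow> bool" where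
  "small_category U C \<longleftrightarrow> category C \<and>
    (\<exists>f :: 'o \<Rightarrow> 'u. inj_on f (Obj C)) \<and> (\<exists>g :: 'm \<Rightarrow> 'u. inj_on g (Arr C))"

definition cocone ::
  "('i, 'j, 'z) cat_scheme \<Rightarrow> ('o, 'm, 'y) cat_scheme \<Rightarrow> ('i, 'j, 'o, 'm) ftor \<Rightarrow>
    'o \<Rightarrow> ('i \<Rightarrow> 'm) \<Rightarrow> bool" where
  "cocone J C D c l \<longleftrightarrow> c \<in> Obj C \<and> (\<forall>i \<in> Obj J. l i \<in> Hom C (FObj D i) c) \<and>
    (\<forall>u \<in> Arr J. l (Cod J u) \<cdot>\<^bsub>C\<^esub> FArr D u = l (Dom J u))"

definition colimit ::
  "('i, 'j, 'z) cat_scheme \<Rightarrow> ('o, 'm, 'y) cat_scheme \<Rightarrow> ('i, 'j, 'o, 'm) ftor \<Rightarrow>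
    'o \<Rightarrow> ('i \<Rightarrow> 'm) \<Rightarrow> bool" where
  "colimit J C D c l \<longleftrightarrow> cocone J C D c l \<and>
    (\<forall>c' l'. cocone J C D c' l' \<longrightarrow>
      (\<exists>!h. h \<in> Hom C c c' \<and> (\<forall>i \<in> Obj J. h \<cdot>\<^bsub>C\<^esub> l i = l' i)))"

definition cocomplete :: "'u itself \<Rightarrow> ('o, 'm, 'z) cat_scheme \<Rightarrow> bool" where
  "cocomplete U C \<longleftrightarrow>
    (\<forall>(J :: ('u, 'u) cat) D. cat_functor J C D \<longrightarrow> (\<exists>c l. colimit J C D c l))"

definition filtered :: "('i, 'j, 'z) cat_scheme \<Rightarrow> bool" where
  "filtered J \<longleftrightarrow> category J \<and> Obj J \<noteq> {} \<and>
    (\<forall>i \<in> Obj J. \<forall>j \<in> Obj J. \<exists>k \<in> Obj J. Hom J i k \<noteq> {} \<and> Hom J j k \<noteq> {}) \<and>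
    (\<forall>i \<in> Obj J. \<forall>j \<in> Obj J. \<forall>u \<in> Hom J i j. \<forall>v \<in> Hom J i j.
      \<exists>k \<in> Obj J. \<exists>w \<in> Hom J j k. w \<cdot>\<^bsub>J\<^esub> u = w \<cdot>\<^bsub>J\<^esub> v)"

text \<open>The functor \<open>colim : Fct(J, C) \<rightarrow> C\<close> sends (pointwise) short exact sequences of diagrams to
  short exact sequences, for all small filtered \<open>J\<close>; here \<open>a\<close> and \<open>b\<close> are the arrows induced
  by \<open>s\<close> and \<open>t\<close> on colimits.\<close>

definition exact_filtered_colimits :: "'u itself \<Rightarrow> ('o, 'm, 'z) cat_scheme \<Rightarrow> bool" where
  "exact_filtered_colimits U C \<longleftrightarrow>
    (\<forall>(J :: ('u, 'u) cat) s t c\<^sub>1 l\<^sub>1 c\<^sub>2 l\<^sub>2 c\<^sub>3 l\<^sub>3 a b.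
      filtered J \<and> natural_transformation J C s \<and> natural_transformation J C t \<and>
      NCod s = NDom t \<and> (\<forall>i \<in> Obj J. short_exact C (NComp s i) (NComp t i)) \<and>
      colimit J C (NDom s) c\<^sub>1 l\<^sub>1 \<and> colimit J C (NCod s) c\<^sub>2 l\<^sub>2 \<and> colimit J C (NCod t) c\<^sub>3 l\<^sub>3 \<and>
      a \<in> Hom C c\<^sub>1 c\<^sub>2 \<and> (\<forall>i \<in> Obj J. a \<cdot>\<^bsub>C\<^esub> l\<^sub>1 i = l\<^sub>2 i \<cdot>\<^bsub>C\<^esub> NComp s i) \<and>
      b \<in> Hom C c\<^sub>2 c\<^sub>3 \<and> (\<forall>i \<in> Obj J. b \<cdot>\<^bsub>C\<^esub> l\<^sub>2 i = l\<^sub>3 i \<cdot>\<^bsub>C\<^esub> NComp t i)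
      \<longrightarrow> short_exact C a b)"

definition generator :: "('o, 'm, 'z) cat_scheme \<Rightarrow> 'o \<Rightarrow> bool" where
  "generator C g \<longleftrightarrow> g \<in> Obj C \<and>
    (\<forall>a \<in> Obj C. \<forall>b \<in> Obj C. \<forall>u \<in> Hom C a b. \<forall>v \<in> Hom C a b.
      u \<noteq> v \<longrightarrow> (\<exists>h \<in> Hom C g a. u \<cdot>\<^bsub>C\<^esub> h \<noteq> v \<cdot>\<^bsub>C\<^esub> h))"

definition grothendieck_category :: "'u itself \<Rightarrow> ('o, 'm, 'z) cat_scheme \<Rightarrow> bool" where
  "grothendieck_category U C \<longleftrightarrow> abelian_category C \<and> cocomplete U C \<and>
    exact_filtered_colimits U C \<and> (\<exists>g. generator C g)"


section \<open>Symmetric monoidal categories\<close>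

text \<open>The structure isomorphisms are \<open>assoc a b c : (a + b) + c \<rightarrow> a + (b + c)\<close>,
  \<open>lunit a : 0 + a \<rightarrow> a\<close>, \<open>runit a : a + 0 \<rightarrow> a\<close> and \<open>braid a b : a + b \<rightarrow> b + a\<close>.\<close>

record ('o, 'm) smcat = "('o, 'm) cat" +
  plus_obj :: "'o \<Rightarrow> 'o \<Rightarrow> 'o"
  plus_arr :: "'m \<Rightarrow> 'm \<Rightarrow> 'm"
  unit_obj :: "'o"
  assoc :: "'o \<Rightarrow> 'o \<Rightarrow> 'o \<Rightarrow> 'm"
  lunit :: "'o \<Rightarrow> 'm"
  runit :: "'o \<Rightarrow> 'm"
  braid :: "'o \<Rightarrow> 'o \<Rightarrow> 'm"

locale symmetric_monoidal_category = category M
  for M :: "('o, 'm, 'z) smcat_scheme" +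
  assumes plus_obj: "a \<in> Obj M \<Longrightarrow> b \<in> Obj M \<Longrightarrow> plus_obj M a b \<in> Obj M"
    and plus_hom: "f \<in> Hom M a b \<Longrightarrow> g \<in> Hom M c d \<Longrightarrow>
      plus_arr M f g \<in> Hom M (plus_obj M a c) (plus_obj M b d)"
    and plus_idt: "a \<in> Obj M \<Longrightarrow> b \<in> Obj M \<Longrightarrow>
      plus_arr M (Idt M a) (Idt M b) = Idt M (plus_obj M a b)"
    and plus_comp: "f \<in> Hom M a b \<Longrightarrow> g \<in> Hom M b c \<Longrightarrow> f' \<in> Hom M a' b' \<Longrightarrow> g' \<in> Hom M b' c' \<Longrightarrow>
      plus_arr M (g \<cdot>\<^bsub>M\<^esub> f) (g' \<cdot>\<^bsub>M\<^esub> f') = plus_arr M g g' \<cdot>\<^bsub>M\<^esub> plus_arr M f f'"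
    and unit_obj: "unit_obj M \<in> Obj M"
    and assoc_hom: "a \<in> Obj M \<Longrightarrow> b \<in> Obj M \<Longrightarrow> c \<in> Obj M \<Longrightarrow>
      assoc M a b c \<in> Hom M (plus_obj M (plus_obj M a b) c) (plus_obj M a (plus_obj M b c))"
    and assoc_iso: "a \<in> Obj M \<Longrightarrow> b \<in> Obj M \<Longrightarrow> c \<in> Obj M \<Longrightarrow> isomorphism M (assoc M a b c)"
    and assoc_natural: "f \<in> Hom M a a' \<Longrightarrow> g \<in> Hom M b b' \<Longrightarrow> h \<in> Hom M c c' \<Longrightarrow>
      assoc M a' b' c' \<cdot>\<^bsub>M\<^esub> plus_arr M (plus_arr M f g) h =
      plus_arr M f (plus_arr M g h) \<cdot>\<^bsub>M\<^esub> assoc M a b c"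
    and lunit_hom: "a \<in> Obj M \<Longrightarrow> lunit M a \<in> Hom M (plus_obj M (unit_obj M) a) a"
    and lunit_iso: "a \<in> Obj M \<Longrightarrow> isomorphism M (lunit M a)"
    and lunit_natural: "f \<in> Hom M a b \<Longrightarrow>
      lunit M b \<cdot>\<^bsub>M\<^esub> plus_arr M (Idt M (unit_obj M)) f = f \<cdot>\<^bsub>M\<^esub> lunit M a"
    and runit_hom: "a \<in> Obj M \<Longrightarrow> runit M a \<in> Hom M (plus_obj M a (unit_obj M)) a"
    and runit_iso: "a \<in> Obj M \<Longrightarrow> isomorphism M (runit M a)"
    and runit_natural: "f \<in> Hom M a b \<Longrightarrow>
      runit M b \<cdot>\<^bsub>M\<^esub> plus_arr M f (Idt M (unit_obj M)) = f \<cdot>\<^bsub>M\<^esub> runit M a"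
    and braid_hom: "a \<in> Obj M \<Longrightarrow> b \<in> Obj M \<Longrightarrow>
      braid M a b \<in> Hom M (plus_obj M a b) (plus_obj M b a)"
    and braid_natural: "f \<in> Hom M a a' \<Longrightarrow> g \<in> Hom M b b' \<Longrightarrow>
      braid M a' b' \<cdot>\<^bsub>M\<^esub> plus_arr M f g = plus_arr M g f \<cdot>\<^bsub>M\<^esub> braid M a b"
    and pentagon: "a \<in> Obj M \<Longrightarrow> b \<in> Obj M \<Longrightarrow> c \<in> Obj M \<Longrightarrow> d \<in> Obj M \<Longrightarrow>
      plus_arr M (Idt M a) (assoc M b c d) \<cdot>\<^bsub>M\<^esub> assoc M a (plus_obj M b c) d
        \<cdot>\<^bsub>M\<^esub> plus_arr M (assoc M a b c) (Idt M d) =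
      assoc M a b (plus_obj M c d) \<cdot>\<^bsub>M\<^esub> assoc M (plus_obj M a b) c d"
    and triangle: "a \<in> Obj M \<Longrightarrow> b \<in> Obj M \<Longrightarrow>
      plus_arr M (Idt M a) (lunit M b) \<cdot>\<^bsub>M\<^esub> assoc M a (unit_obj M) b =
      plus_arr M (runit M a) (Idt M b)"
    and symmetry: "a \<in> Obj M \<Longrightarrow> b \<in> Obj M \<Longrightarrow>
      braid M b a \<cdot>\<^bsub>M\<^esub> braid M a b = Idt M (plus_obj M a b)"
    and braid_unit: "a \<in> Obj M \<Longrightarrow> lunit M a \<cdot>\<^bsub>M\<^esub> braid M a (unit_obj M) = runit M a"
    and hexagon: "a \<in> Obj M \<Longrightarrow> b \<in> Obj M \<Longrightarrow> c \<in> Obj M \<Longrightarrow>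
      assoc M b c a \<cdot>\<^bsub>M\<^esub> braid M a (plus_obj M b c) \<cdot>\<^bsub>M\<^esub> assoc M a b c =
      plus_arr M (Idt M b) (braid M a c) \<cdot>\<^bsub>M\<^esub> assoc M b a c
        \<cdot>\<^bsub>M\<^esub> plus_arr M (braid M a b) (Idt M c)"

text \<open>The empty sum is the unit.\<close>

definition finite_sum :: "('o, 'm, 'z) smcat_scheme \<Rightarrow> 'o list \<Rightarrow> 'o" where
  "finite_sum M ts = foldr (plus_obj M) ts (unit_obj M)"

definition P0 :: "('o, 'm, 'z) smcat_scheme \<Rightarrow> bool" where
  "P0 M \<longleftrightarrow> (\<exists>T. finite T \<and> T \<subseteq> Obj M \<and>
    (\<forall>x \<in> Obj M. \<exists>ts. set ts \<subseteq> T \<and> retract M x (finite_sum M ts)))"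


section \<open>Strongly polynomial functors\<close>

definition tau :: "('o, 'm, 'z) smcat_scheme \<Rightarrow> 'o \<Rightarrow> ('o, 'm, 'p, 'n) ftor \<Rightarrow> ('o, 'm, 'p, 'n) ftor"
  where "tau M x F =
    \<lparr>FObj = (\<lambda>y. FObj F (plus_obj M x y)), FArr = (\<lambda>f. FArr F (plus_arr M (Idt M x) f))\<rparr>"

definition from_unit :: "('o, 'm, 'z) smcat_scheme \<Rightarrow> 'o \<Rightarrow> 'm" where
  "from_unit M x = (THE f. f \<in> Hom M (unit_obj M) x)"

text \<open>The component at \<open>y\<close> is \<open>F\<close> applied to \<open>y \<cong> 0 + y \<rightarrow> x + y\<close>.\<close>

definition to_tau ::
  "('o, 'm, 'z) smcat_scheme \<Rightarrow> 'o \<Rightarrow> ('o, 'm, 'p, 'n) ftor \<Rightarrow> ('o, 'm, 'p, 'n) ntrans" where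
  "to_tau M x F = \<lparr>NDom = F, NCod = tau M x F, NComp = (\<lambda>y \<in> Obj M.
    FArr F (plus_arr M (from_unit M x) (Idt M y) \<cdot>\<^bsub>M\<^esub> inverse_arr M (lunit M y)))\<rparr>"

text \<open>Cokernels of transformations of endofunctors of \<open>Fct M A\<close> are computed objectwise, so the value
  of \<open>\<delta>\<^sub>x\<close> at \<open>F\<close> is a cokernel in \<open>Fct M A\<close>. It is defined up to isomorphism; one is chosen.\<close>

definition delta :: "('o, 'm, 'z) smcat_scheme \<Rightarrow> ('p, 'n, 'y) cat_scheme \<Rightarrow> 'o \<Rightarrow>
    ('o, 'm, 'p, 'n) ftor \<Rightarrow> ('o, 'm, 'p, 'n) ftor" where
  "delta M A x F = (SOME G. \<exists>p. is_cokernel (Fct M A) (to_tau M x F) p \<and> Cod (Fct M A) p = G)"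

definition strongly_polynomial ::
  "('o, 'm, 'z) smcat_scheme \<Rightarrow> ('p, 'n, 'y) cat_scheme \<Rightarrow> ('o, 'm, 'p, 'n) ftor \<Rightarrow> bool" where
  "strongly_polynomial M A F \<longleftrightarrow> (\<exists>d :: nat. \<forall>as. length as = d + 1 \<and> set as \<subseteq> Obj M \<longrightarrow>
    zero_object (Fct M A) (foldr (delta M A) as F))"

definition pointwise_noetherian ::
  "('o, 'm, 'z) cat_scheme \<Rightarrow> ('p, 'n, 'y) cat_scheme \<Rightarrow> ('o, 'm, 'p, 'n) ftor \<Rightarrow> bool" where
  "pointwise_noetherian M A F \<longleftrightarrow> (\<forall>c \<in> Obj M. noetherian_object A (FObj F c))"

end

theory Submission
  imports Defs Complex_Main "HOL-Library.Sublist"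
begin

text \<open>The argument is Hilbert's basis theorem, with \<open>\<delta>\<^sub>x\<close> in the role of taking leading coefficients. By
induction on the polynomial degree, every \<open>\<delta>\<^sub>x F\<close> satisfies the ascending chain condition on its
subfunctors: it is again pointwise noetherian, being a quotient of \<open>\<tau>\<^sub>x F\<close>, and it is killed by one
\<open>\<delta>\<close> fewer. In degree \<open>-1\<close> the functor is zero.

Let \<open>x\<close> be an object and \<open>i : F y \<rightarrow> F(x + y)\<close> the natural map, with cokernel \<open>p : F(x + y) \<rightarrow> (\<delta>\<^sub>x F) y\<close>.
Among nested subobjects of \<open>F(x + y)\<close>, one is determined by its inverse image under \<open>i\<close> and its
direct image under \<open>p\<close> (\<open>subobjects_compared_by_preimage_and_image\<close>). For a subfunctor \<open>S\<close> of \<open>F\<close>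
the direct images of the \<open>S(x + y)\<close> form a subfunctor of \<open>\<delta>\<^sub>x F\<close>, its leading part, while the inverse
images form a subfunctor of \<open>F\<close> that may be larger than \<open>S\<close>, the saturation of \<open>S\<close> along \<open>x\<close>. So
knowing \<open>S\<close> at \<open>x + y\<close> amounts to knowing, at \<open>y\<close>, its leading part and its saturation.
Peeling off the summands of \<open>t\<^sub>1 + \<dots> + t\<^sub>m\<close> in this way describes \<open>S\<close> there by the leading
parts of its iterated saturations, and by the value of the last one at the unit.

For a chain \<open>S\<^sub>0 \<le> S\<^sub>1 \<le> \<dots>\<close> one therefore needs a single index from which on the leading parts of
the saturations of \<open>S\<^sub>n\<close> along all words in the generating objects are constant. Saturating
enlarges subfunctors, so these leading parts grow both with \<open>n\<close> and with the word; Dickson's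
lemma then gives a uniform bound (\<open>chains_indexed_by_sorted_words_stabilise\<close>). To make Dickson's lemma
apply, words are taken sorted, which is harmless because finite sums do not depend on the order
of their summands up to isomorphism. By \<open>(P\<^sub>0)\<close> every object is a retract of such a sum, and the
value of a subfunctor at a retract is determined by its value at the larger object
(\<open>acc_subfunctors_if_acc_delta\<close>).

Subobjects of an object \<open>c\<close> are represented by sets of arrows into \<open>c\<close>, namely those annihilated
by some arrow out of \<open>c\<close>. Equality of subobjects is then equality of sets, and a subfunctor
is a family of such sets.\<close>

section \<open>Ascending chains indexed by words\<close>

definition ascending_chain_condition :: "'a::order set \<Rightarrow> bool" where
  "ascending_chain_condition X \<longleftrightarrow>
    (\<forall>s :: nat \<Rightarrow> 'a. range s \<subseteq> X \<and> mono s \<longrightarrow> (\<exists>N. \<forall>n \<ge> N. s n = s N))"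

text \<open>By Ramsey some subsequence is monotone in one of the two directions, and a weakly decreasing
  sequence of natural numbers is eventually constant.\<close>

lemma nat_sequence_has_mono_subsequence:
  fixes c :: "nat \<Rightarrow> nat"
  obtains r :: "nat \<Rightarrow> nat" where "strict_mono r" "mono (\<lambda>j. c (r j))"
proof -
  obtain f where f: "strict_mono f" "monoseq (\<lambda>n. c (f n))"
    using seq_monosub by blast
  show thesis
  proof (cases "mono (\<lambda>n. c (f n))")
    case True
    with f that show ?thesis by blast
  next
    case False
    with f(2) have dec: "m \<le> n \<Longrightarrow> c (f n) \<le> c (f m)" for m n
      by (auto simp: monoseq_def mono_def)
    define v where "v = (LEAST v. v \<in> range (\<lambda>n. c (f n)))"
    have "v \<in> range (\<lambda>n. c (f n))"
      unfolding v_def by (rule LeastI) blast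
    then obtain N where N: "v = c (f N)" by blast
    have const: "c (f (N + n)) = v" for n
    proof (rule antisym)
      show "c (f (N + n)) \<le> v" using dec[of N "N + n"] N by simp
      show "v \<le> c (f (N + n))" unfolding v_def by (rule Least_le) blast
    qed
    have "strict_mono (\<lambda>n. f (N + n))"
      using f(1) by (auto simp: strict_mono_def)
    moreover have "mono (\<lambda>n. c (f (N + n)))"
      using const by (simp add: mono_def)
    ultimately show ?thesis by (rule that)
  qed
qed

lemma Dickson_subsequence:
  fixes c :: "nat \<Rightarrow> 'k \<Rightarrow> nat"
  assumes "finite K"
  shows "\<exists>r :: nat \<Rightarrow> nat. strict_mono r \<and> (\<forall>k \<in> K. mono (\<lambda>j. c (r j) k))"
  using assms
proof (induction K)
  case empty
  show ?case by (intro exI[of _ id]) (simp add: strict_mono_def)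
next
  case (insert k K)
  then obtain r :: "nat \<Rightarrow> nat" where r: "strict_mono r" "\<forall>k \<in> K. mono (\<lambda>j. c (r j) k)" by blast
  obtain q :: "nat \<Rightarrow> nat" where q: "strict_mono q" "mono (\<lambda>j. c (r (q j)) k)"
    using nat_sequence_has_mono_subsequence[of "\<lambda>j. c (r j) k"] by blast
  have "strict_mono (\<lambda>j. r (q j))"
    using r(1) q(1) by (auto simp: strict_mono_def)
  moreover have "mono (\<lambda>j. c (r (q j)) l)" if "l \<in> insert k K" for l
  proof (cases "l = k")
    case True
    then show ?thesis using q(2) by simp
  next
    case False
    then have "mono (\<lambda>j. c (r j) l)" using that r(2) by blast
    then show ?thesis
      using strict_mono_mono[OF q(1)] by (simp add: mono_def)
  qed
  ultimately show ?case by blast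
qed

text \<open>Among sorted words, the subword order is the componentwise order on multiplicities, to which
  Dickson's lemma applies.\<close>

lemma sorted_subseq_if_count_le:
  fixes v w :: "nat list"
  assumes "sorted v" "sorted w" "\<And>k. count_list v k \<le> count_list w k"
  shows "subseq v w"
  using assms
proof (induction w arbitrary: v)
  case Nil
  have "v = []"
  proof (rule ccontr)
    assume "v \<noteq> []"
    then have "count_list v (hd v) \<noteq> 0" by (simp add: count_list_0_iff)
    with Nil(3)[of "hd v"] show False by simp
  qed
  then show ?case by simp
next
  case (Cons y w)
  have sub: "set v \<subseteq> set (y # w)"
  proof
    fix x assume "x \<in> set v"
    then have "count_list v x \<noteq> 0" by (simp add: count_list_0_iff)
    then have "count_list (y # w) x \<noteq> 0" using Cons.prems(3)[of x] by linarith
    then show "x \<in> set (y # w)" unfolding count_list_0_iff by blast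
  qed
  have low: "\<forall>x \<in> set v. y \<le> x" using sub Cons.prems(2) by auto
  show ?case
  proof (cases "y \<in> set v")
    case True
    then obtain z v' where v: "v = z # v'" by (cases v) auto
    then have "z = y" using True low Cons.prems(1) by fastforce
    with v have v: "v = y # v'" by simp
    have "count_list v' k \<le> count_list w k" for k
      using Cons.prems(3)[of k] v by (simp split: if_splits)
    then have "subseq v' w"
      using Cons.IH[of v'] Cons.prems(1,2) v by simp
    then show ?thesis using v by simp
  next
    case False
    then have "count_list v y = 0" by (simp add: count_list_0_iff)
    then have "count_list v k \<le> count_list w k" for k
      using Cons.prems(3)[of k] by (cases "k = y") auto
    then have "subseq v w"
      using Cons.IH[of v] Cons.prems(1,2) by simp
    then show ?thesis by (rule list_emb_Cons)
  qed
qed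

definition sorted_words :: "nat \<Rightarrow> nat list set" where
  "sorted_words r = {w. sorted w \<and> set w \<subseteq> {..<r}}"

text \<open>If no such \<open>N\<close> existed, there would be indices \<open>a\<^sub>0 < a\<^sub>1 < \<dots>\<close> and words \<open>w\<^sub>j\<close> at which \<open>\<Phi>\<close>
  increases strictly between \<open>a\<^sub>j\<close> and the next index. On a subsequence along which the words
  increase as well, the values \<open>\<Phi> w\<^sub>j a\<^sub>j\<close> form a strictly ascending chain in \<open>X\<close>.\<close>

lemma chains_indexed_by_sorted_words_stabilise:
  fixes \<Phi> :: "nat list \<Rightarrow> nat \<Rightarrow> 'a::order"
  assumes acc: "ascending_chain_condition X"
    and in_X: "\<And>w n. w \<in> sorted_words r \<Longrightarrow> \<Phi> w n \<in> X"
    and mono_n: "\<And>w m n. w \<in> sorted_words r \<Longrightarrow> m \<le> n \<Longrightarrow> \<Phi> w m \<le> \<Phi> w n"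
    and mono_w: "\<And>v w n. v \<in> sorted_words r \<Longrightarrow> w \<in> sorted_words r \<Longrightarrow> subseq v w \<Longrightarrow> \<Phi> v n \<le> \<Phi> w n"
  shows "\<exists>N. \<forall>n \<ge> N. \<forall>w \<in> sorted_words r. \<Phi> w n = \<Phi> w N"
proof (rule ccontr)
  assume "\<not> ?thesis"
  then have "\<forall>N. \<exists>p. fst p \<ge> N \<and> snd p \<in> sorted_words r \<and> \<Phi> (snd p) (fst p) \<noteq> \<Phi> (snd p) N"
    by simp blast
  from choice[OF this] obtain p where
    p: "\<forall>N. fst (p N) \<ge> N \<and> snd (p N) \<in> sorted_words r \<and>
      \<Phi> (snd (p N)) (fst (p N)) \<noteq> \<Phi> (snd (p N)) N"
    by (rule exE)
  define next_n where "next_n N = fst (p N)" for N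
  define wd where "wd N = snd (p N)" for N
  have nw: "next_n N \<ge> N" "wd N \<in> sorted_words r" "\<Phi> (wd N) (next_n N) \<noteq> \<Phi> (wd N) N" for N
    using p[rule_format, of N] by (simp_all add: next_n_def wd_def)
  define a where "a j = (next_n ^^ j) 0" for j
  have a_Suc: "a (Suc j) = next_n (a j)" for j by (simp add: a_def)
  have a_mono: "i \<le> j \<Longrightarrow> a i \<le> a j" for i j
    by (rule lift_Suc_mono_le[of a]) (simp_all add: a_Suc nw(1))
  define w where "w j = wd (a j)" for j
  have w: "w j \<in> sorted_words r" for j by (simp add: w_def nw(2))
  have step: "\<Phi> (w j) (a j) < \<Phi> (w j) (a (Suc j))" for j
    using mono_n[OF w, of "a j" "a (Suc j)" j] nw(3)[of "a j"] a_mono[of j "Suc j"]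
    by (auto simp: w_def a_Suc less_le)
  obtain q :: "nat \<Rightarrow> nat"
    where q: "strict_mono q" "\<forall>k \<in> {..<r}. mono (\<lambda>j. count_list (w (q j)) k)"
    using Dickson_subsequence[OF finite_lessThan, of r "\<lambda>j. count_list (w j)"] by blast
  have w_le: "subseq (w (q i)) (w (q j))" if "i \<le> j" for i j
  proof (rule sorted_subseq_if_count_le)
    show "count_list (w (q i)) k \<le> count_list (w (q j)) k" for k
    proof (cases "k < r")
      case True
      then have "mono (\<lambda>j. count_list (w (q j)) k)" using q(2) by simp
      from monoD[OF this that] show ?thesis .
    next
      case False
      then have "k \<notin> set (w (q i))" using w[of "q i"] by (auto simp: sorted_words_def)
      then have "count_list (w (q i)) k = 0" by (simp add: count_list_0_iff)
      then show ?thesis by simp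
    qed
    show "sorted (w (q i))" "sorted (w (q j))"
      using w[of "q i"] w[of "q j"] by (simp_all add: sorted_words_def)
  qed
  define s where "s j = \<Phi> (w (q j)) (a (q j))" for j
  have lt: "s j < s (Suc j)" for j
  proof -
    have "q j < q (Suc j)" using q(1) by (simp add: strict_mono_def)
    then have "a (Suc (q j)) \<le> a (q (Suc j))" by (intro a_mono) simp
    then have "\<Phi> (w (q j)) (a (Suc (q j))) \<le> \<Phi> (w (q j)) (a (q (Suc j)))"
      by (rule mono_n[OF w])
    moreover have "\<Phi> (w (q j)) (a (q (Suc j))) \<le> \<Phi> (w (q (Suc j))) (a (q (Suc j)))"
      by (rule mono_w[OF w w w_le[OF le_SucI[OF le_refl]]])
    ultimately show ?thesis
      using step[of "q j"] unfolding s_def by (meson less_le_trans)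
  qed
  have "mono s"
    using less_imp_le[OF lt] by (rule incseq_SucI)
  moreover have "range s \<subseteq> X" using in_X[OF w] by (auto simp: s_def)
  ultimately obtain N where N: "\<And>n. n \<ge> N \<Longrightarrow> s n = s N"
    using acc unfolding ascending_chain_condition_def by blast
  from N[of "Suc N"] lt[of N] show False by simp
qed

section \<open>Retracts and finite sums\<close>

context category
begin

lemma retract_refl: "a \<in> Obj C \<Longrightarrow> retract C a a"
  unfolding retract_def using idt_hom comp_idt by blast

lemma retract_trans:
  assumes "retract C a b" "retract C b c"
  shows "retract C a c"
proof -
  obtain s r where sr: "s \<in> Hom C a b" "r \<in> Hom C b a" "r \<cdot>\<^bsub>C\<^esub> s = Idt C a"
    using assms(1) by (auto simp: retract_def)
  obtain s' r' where sr': "s' \<in> Hom C b c" "r' \<in> Hom C c b" "r' \<cdot>\<^bsub>C\<^esub> s' = Idt C b"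
    using assms(2) by (auto simp: retract_def)
  have "(r \<cdot>\<^bsub>C\<^esub> r') \<cdot>\<^bsub>C\<^esub> (s' \<cdot>\<^bsub>C\<^esub> s) = r \<cdot>\<^bsub>C\<^esub> ((r' \<cdot>\<^bsub>C\<^esub> s') \<cdot>\<^bsub>C\<^esub> s)"
    by (simp add: comp_assoc[OF comp_hom[OF sr(1) sr'(1)] sr'(2) sr(2)]
        comp_assoc[OF sr(1) sr'(1,2)])
  also have "\<dots> = Idt C a" using sr sr' idt_comp by simp
  finally show ?thesis
    unfolding retract_def using comp_hom[OF sr(1) sr'(1)] comp_hom[OF sr'(2) sr(2)] by blast
qed

lemma isomorphism_hom_inverse:
  assumes "isomorphism C f" "f \<in> Hom C a b"
  obtains g where "g \<in> Hom C b a" "g \<cdot>\<^bsub>C\<^esub> f = Idt C a" "f \<cdot>\<^bsub>C\<^esub> g = Idt C b" "inverse_arr C f = g"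
proof -
  obtain g where g: "inverse_arrows C f g" using assms(1) by (auto simp: isomorphism_def)
  have "h = g" if "inverse_arrows C f h" for h
  proof -
    have h: "h \<in> Hom C b a" "g \<in> Hom C b a"
      using that g assms(2) by (auto simp: inverse_arrows_def Hom_def)
    have "h = (g \<cdot>\<^bsub>C\<^esub> f) \<cdot>\<^bsub>C\<^esub> h"
      using g h assms(2) idt_comp[OF h(1)] by (auto simp: inverse_arrows_def Hom_def)
    also have "\<dots> = g \<cdot>\<^bsub>C\<^esub> (f \<cdot>\<^bsub>C\<^esub> h)" by (rule comp_assoc[OF h(1) assms(2) h(2)])
    also have "\<dots> = g"
      using that h assms(2) comp_idt[OF h(2)] by (auto simp: inverse_arrows_def Hom_def)
    finally show ?thesis .
  qed
  then have "inverse_arr C f = g"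
    unfolding inverse_arr_def using g by (rule the_equality[rotated])
  with g assms(2) show thesis
    by (intro that) (auto simp: inverse_arrows_def Hom_def)
qed

lemma isomorphism_retract:
  assumes "isomorphism C f" "f \<in> Hom C a b"
  shows "retract C a b" "retract C b a"
proof -
  obtain g where "g \<in> Hom C b a" "g \<cdot>\<^bsub>C\<^esub> f = Idt C a" "f \<cdot>\<^bsub>C\<^esub> g = Idt C b"
    using isomorphism_hom_inverse[OF assms] by blast
  with assms(2) show "retract C a b" "retract C b a" unfolding retract_def by blast+
qed

end

context symmetric_monoidal_category
begin

lemma retract_plus:
  assumes "retract M a b" "retract M c d" "a \<in> Obj M" "c \<in> Obj M"
  shows "retract M (plus_obj M a c) (plus_obj M b d)"
proof -
  obtain s r where sr: "s \<in> Hom M a b" "r \<in> Hom M b a" "r \<cdot>\<^bsub>M\<^esub> s = Idt M a"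
    using assms(1) by (auto simp: retract_def)
  obtain s' r' where sr': "s' \<in> Hom M c d" "r' \<in> Hom M d c" "r' \<cdot>\<^bsub>M\<^esub> s' = Idt M c"
    using assms(2) by (auto simp: retract_def)
  have "plus_arr M r r' \<cdot>\<^bsub>M\<^esub> plus_arr M s s' = Idt M (plus_obj M a c)"
    using plus_comp[OF sr(1,2) sr'(1,2)] sr(3) sr'(3) plus_idt assms(3,4) by simp
  then show ?thesis
    using plus_hom[OF sr(1) sr'(1)] plus_hom[OF sr(2) sr'(2)] unfolding retract_def by blast
qed

text \<open>Reassociate, braid the first two summands and reassociate back: a composite of isomorphisms.\<close>

lemma retract_swap:
  assumes x: "x \<in> Obj M" and y: "y \<in> Obj M" and z: "z \<in> Obj M"
  shows "retract M (plus_obj M x (plus_obj M y z)) (plus_obj M y (plus_obj M x z))"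
proof -
  have "retract M (plus_obj M x (plus_obj M y z)) (plus_obj M (plus_obj M x y) z)"
    using isomorphism_retract(2)[OF assoc_iso assoc_hom] x y z by blast
  also have "retract M \<dots> (plus_obj M (plus_obj M y x) z)"
  proof (rule retract_plus)
    show "retract M (plus_obj M x y) (plus_obj M y x)"
      using braid_hom[OF x y] braid_hom[OF y x] symmetry[OF x y] unfolding retract_def by blast
  qed (intro retract_refl plus_obj x y z)+
  also (retract_trans) have "retract M \<dots> (plus_obj M y (plus_obj M x z))"
    using isomorphism_retract(1)[OF assoc_iso assoc_hom] x y z by blast
  finally (retract_trans) show ?thesis .
qed

lemma finite_sum_obj: "set ts \<subseteq> Obj M \<Longrightarrow> finite_sum M ts \<in> Obj M"
  by (induction ts) (auto simp: finite_sum_def unit_obj plus_obj)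

lemma retract_finite_sum_insort:
  assumes "t i \<in> Obj M" "\<And>k. k \<in> set ks \<Longrightarrow> t k \<in> Obj M"
  shows "retract M (finite_sum M (map t (i # ks))) (finite_sum M (map t (insort i ks)))"
  using assms(2)
proof (induction ks)
  case Nil
  show ?case using assms(1) by (auto intro!: retract_refl finite_sum_obj)
next
  case (Cons k ks)
  have obj: "finite_sum M (map t ks) \<in> Obj M" "t k \<in> Obj M"
    using Cons.prems by (auto intro!: finite_sum_obj)
  have fs: "finite_sum M (a # l) = plus_obj M a (finite_sum M l)" for a l
    by (simp add: finite_sum_def)
  show ?case
  proof (cases "i \<le> k")
    case True
    then show ?thesis using assms(1) Cons.prems by (auto intro!: retract_refl finite_sum_obj)
  next
    case False
    have "retract M (finite_sum M (map t (i # k # ks)))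
        (plus_obj M (t k) (finite_sum M (map t (i # ks))))"
      using retract_swap[OF assms(1) obj(2,1)] by (simp add: fs)
    moreover have "retract M \<dots> (plus_obj M (t k) (finite_sum M (map t (insort i ks))))"
      using Cons assms(1) obj by (intro retract_plus retract_refl finite_sum_obj) auto
    ultimately have "retract M (finite_sum M (map t (i # k # ks)))
        (plus_obj M (t k) (finite_sum M (map t (insort i ks))))"
      by (rule retract_trans)
    then show ?thesis using False by (simp add: fs)
  qed
qed

text \<open>Sorting the summands gives an isomorphic sum; the weaker conclusion suffices and composes with
  the retractions of \<^const>\<open>P0\<close>.\<close>

lemma retract_finite_sum_sort:
  assumes "\<And>k. k \<in> set ks \<Longrightarrow> t k \<in> Obj M"
  shows "retract M (finite_sum M (map t ks)) (finite_sum M (map t (sort ks)))"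
  using assms
proof (induction ks)
  case Nil
  show ?case by (auto intro!: retract_refl finite_sum_obj)
next
  case (Cons k ks)
  have fs: "finite_sum M (a # l) = plus_obj M a (finite_sum M l)" for a l
    by (simp add: finite_sum_def)
  have "retract M (finite_sum M (map t (k # ks))) (finite_sum M (map t (k # sort ks)))"
    unfolding list.map fs using Cons
    by (intro retract_plus retract_refl finite_sum_obj) auto
  moreover have "retract M \<dots> (finite_sum M (map t (insort k (sort ks))))"
    using Cons.prems by (intro retract_finite_sum_insort) auto
  ultimately have "retract M (finite_sum M (map t (k # ks)))
      (finite_sum M (map t (insort k (sort ks))))"
    by (rule retract_trans)
  then show ?case by simp
qed

end

section \<open>Abelian categories\<close>

lemma ex1_unique: "\<exists>!x. P x \<Longrightarrow> P x \<Longrightarrow> P y \<Longrightarrow> x = y"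
  by blast

lemma HomD:
  assumes "f \<in> Hom C a b"
  shows "f \<in> Arr C" "Dom C f = a" "Cod C f = b"
  using assms by (simp_all add: Hom_def)

lemma (in category) hom_obj:
  assumes "f \<in> Hom C a b"
  shows "a \<in> Obj C" "b \<in> Obj C"
  using dom_obj[of f] cod_obj[of f] HomD[OF assms] by simp_all

locale abelian =
  fixes A :: "('p, 'n, 'y) cat_scheme" (structure)
  assumes abelian: "abelian_category A"
begin

sublocale category A
  using abelian by (simp add: abelian_category_def)

lemma zero_arrowE:
  assumes "zero_arrow A f" "f \<in> Hom A a b"
  obtains z g h where "zero_object A z" "g \<in> Hom A a z" "h \<in> Hom A z b" "f = h \<cdot> g"
  using assms HomD[OF assms(2)] unfolding zero_arrow_def by auto

lemma zero_arrowI: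
  assumes "zero_object A z" "g \<in> Hom A a z" "h \<in> Hom A z b"
  shows "zero_arrow A (h \<cdot> g)"
  using assms HomD[OF comp_hom[OF assms(2,3)]] unfolding zero_arrow_def by blast

lemma zero_object_exists: obtains z where "zero_object A z"
  using abelian by (auto simp: abelian_category_def)

lemma zero_object_arrows:
  assumes "zero_object A z" "a \<in> Obj A"
  shows "\<exists>!f. f \<in> Hom A z a" "\<exists>!f. f \<in> Hom A a z"
  using assms by (auto simp: zero_object_def initial_object_def terminal_object_def)

lemma zero_arrow_comp_left:
  assumes "zero_arrow A f" "f \<in> Hom A a b" "g \<in> Hom A b c"
  shows "zero_arrow A (g \<cdot> f)"
proof -
  obtain z u v where z: "zero_object A z" "u \<in> Hom A a z" "v \<in> Hom A z b" "f = v \<cdot> u"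
    using zero_arrowE[OF assms(1,2)] .
  have "g \<cdot> f = (g \<cdot> v) \<cdot> u" using comp_assoc[OF z(2,3) assms(3)] z(4) by simp
  then show ?thesis using zero_arrowI[OF z(1,2) comp_hom[OF z(3) assms(3)]] by simp
qed

lemma zero_arrow_comp_right:
  assumes "zero_arrow A g" "f \<in> Hom A a b" "g \<in> Hom A b c"
  shows "zero_arrow A (g \<cdot> f)"
proof -
  obtain z u v where z: "zero_object A z" "u \<in> Hom A b z" "v \<in> Hom A z c" "g = v \<cdot> u"
    using zero_arrowE[OF assms(1,3)] .
  have "g \<cdot> f = v \<cdot> (u \<cdot> f)" using comp_assoc[OF assms(2) z(2,3)] z(4) by simp
  then show ?thesis using zero_arrowI[OF z(1) comp_hom[OF assms(2) z(2)] z(3)] by simp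
qed

lemma zero_arrow_unique:
  assumes "zero_arrow A f" "zero_arrow A f'" "f \<in> Hom A a b" "f' \<in> Hom A a b"
  shows "f = f'"
proof -
  obtain z u v where z: "zero_object A z" "u \<in> Hom A a z" "v \<in> Hom A z b" "f = v \<cdot> u"
    using zero_arrowE[OF assms(1,3)] .
  obtain z' u' v' where z': "zero_object A z'" "u' \<in> Hom A a z'" "v' \<in> Hom A z' b" "f' = v' \<cdot> u'"
    using zero_arrowE[OF assms(2,4)] .
  obtain w where w: "w \<in> Hom A z z'"
    using zero_object_arrows(1)[OF z(1) hom_obj(1)[OF z'(3)]] by blast
  have u': "w \<cdot> u = u'"
    using zero_object_arrows(2)[OF z'(1) hom_obj(1)[OF z(2)]] comp_hom[OF z(2) w] z'(2) by blast
  have v: "v' \<cdot> w = v"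
    using zero_object_arrows(1)[OF z(1) hom_obj(2)[OF z(3)]] comp_hom[OF w z'(3)] z(3) by blast
  show ?thesis using comp_assoc[OF z(2) w z'(3)] u' v z(4) z'(4) by simp
qed

lemma zero_arrow_exists:
  assumes "a \<in> Obj A" "b \<in> Obj A"
  obtains f where "f \<in> Hom A a b" "zero_arrow A f"
proof -
  obtain z where z: "zero_object A z" using zero_object_exists .
  obtain u v where "u \<in> Hom A a z" "v \<in> Hom A z b"
    using zero_object_arrows[OF z] assms by blast
  with z that[OF comp_hom] zero_arrowI show thesis by blast
qed

text \<open>The additive structure serves only to test the equality of two arrows by the vanishing of a
  third one. The group structure in \<^const>\<open>abelian_category\<close> is existentially quantified and is not
  related there to \<^const>\<open>zero_arrow\<close>; both notions of zero agree because an arrow through a zero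
  object is idempotent for the addition.\<close>

lemma difference_exists:
  assumes f: "f \<in> Hom A a b" and g: "g \<in> Hom A a b"
  obtains d where "d \<in> Hom A a b"
    "\<forall>c. \<forall>h \<in> Hom A c a. zero_arrow A (d \<cdot> h) \<longleftrightarrow> f \<cdot> h = g \<cdot> h"
    "\<forall>c. \<forall>h \<in> Hom A b c. zero_arrow A (h \<cdot> d) \<longleftrightarrow> h \<cdot> f = h \<cdot> g"
proof -
  obtain add ze where pre: "preadditive A add ze"
    using abelian by (auto simp: abelian_category_def)
  define G where "G a b = \<lparr>carrier = Hom A a b, monoid.mult = add, monoid.one = ze a b\<rparr>" for a b
  have G: "comm_group (G a b)" if "a \<in> Obj A" "b \<in> Obj A" for a b
    using pre that unfolding preadditive_def G_def by blast
  have addl: "u \<cdot> add p q = add (u \<cdot> p) (u \<cdot> q)"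
    and addr: "add u u' \<cdot> p = add (u \<cdot> p) (u' \<cdot> p)"
    if "p \<in> Hom A a b" "q \<in> Hom A a b" "u \<in> Hom A b c" "u' \<in> Hom A b c" for a b c p q u u'
    using pre that unfolding preadditive_def by blast+
  have G_simps: "carrier (G a b) = Hom A a b" "mult (G a b) = add" "one (G a b) = ze a b" for a b
    by (simp_all add: G_def)
  have idem: "u = ze a b" if u: "u \<in> Hom A a b" "add u u = u" for u a b
  proof -
    interpret comm_group "G a b" using G hom_obj[OF u(1)] by blast
    show ?thesis using u l_cancel_one[of u u] by (simp add: G_simps)
  qed
  \<comment> \<open>the zero arrows are the neutral elements: an arrow \<open>q p\<close> through a zero object satisfies
    \<open>q + q = q\<close>, as \<open>q\<close> is the only arrow of its kind\<close>
  have zero_iff: "zero_arrow A u \<longleftrightarrow> u = ze a b" if u: "u \<in> Hom A a b" for u a b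
  proof -
    have 1: "w = ze a b" if w: "zero_arrow A w" "w \<in> Hom A a b" for w
    proof -
      obtain z p q where z: "zero_object A z" "p \<in> Hom A a z" "q \<in> Hom A z b" "w = q \<cdot> p"
        using zero_arrowE[OF w] .
      interpret comm_group "G z b" using G hom_obj[OF z(3)] by blast
      have "add q q \<in> Hom A z b" using m_closed[of q q] z(3) by (simp add: G_simps)
      then have "add q q = q"
        using zero_object_arrows(1)[OF z(1) hom_obj(2)[OF z(3)]] z(3) by blast
      then have "add w w = w" using addr[OF z(2,2,3,3)] z(4) by simp
      with idem w(2) show ?thesis by blast
    qed
    obtain w where "w \<in> Hom A a b" "zero_arrow A w"
      using zero_arrow_exists hom_obj[OF u] by blast
    then show ?thesis using 1 u by blast
  qed
  interpret ab: comm_group "G a b" using G hom_obj[OF f] by blast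
  define m where "m = inv\<^bsub>G a b\<^esub> g"
  have m: "m \<in> Hom A a b" "add m g = ze a b"
    using ab.inv_closed[of g] ab.l_inv[of g] g by (simp_all add: m_def G_simps)
  define d where "d = add f m"
  have d: "d \<in> Hom A a b" using ab.m_closed[of f m] f m by (simp add: d_def G_simps)
  have cancel: "add u w = ze p q \<longleftrightarrow> u = v"
    if h: "u \<in> Hom A p q" "v \<in> Hom A p q" "w \<in> Hom A p q" "add w v = ze p q" for u v w p q
  proof -
    interpret comm_group "G p q" using G hom_obj[OF h(1)] by blast
    have "add v w = ze p q" using m_comm[of v w] h by (simp add: G_simps)
    then show ?thesis using right_cancel[of w u v] h(1-3) by (simp add: G_simps)
  qed
  have right: "zero_arrow A (d \<cdot> h) \<longleftrightarrow> f \<cdot> h = g \<cdot> h" if h: "h \<in> Hom A c a" for c h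
  proof -
    have ze: "zero_arrow A (ze a b)" using zero_iff m ab.one_closed by (simp add: G_simps)
    have zeh: "ze a b \<in> Hom A a b" using ab.one_closed by (simp add: G_simps)
    have "add (m \<cdot> h) (g \<cdot> h) = ze a b \<cdot> h" using addr[OF h h m(1) g] m(2) by simp
    also have "\<dots> = ze c b"
      using zero_arrow_comp_right[OF ze h zeh] zero_iff[OF comp_hom[OF h zeh]] by simp
    finally have "add (f \<cdot> h) (m \<cdot> h) = ze c b \<longleftrightarrow> f \<cdot> h = g \<cdot> h"
      by (intro cancel comp_hom[OF h] f g m)
    then show ?thesis
      using zero_iff[OF comp_hom[OF h d]] addr[OF h h f m(1)] by (simp add: d_def)
  qed
  have left: "zero_arrow A (h \<cdot> d) \<longleftrightarrow> h \<cdot> f = h \<cdot> g" if h: "h \<in> Hom A b c" for c h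
  proof -
    have ze: "zero_arrow A (ze a b)" using zero_iff m ab.one_closed by (simp add: G_simps)
    have zeh: "ze a b \<in> Hom A a b" using ab.one_closed by (simp add: G_simps)
    have "add (h \<cdot> m) (h \<cdot> g) = h \<cdot> ze a b" using addl[OF m(1) g h h] m(2) by simp
    also have "\<dots> = ze a c"
      using zero_arrow_comp_left[OF ze zeh h] zero_iff[OF comp_hom[OF zeh h]] by simp
    finally have "add (h \<cdot> f) (h \<cdot> m) = ze a c \<longleftrightarrow> h \<cdot> f = h \<cdot> g"
      by (intro cancel comp_hom[OF _ h] f g m)
    then show ?thesis
      using zero_iff[OF comp_hom[OF d h]] addl[OF f m(1) h h] by (simp add: d_def)
  qed
  show thesis using right left by (intro that[OF d]) simp_all
qed

lemma monic_hom: "f \<in> Hom A a b \<Longrightarrow> monic A f \<longleftrightarrow>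
    (\<forall>c. \<forall>g \<in> Hom A c a. \<forall>h \<in> Hom A c a. f \<cdot> g = f \<cdot> h \<longrightarrow> g = h)"
  by (auto simp: monic_def Hom_def)

lemma epic_hom: "f \<in> Hom A a b \<Longrightarrow> epic A f \<longleftrightarrow>
    (\<forall>c. \<forall>g \<in> Hom A b c. \<forall>h \<in> Hom A b c. g \<cdot> f = h \<cdot> f \<longrightarrow> g = h)"
  by (auto simp: epic_def Hom_def)

lemma monicD: "monic A f \<Longrightarrow> f \<in> Hom A a b \<Longrightarrow> g \<in> Hom A c a \<Longrightarrow> h \<in> Hom A c a \<Longrightarrow>
    f \<cdot> g = f \<cdot> h \<Longrightarrow> g = h"
  by (simp add: monic_hom)

lemma epicD: "epic A f \<Longrightarrow> f \<in> Hom A a b \<Longrightarrow> g \<in> Hom A b c \<Longrightarrow> h \<in> Hom A b c \<Longrightarrow>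
    g \<cdot> f = h \<cdot> f \<Longrightarrow> g = h"
  by (simp add: epic_hom)

lemma monic_cancel_zero:
  assumes "monic A f" "f \<in> Hom A a b" "g \<in> Hom A c a" "zero_arrow A (f \<cdot> g)"
  shows "zero_arrow A g"
proof -
  obtain o' where o': "o' \<in> Hom A c a" "zero_arrow A o'"
    using zero_arrow_exists hom_obj[OF assms(3)] by blast
  have "f \<cdot> g = f \<cdot> o'"
    using zero_arrow_unique[OF assms(4) zero_arrow_comp_left[OF o'(2,1) assms(2)]
        comp_hom[OF assms(3,2)] comp_hom[OF o'(1) assms(2)]] .
  with monicD[OF assms(1-3) o'(1)] o'(2) show ?thesis by simp
qed

lemma epic_cancel_zero:
  assumes "epic A f" "f \<in> Hom A a b" "g \<in> Hom A b c" "zero_arrow A (g \<cdot> f)"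
  shows "zero_arrow A g"
proof -
  obtain o' where o': "o' \<in> Hom A b c" "zero_arrow A o'"
    using zero_arrow_exists hom_obj[OF assms(3)] by blast
  have "g \<cdot> f = o' \<cdot> f"
    using zero_arrow_unique[OF assms(4) zero_arrow_comp_right[OF o'(2) assms(2) o'(1)]
        comp_hom[OF assms(2,3)] comp_hom[OF assms(2) o'(1)]] .
  with epicD[OF assms(1-3) o'(1)] o'(2) show ?thesis by simp
qed

lemma monicI_zero:
  assumes f: "f \<in> Hom A a b"
    and zero: "\<And>c g. g \<in> Hom A c a \<Longrightarrow> zero_arrow A (f \<cdot> g) \<Longrightarrow> zero_arrow A g"
  shows "monic A f"
  unfolding monic_hom[OF f]
proof (intro allI ballI impI)
  fix c g h assume gh: "g \<in> Hom A c a" "h \<in> Hom A c a" "f \<cdot> g = f \<cdot> h"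
  obtain d where d: "d \<in> Hom A c a"
    "\<forall>e. \<forall>k \<in> Hom A e c. zero_arrow A (d \<cdot> k) \<longleftrightarrow> g \<cdot> k = h \<cdot> k"
    "\<forall>e. \<forall>k \<in> Hom A a e. zero_arrow A (k \<cdot> d) \<longleftrightarrow> k \<cdot> g = k \<cdot> h"
    using difference_exists[OF gh(1,2)] .
  have "zero_arrow A (f \<cdot> d)" using d(3) f gh(3) by blast
  then have "zero_arrow A d" using zero d(1) by blast
  with d(2)[rule_format, OF idt_hom[OF hom_obj(1)[OF d(1)]]] show "g = h"
    using comp_idt[OF d(1)] comp_idt[OF gh(1)] comp_idt[OF gh(2)] by simp
qed

lemma epicI_zero:
  assumes f: "f \<in> Hom A a b"
    and zero: "\<And>c g. g \<in> Hom A b c \<Longrightarrow> zero_arrow A (g \<cdot> f) \<Longrightarrow> zero_arrow A g"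
  shows "epic A f"
  unfolding epic_hom[OF f]
proof (intro allI ballI impI)
  fix c g h assume gh: "g \<in> Hom A b c" "h \<in> Hom A b c" "g \<cdot> f = h \<cdot> f"
  obtain d where d: "d \<in> Hom A b c"
    "\<forall>e. \<forall>k \<in> Hom A e b. zero_arrow A (d \<cdot> k) \<longleftrightarrow> g \<cdot> k = h \<cdot> k"
    "\<forall>e. \<forall>k \<in> Hom A c e. zero_arrow A (k \<cdot> d) \<longleftrightarrow> k \<cdot> g = k \<cdot> h"
    using difference_exists[OF gh(1,2)] .
  have "zero_arrow A (d \<cdot> f)" using d(2) f gh(3) by blast
  then have "zero_arrow A d" using zero d(1) by blast
  with d(2)[rule_format, OF idt_hom[OF hom_obj(1)[OF d(1)]]] show "g = h"
    using comp_idt[OF d(1)] comp_idt[OF gh(1)] comp_idt[OF gh(2)] by simp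
qed

lemma is_kernelD:
  assumes ker: "is_kernel A f k" and f: "f \<in> Hom A a b"
  shows "k \<in> Hom A (Dom A k) a" "zero_arrow A (f \<cdot> k)" "monic A k"
    "\<And>c g. g \<in> Hom A c a \<Longrightarrow> zero_arrow A (f \<cdot> g) \<Longrightarrow> \<exists>h \<in> Hom A c (Dom A k). k \<cdot> h = g"
proof -
  show k: "k \<in> Hom A (Dom A k) a" and z: "zero_arrow A (f \<cdot> k)"
    using ker HomD[OF f] by (auto simp: is_kernel_def Hom_def)
  have univ: "\<exists>!h. h \<in> Hom A c (Dom A k) \<and> k \<cdot> h = g"
    if g: "g \<in> Hom A c a" "zero_arrow A (f \<cdot> g)" for c g
  proof -
    have "\<forall>g \<in> Arr A. Cod A g = Dom A f \<and> zero_arrow A (f \<cdot> g) \<longrightarrow>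
        (\<exists>!h. h \<in> Hom A (Dom A g) (Dom A k) \<and> k \<cdot> h = g)"
      using ker unfolding is_kernel_def by (elim conjE)
    from this[rule_format, OF HomD(1)[OF g(1)]] show ?thesis
      using HomD[OF f] HomD[OF g(1)] g(2) by (simp only: simp_thms)
  qed
  show "\<exists>h \<in> Hom A c (Dom A k). k \<cdot> h = g"
    if "g \<in> Hom A c a" "zero_arrow A (f \<cdot> g)" for c g
    using ex1_implies_ex[OF univ[OF that]] by (simp only: Bex_def)
  show "monic A k"
    unfolding monic_hom[OF k]
  proof (intro allI ballI impI)
    fix c g h assume gh: "g \<in> Hom A c (Dom A k)" "h \<in> Hom A c (Dom A k)" "k \<cdot> g = k \<cdot> h"
    have fkg: "zero_arrow A (f \<cdot> (k \<cdot> g))"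
      using zero_arrow_comp_right[OF z gh(1) comp_hom[OF k f]] comp_assoc[OF gh(1) k f] by simp
    show "g = h"
      by (rule ex1_unique[OF univ[OF comp_hom[OF gh(1) k] fkg]]) (simp_all add: gh)
  qed
qed

lemma is_cokernelD:
  assumes coker: "is_cokernel A f p" and f: "f \<in> Hom A a b"
  shows "p \<in> Hom A b (Cod A p)" "zero_arrow A (p \<cdot> f)" "epic A p"
    "\<And>c g. g \<in> Hom A b c \<Longrightarrow> zero_arrow A (g \<cdot> f) \<Longrightarrow> \<exists>h \<in> Hom A (Cod A p) c. h \<cdot> p = g"
proof -
  show p: "p \<in> Hom A b (Cod A p)" and z: "zero_arrow A (p \<cdot> f)"
    using coker HomD[OF f] by (auto simp: is_cokernel_def Hom_def)
  have univ: "\<exists>!h. h \<in> Hom A (Cod A p) c \<and> h \<cdot> p = g"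
    if g: "g \<in> Hom A b c" "zero_arrow A (g \<cdot> f)" for c g
  proof -
    have "\<forall>g \<in> Arr A. Dom A g = Cod A f \<and> zero_arrow A (g \<cdot> f) \<longrightarrow>
        (\<exists>!h. h \<in> Hom A (Cod A p) (Cod A g) \<and> h \<cdot> p = g)"
      using coker unfolding is_cokernel_def by (elim conjE)
    from this[rule_format, OF HomD(1)[OF g(1)]] show ?thesis
      using HomD[OF f] HomD[OF g(1)] g(2) by (simp only: simp_thms)
  qed
  show "\<exists>h \<in> Hom A (Cod A p) c. h \<cdot> p = g"
    if "g \<in> Hom A b c" "zero_arrow A (g \<cdot> f)" for c g
    using ex1_implies_ex[OF univ[OF that]] by (simp only: Bex_def)
  show "epic A p"
    unfolding epic_hom[OF p]
  proof (intro allI ballI impI)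
    fix c g h assume gh: "g \<in> Hom A (Cod A p) c" "h \<in> Hom A (Cod A p) c" "g \<cdot> p = h \<cdot> p"
    have gpf: "zero_arrow A ((g \<cdot> p) \<cdot> f)"
      using zero_arrow_comp_left[OF z comp_hom[OF f p] gh(1)] comp_assoc[OF f p gh(1)] by simp
    show "g = h"
      by (rule ex1_unique[OF univ[OF comp_hom[OF p gh(1)] gpf]]) (simp_all add: gh)
  qed
qed

lemma kernel_exists:
  assumes "f \<in> Hom A a b"
  obtains x k where "k \<in> Hom A x a" "zero_arrow A (f \<cdot> k)" "monic A k"
    "\<forall>c. \<forall>g \<in> Hom A c a. zero_arrow A (f \<cdot> g) \<longrightarrow> (\<exists>h \<in> Hom A c x. k \<cdot> h = g)"
proof -
  obtain k where k: "is_kernel A f k"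
    using abelian HomD(1)[OF assms] by (auto simp: abelian_category_def)
  show thesis using is_kernelD(4)[OF k assms] by (intro that[OF is_kernelD(1-3)[OF k assms]]) simp
qed

lemma cokernel_exists:
  assumes "f \<in> Hom A a b"
  obtains x p where "p \<in> Hom A b x" "zero_arrow A (p \<cdot> f)" "epic A p"
    "\<forall>c. \<forall>g \<in> Hom A b c. zero_arrow A (g \<cdot> f) \<longrightarrow> (\<exists>h \<in> Hom A x c. h \<cdot> p = g)"
proof -
  obtain p where p: "is_cokernel A f p"
    using abelian HomD(1)[OF assms] by (auto simp: abelian_category_def)
  show thesis using is_cokernelD(4)[OF p assms] by (intro that[OF is_cokernelD(1-3)[OF p assms]]) simp
qed

lemma monic_factors:
  assumes "monic A m" "m \<in> Hom A a b"
  obtains q c where "q \<in> Hom A b c"  "zero_arrow A (q \<cdot> m)"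
    "\<forall>d. \<forall>g \<in> Hom A d b. zero_arrow A (q \<cdot> g) \<longrightarrow> (\<exists>h \<in> Hom A d a. m \<cdot> h = g)"
proof -
  obtain q where q: "is_kernel A q m"
    using abelian assms by (auto simp: abelian_category_def)
  then have qh: "q \<in> Hom A b (Cod A q)"
    using HomD[OF assms(2)] by (auto simp: is_kernel_def Hom_def)
  show thesis
    using is_kernelD(4)[OF q qh] HomD(2)[OF assms(2)]
    by (intro that[OF qh is_kernelD(2)[OF q qh]]) simp
qed

text \<open>An epimorphism of an abelian category is the cokernel of its kernel.\<close>

lemma epic_factors:
  assumes e: "epic A e" "e \<in> Hom A a b" and f: "f \<in> Hom A a c"
    and ker: "\<And>d k. k \<in> Hom A d a \<Longrightarrow> zero_arrow A (e \<cdot> k) \<Longrightarrow> zero_arrow A (f \<cdot> k)"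
  shows "\<exists>h \<in> Hom A b c. h \<cdot> e = f"
proof -
  obtain k where k: "is_cokernel A k e"
    using abelian e by (auto simp: abelian_category_def)
  then have kh: "k \<in> Hom A (Dom A k) a"
    using HomD[OF e(2)] by (auto simp: is_cokernel_def Hom_def)
  show ?thesis
    using is_cokernelD(4)[OF k kh f] ker[OF kh is_cokernelD(2)[OF k kh]] HomD(3)[OF e(2)] by simp
qed

lemma monic_comp:
  assumes "monic A f" "monic A g" "f \<in> Hom A a b" "g \<in> Hom A b c"
  shows "monic A (g \<cdot> f)"
proof (rule monicI_zero[OF comp_hom[OF assms(3,4)]])
  fix d h assume h: "h \<in> Hom A d a" "zero_arrow A ((g \<cdot> f) \<cdot> h)"
  then have "zero_arrow A (g \<cdot> (f \<cdot> h))" using comp_assoc[OF h(1) assms(3,4)] by simp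
  then show "zero_arrow A h"
    using monic_cancel_zero assms comp_hom[OF h(1) assms(3)] h(1) by blast
qed

text \<open>The image \<open>m\<close> is the kernel of the cokernel of \<open>f\<close>. If \<open>d e\<close> vanishes, then \<open>e\<close> factors through
  the kernel \<open>k\<close> of \<open>d\<close>; the monomorphism \<open>m k\<close> is a kernel of some \<open>q\<close>, which kills \<open>f\<close> and hence \<open>m\<close>,
  so that \<open>k\<close> is split and \<open>d\<close> vanishes. The last property says that \<open>m\<close> is no larger than the
  image.\<close>

lemma epi_mono_factorization:
  assumes f: "f \<in> Hom A a b"
  obtains i e m where "e \<in> Hom A a i" "m \<in> Hom A i b" "m \<cdot> e = f" "epic A e" "monic A m"
    "\<forall>c. \<forall>r \<in> Hom A b c. zero_arrow A (r \<cdot> f) \<longrightarrow> zero_arrow A (r \<cdot> m)"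
proof -
  obtain y p where p: "p \<in> Hom A b y" "zero_arrow A (p \<cdot> f)" "epic A p"
    "\<forall>c. \<forall>g \<in> Hom A b c. zero_arrow A (g \<cdot> f) \<longrightarrow> (\<exists>h \<in> Hom A y c. h \<cdot> p = g)"
    using cokernel_exists[OF f] .
  obtain i m where m: "m \<in> Hom A i b" "zero_arrow A (p \<cdot> m)" "monic A m"
    "\<forall>c. \<forall>g \<in> Hom A c b. zero_arrow A (p \<cdot> g) \<longrightarrow> (\<exists>h \<in> Hom A c i. m \<cdot> h = g)"
    using kernel_exists[OF p(1)] .
  obtain e where e: "e \<in> Hom A a i" "m \<cdot> e = f" using m(4)[rule_format, OF f p(2)] by blast
  have coann: "zero_arrow A (r \<cdot> m)" if r: "r \<in> Hom A b c" "zero_arrow A (r \<cdot> f)" for c r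
  proof -
    obtain h where h: "h \<in> Hom A y c" "h \<cdot> p = r" using p(4)[rule_format, OF r] by blast
    then show ?thesis
      using zero_arrow_comp_left[OF m(2) comp_hom[OF m(1) p(1)] h(1)]
        comp_assoc[OF m(1) p(1) h(1)] by simp
  qed
  have "epic A e"
  proof (rule epicI_zero[OF e(1)])
    fix c d assume d: "d \<in> Hom A i c" "zero_arrow A (d \<cdot> e)"
    obtain x k where k: "k \<in> Hom A x i" "zero_arrow A (d \<cdot> k)" "monic A k"
      "\<forall>c. \<forall>g \<in> Hom A c i. zero_arrow A (d \<cdot> g) \<longrightarrow> (\<exists>h \<in> Hom A c x. k \<cdot> h = g)"
      using kernel_exists[OF d(1)] .
    obtain e' where e': "e' \<in> Hom A a x" "k \<cdot> e' = e" using k(4)[rule_format, OF e(1) d(2)] by blast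
    have mk: "m \<cdot> k \<in> Hom A x b" "monic A (m \<cdot> k)"
      using comp_hom[OF k(1) m(1)] monic_comp[OF k(3) m(3) k(1) m(1)] .
    obtain c' q where q: "q \<in> Hom A b c'"  "zero_arrow A (q \<cdot> (m \<cdot> k))"
      "\<forall>d. \<forall>g \<in> Hom A d b. zero_arrow A (q \<cdot> g) \<longrightarrow> (\<exists>h \<in> Hom A d x. (m \<cdot> k) \<cdot> h = g)"
      using monic_factors[OF mk(2,1)] .
    have "f = (m \<cdot> k) \<cdot> e'" using comp_assoc[OF e'(1) k(1) m(1)] e'(2) e(2) by simp
    then have "q \<cdot> f = (q \<cdot> (m \<cdot> k)) \<cdot> e'" using comp_assoc[OF e'(1) mk(1) q(1)] by simp
    then have "zero_arrow A (q \<cdot> f)"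
      using zero_arrow_comp_right[OF q(2) e'(1) comp_hom[OF mk(1) q(1)]] by simp
    then have "zero_arrow A (q \<cdot> m)" using coann q(1) by blast
    then obtain l where l: "l \<in> Hom A i x" "(m \<cdot> k) \<cdot> l = m" using q(3)[rule_format, OF m(1)] by blast
    have "m \<cdot> (k \<cdot> l) = m \<cdot> Idt A i" using l comp_assoc[OF l(1) k(1) m(1)] comp_idt[OF m(1)] by simp
    then have kl: "k \<cdot> l = Idt A i"
      using monicD[OF m(3,1) comp_hom[OF l(1) k(1)] idt_hom[OF hom_obj(1)[OF m(1)]]] by simp
    have "zero_arrow A ((d \<cdot> k) \<cdot> l)"
      by (rule zero_arrow_comp_right[OF k(2) l(1) comp_hom[OF k(1) d(1)]])
    then show "zero_arrow A d"
      using comp_assoc[OF l(1) k(1) d(1)] kl comp_idt[OF d(1)] by simp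
  qed
  then show thesis using coann by (intro that[OF e(1) m(1) e(2) _ m(3)]) simp_all
qed

end

section \<open>Subobjects as annihilators\<close>

context abelian
begin

definition annihilated :: "'n \<Rightarrow> 'n set" where
  "annihilated q = {f \<in> Arr A. Cod A f = Dom A q \<and> zero_arrow A (q \<cdot> f)}"

text \<open>As every monomorphism is a kernel, the subobjects of \<open>c\<close> correspond to these sets: a subobject is
  identified with the arrows that factor through it. Taking \<open>q\<close> epic makes it unique up to
  isomorphism, as the quotient of \<open>c\<close> by the subobject.\<close>

definition subobjects :: "'p \<Rightarrow> 'n set set" where
  "subobjects c = {annihilated q | q. epic A q \<and> Dom A q = c}"

definition preimage :: "'n \<Rightarrow> 'n set \<Rightarrow> 'n set" where
  "preimage i S = {f \<in> Arr A. Cod A f = Dom A i \<and> i \<cdot> f \<in> S}"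

text \<open>The arrows through the image of a subobject need not lift to it, so the image is described by
  the arrows \<open>s\<close> that kill it.\<close>

definition direct_image :: "'n \<Rightarrow> 'n set \<Rightarrow> 'n set" where
  "direct_image p S = {g \<in> Arr A. Cod A g = Cod A p \<and>
    (\<forall>s \<in> Arr A. Dom A s = Cod A p \<and> (\<forall>f \<in> S. zero_arrow A (s \<cdot> (p \<cdot> f))) \<longrightarrow> zero_arrow A (s \<cdot> g))}"

lemma annihilated_iff:
  assumes "q \<in> Hom A c d"
  shows "f \<in> annihilated q \<longleftrightarrow> (\<exists>a. f \<in> Hom A a c) \<and> zero_arrow A (q \<cdot> f)"
  using HomD[OF assms] by (auto simp: annihilated_def Hom_def)

text \<open>Replacing \<open>q\<close> by the cokernel of its kernel makes it epic and annihilates the same arrows.\<close>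

lemma annihilated_is_subobject:
  assumes q: "q \<in> Hom A c d"
  shows "annihilated q \<in> subobjects c"
proof -
  obtain x k where k: "k \<in> Hom A x c" "zero_arrow A (q \<cdot> k)" "monic A k"
    "\<forall>a. \<forall>g \<in> Hom A a c. zero_arrow A (q \<cdot> g) \<longrightarrow> (\<exists>h \<in> Hom A a x. k \<cdot> h = g)"
    using kernel_exists[OF q] .
  obtain y p where p: "p \<in> Hom A c y" "zero_arrow A (p \<cdot> k)" "epic A p"
    "\<forall>a. \<forall>g \<in> Hom A c a. zero_arrow A (g \<cdot> k) \<longrightarrow> (\<exists>h \<in> Hom A y a. h \<cdot> p = g)"
    using cokernel_exists[OF k(1)] .
  obtain u where u: "u \<in> Hom A y d" "u \<cdot> p = q" using p(4) q k(2) by blast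
  have "zero_arrow A (q \<cdot> f) \<longleftrightarrow> zero_arrow A (p \<cdot> f)" if f: "f \<in> Hom A a c" for a f
  proof
    assume "zero_arrow A (q \<cdot> f)"
    then obtain h where h: "h \<in> Hom A a x" "k \<cdot> h = f" using k(4) f by blast
    show "zero_arrow A (p \<cdot> f)"
      using zero_arrow_comp_right[OF p(2) h(1) comp_hom[OF k(1) p(1)]]
        comp_assoc[OF h(1) k(1) p(1)] h(2) by simp
  next
    assume "zero_arrow A (p \<cdot> f)"
    from zero_arrow_comp_left[OF this comp_hom[OF f p(1)] u(1)]
    show "zero_arrow A (q \<cdot> f)" using comp_assoc[OF f p(1) u(1)] u(2) by simp
  qed
  then have "annihilated q = annihilated p"
    using annihilated_iff[OF q] annihilated_iff[OF p(1)] by blast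
  then show ?thesis using p(3) HomD[OF p(1)] by (auto simp: subobjects_def)
qed

lemma subobjectE:
  assumes "S \<in> subobjects c"
  obtains q d where "q \<in> Hom A c d" "epic A q" "S = annihilated q"
proof -
  obtain q where q: "epic A q" "Dom A q = c" "S = annihilated q"
    using assms by (auto simp: subobjects_def)
  then have "q \<in> Hom A c (Cod A q)" by (auto simp: epic_def Hom_def)
  then show thesis using q that by blast
qed

lemma subobject_hom:
  assumes "S \<in> subobjects c" "f \<in> S"
  shows "f \<in> Hom A (Dom A f) c"
proof -
  obtain q d where "q \<in> Hom A c d" "S = annihilated q" using subobjectE[OF assms(1)] by blast
  then show ?thesis using assms(2) by (auto simp: annihilated_def Hom_def)
qed

lemma subobject_generator:
  assumes "S \<in> subobjects c"
  obtains x k where "k \<in> Hom A x c" "monic A k" "\<forall>a. \<forall>f \<in> Hom A a c. f \<in> S \<longleftrightarrow> (\<exists>h \<in> Hom A a x. k \<cdot> h = f)"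
proof -
  obtain q d where q: "q \<in> Hom A c d" "epic A q" "S = annihilated q" using subobjectE[OF assms] .
  obtain x k where k: "k \<in> Hom A x c" "zero_arrow A (q \<cdot> k)" "monic A k"
    "\<forall>a. \<forall>g \<in> Hom A a c. zero_arrow A (q \<cdot> g) \<longrightarrow> (\<exists>h \<in> Hom A a x. k \<cdot> h = g)"
    using kernel_exists[OF q(1)] .
  have "f \<in> S \<longleftrightarrow> (\<exists>h \<in> Hom A a x. k \<cdot> h = f)" if f: "f \<in> Hom A a c" for a f
  proof
    assume "f \<in> S"
    then show "\<exists>h \<in> Hom A a x. k \<cdot> h = f" using k(4) f by (auto simp: q(3) annihilated_def)
  next
    assume "\<exists>h \<in> Hom A a x. k \<cdot> h = f"
    then obtain h where h: "h \<in> Hom A a x" "k \<cdot> h = f" ..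
    show "f \<in> S"
      using zero_arrow_comp_right[OF k(2) h(1) comp_hom[OF k(1) q(1)]]
        comp_assoc[OF h(1) k(1) q(1)] h(2) f unfolding q(3) annihilated_iff[OF q(1)] by auto
  qed
  then show thesis using that[OF k(1,3)] by blast
qed

lemma annihilated_mono_factor:
  assumes q: "q \<in> Hom A c d" "epic A q" and q': "q' \<in> Hom A c d'"
    and le: "annihilated q \<subseteq> annihilated q'"
  obtains u where "u \<in> Hom A d d'" "u \<cdot> q = q'"
proof -
  have "\<exists>u \<in> Hom A d d'. u \<cdot> q = q'"
  proof (rule epic_factors[OF q(2,1) q'])
    fix a k assume "k \<in> Hom A a c" "zero_arrow A (q \<cdot> k)"
    then show "zero_arrow A (q' \<cdot> k)"
      using le annihilated_iff[OF q(1)] annihilated_iff[OF q'] by blast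
  qed
  with that show thesis by blast
qed

lemma annihilated_mono:
  assumes "q \<in> Hom A c d" "u \<in> Hom A d d'"
  shows "annihilated q \<subseteq> annihilated (u \<cdot> q)"
proof
  fix f assume "f \<in> annihilated q"
  then obtain a where f: "f \<in> Hom A a c" "zero_arrow A (q \<cdot> f)"
    unfolding annihilated_iff[OF assms(1)] by blast
  then have "zero_arrow A (u \<cdot> (q \<cdot> f))"
    using zero_arrow_comp_left comp_hom assms by blast
  then show "f \<in> annihilated (u \<cdot> q)"
    using f(1) comp_assoc[OF f(1) assms]
    unfolding annihilated_iff[OF comp_hom[OF assms]] by auto
qed

lemma preimage_annihilated:
  assumes i: "i \<in> Hom A a b" and q: "q \<in> Hom A b c"
  shows "preimage i (annihilated q) = annihilated (q \<cdot> i)"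
proof (intro Set.set_eqI)
  fix f
  show "f \<in> preimage i (annihilated q) \<longleftrightarrow> f \<in> annihilated (q \<cdot> i)"
  proof (cases "f \<in> Hom A (Dom A f) a")
    case True
    then show ?thesis
      using comp_assoc[OF True i q] comp_hom[OF True i] HomD[OF True] HomD[OF i] 
      unfolding annihilated_iff[OF comp_hom[OF i q]] preimage_def mem_Collect_eq annihilated_iff[OF q]
      by auto
  next
    case False
    then show ?thesis
      using HomD[OF i] HomD[OF comp_hom[OF i q]] by (auto simp: preimage_def annihilated_def Hom_def)
  qed
qed

lemma preimage_is_subobject:
  assumes i: "i \<in> Hom A a b" and S: "S \<in> subobjects b"
  shows "preimage i S \<in> subobjects a"
proof -
  obtain q d where q: "q \<in> Hom A b d" "S = annihilated q" using subobjectE[OF S] by blast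
  show ?thesis
    using annihilated_is_subobject[OF comp_hom[OF i q(1)]] preimage_annihilated[OF i q(1)] q(2) by simp
qed

lemma preimage_mono: "S \<subseteq> S' \<Longrightarrow> preimage i S \<subseteq> preimage i S'"
  by (auto simp: preimage_def)

lemma direct_image_mono:
  assumes "S \<subseteq> S'" shows "direct_image p S \<subseteq> direct_image p S'"
  using assms unfolding direct_image_def by blast

lemma direct_image_iff:
  assumes "p \<in> Hom A b d" "g \<in> Hom A a d"
  shows "g \<in> direct_image p S \<longleftrightarrow>
    (\<forall>c. \<forall>s \<in> Hom A d c. (\<forall>f \<in> S. zero_arrow A (s \<cdot> (p \<cdot> f))) \<longrightarrow> zero_arrow A (s \<cdot> g))"
  using HomD[OF assms(1)] HomD[OF assms(2)] unfolding direct_image_def by (auto simp: Hom_def)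

lemma direct_image_is_subobject:
  assumes p: "p \<in> Hom A b d" and S: "S \<in> subobjects b"
  shows "direct_image p S \<in> subobjects d"
proof -
  obtain x k where k: "k \<in> Hom A x b" "monic A k"
    "\<forall>a. \<forall>f \<in> Hom A a b. f \<in> S \<longleftrightarrow> (\<exists>h \<in> Hom A a x. k \<cdot> h = f)"
    using subobject_generator[OF S] .
  have pk: "p \<cdot> k \<in> Hom A x d" using comp_hom[OF k(1) p] .
  obtain y c where c: "c \<in> Hom A d y" "zero_arrow A (c \<cdot> (p \<cdot> k))" "epic A c"
    "\<forall>a. \<forall>g \<in> Hom A d a. zero_arrow A (g \<cdot> (p \<cdot> k)) \<longrightarrow> (\<exists>h \<in> Hom A y a. h \<cdot> c = g)"
    using cokernel_exists[OF pk] .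
  have kS: "k \<in> S"
    using k(3)[rule_format, OF k(1)] idt_hom[OF hom_obj(1)[OF k(1)]] comp_idt[OF k(1)] by blast
  have c_kills: "zero_arrow A (c \<cdot> (p \<cdot> f))" if f: "f \<in> S" for f
  proof -
    obtain h where h: "h \<in> Hom A (Dom A f) x" "k \<cdot> h = f"
      using k(3)[rule_format, OF subobject_hom[OF S f]] f by blast
    show ?thesis
      using zero_arrow_comp_right[OF c(2) h(1) comp_hom[OF pk c(1)]]
        comp_assoc[OF h(1) pk c(1)] comp_assoc[OF h(1) k(1) p] h(2) by simp
  qed
  have "g \<in> direct_image p S \<longleftrightarrow> zero_arrow A (c \<cdot> g)" if g: "g \<in> Hom A a d" for a g
    unfolding direct_image_iff[OF p g]
  proof (intro iffI allI ballI impI)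
    assume "\<forall>e. \<forall>s \<in> Hom A d e. (\<forall>f \<in> S. zero_arrow A (s \<cdot> (p \<cdot> f))) \<longrightarrow> zero_arrow A (s \<cdot> g)"
    from bspec[OF spec[OF this] c(1)] show "zero_arrow A (c \<cdot> g)" using c_kills by simp
  next
    fix e s assume s: "zero_arrow A (c \<cdot> g)" "s \<in> Hom A d e" "\<forall>f \<in> S. zero_arrow A (s \<cdot> (p \<cdot> f))"
    then obtain h where h: "h \<in> Hom A y e" "h \<cdot> c = s"
      using c(4)[rule_format, OF s(2)] kS by blast
    show "zero_arrow A (s \<cdot> g)"
      using zero_arrow_comp_left[OF s(1) comp_hom[OF g c(1)] h(1)]
        comp_assoc[OF g c(1) h(1)] h(2) by simp
  qed
  note iff = this
  have "direct_image p S = annihilated c"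
  proof (rule Set.set_eqI)
    fix g
    show "g \<in> direct_image p S \<longleftrightarrow> g \<in> annihilated c"
    proof (cases "g \<in> Hom A (Dom A g) d")
      case True
      show ?thesis using iff[OF True] annihilated_iff[OF c(1), of g] True by blast
    next
      case False
      then show ?thesis
        using HomD(3)[OF p] HomD(2)[OF c(1)] by (auto simp: direct_image_def annihilated_def Hom_def)
    qed
  qed
  then show ?thesis using annihilated_is_subobject[OF c(1)] by simp
qed

text \<open>This is the short five lemma for the quotients \<open>q\<close> and \<open>q'\<close> of \<open>b\<close> by \<open>S\<close> and \<open>S'\<close>. They are
  connected by \<open>u\<close>, and both are extensions of a quotient of \<open>d\<close> by the image of \<open>a\<close>; the assumption on
  preimages makes \<open>u\<close> injective on the image of \<open>a\<close>, the one on direct images puts the kernel of \<open>u\<close>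
  inside that image.\<close>

lemma subobjects_compared_by_preimage_and_image:
  assumes i: "i \<in> Hom A a b" and p: "p \<in> Hom A b d"
    and coker: "\<And>c g. g \<in> Hom A b c \<Longrightarrow> zero_arrow A (g \<cdot> i) \<Longrightarrow> \<exists>h \<in> Hom A d c. h \<cdot> p = g"
    and S: "S \<in> subobjects b" and S': "S' \<in> subobjects b" and le: "S \<subseteq> S'"
    and pre: "preimage i S' \<subseteq> preimage i S" and im: "direct_image p S' \<subseteq> direct_image p S"
  shows "S' \<subseteq> S"
proof
  fix f assume f: "f \<in> S'"
  obtain e q where q: "q \<in> Hom A b e" "epic A q" "S = annihilated q" using subobjectE[OF S] .
  obtain e' q' where q': "q' \<in> Hom A b e'" "epic A q'" "S' = annihilated q'" using subobjectE[OF S'] .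
  obtain u where u: "u \<in> Hom A e e'" "u \<cdot> q = q'"
    using annihilated_mono_factor[OF q(1,2) q'(1)] le q(3) q'(3) by blast
  have fh: "f \<in> Hom A (Dom A f) b" and q'f: "zero_arrow A (q' \<cdot> f)"
    using subobject_hom[OF S' f] f q'(3) by (simp_all add: annihilated_def)
  have qi: "q \<cdot> i \<in> Hom A a e" and q'i: "q' \<cdot> i \<in> Hom A a e'"
    using comp_hom[OF i q(1)] comp_hom[OF i q'(1)] .
  obtain j t m where tm: "t \<in> Hom A a j" "m \<in> Hom A j e" "m \<cdot> t = q \<cdot> i" "epic A t" "monic A m"
    "\<forall>c. \<forall>r \<in> Hom A e c. zero_arrow A (r \<cdot> (q \<cdot> i)) \<longrightarrow> zero_arrow A (r \<cdot> m)"
    using epi_mono_factorization[OF qi] .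
  obtain j' t' m' where tm': "t' \<in> Hom A a j'" "m' \<in> Hom A j' e'" "m' \<cdot> t' = q' \<cdot> i"
    "epic A t'" "monic A m'"
    "\<forall>c. \<forall>r \<in> Hom A e' c. zero_arrow A (r \<cdot> (q' \<cdot> i)) \<longrightarrow> zero_arrow A (r \<cdot> m')"
    using epi_mono_factorization[OF q'i] .
  \<comment> \<open>\<open>q f\<close> factors through the image \<open>m\<close> of \<open>q i\<close>: an arrow \<open>r\<close> with
    kernel \<open>m\<close> satisfies \<open>r q = s p\<close>, and \<open>s\<close> annihilates the direct image of \<open>S\<close>,
    to which \<open>p f\<close> belongs\<close>
  obtain c r where r: "r \<in> Hom A e c" "zero_arrow A (r \<cdot> m)"
    "\<forall>d. \<forall>g \<in> Hom A d e. zero_arrow A (r \<cdot> g) \<longrightarrow> (\<exists>h \<in> Hom A d j. m \<cdot> h = g)"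
    using monic_factors[OF tm(5,2)] .
  have rq: "r \<cdot> q \<in> Hom A b c" using comp_hom[OF q(1) r(1)] .
  have "zero_arrow A ((r \<cdot> m) \<cdot> t)"
    by (rule zero_arrow_comp_right[OF r(2) tm(1) comp_hom[OF tm(2) r(1)]])
  then have "zero_arrow A ((r \<cdot> q) \<cdot> i)"
    using comp_assoc[OF tm(1,2) r(1)] comp_assoc[OF i q(1) r(1)] tm(3) by simp
  then obtain s where s: "s \<in> Hom A d c" "s \<cdot> p = r \<cdot> q" using coker[OF rq] by blast
  have "zero_arrow A (s \<cdot> (p \<cdot> g))" if g: "g \<in> S" for g
  proof -
    have gh: "g \<in> Hom A (Dom A g) b" and "zero_arrow A (q \<cdot> g)"
      using subobject_hom[OF S g] g q(3) by (simp_all add: annihilated_def)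
    then have "zero_arrow A (r \<cdot> (q \<cdot> g))"
      using zero_arrow_comp_left[OF _ comp_hom[OF gh q(1)] r(1)] by blast
    then show ?thesis
      using comp_assoc[OF gh q(1) r(1)] comp_assoc[OF gh p s(1)] s(2) by simp
  qed
  moreover have "p \<cdot> f \<in> direct_image p S'"
    using f unfolding direct_image_iff[OF p comp_hom[OF fh p]] by blast
  ultimately have "zero_arrow A (s \<cdot> (p \<cdot> f))"
    using im s(1) direct_image_iff[OF p comp_hom[OF fh p], of S] by blast
  then have "zero_arrow A (r \<cdot> (q \<cdot> f))"
    using comp_assoc[OF fh q(1) r(1)] comp_assoc[OF fh p s(1)] s(2) by simp
  then obtain h where h: "h \<in> Hom A (Dom A f) j" "m \<cdot> h = q \<cdot> f"
    using r(3) comp_hom[OF fh q(1)] by blast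
  \<comment> \<open>\<open>t\<close> and \<open>t'\<close> have the same kernel, so that \<open>u m\<close> is as monic as \<open>m'\<close>\<close>
  have ker_t: "zero_arrow A (t \<cdot> k)" if k: "k \<in> Hom A x a" "zero_arrow A (t' \<cdot> k)" for x k
  proof -
    have "zero_arrow A (m' \<cdot> (t' \<cdot> k))"
      by (rule zero_arrow_comp_left[OF k(2) comp_hom[OF k(1) tm'(1)] tm'(2)])
    then have "zero_arrow A ((q' \<cdot> i) \<cdot> k)" using comp_assoc[OF k(1) tm'(1,2)] tm'(3) by simp
    then have "k \<in> preimage i S'"
      using k(1) unfolding q'(3) preimage_annihilated[OF i q'(1)] annihilated_iff[OF q'i] by blast
    then have "k \<in> annihilated (q \<cdot> i)"
      using pre unfolding q(3) preimage_annihilated[OF i q(1)] by blast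
    then have "zero_arrow A ((m \<cdot> t) \<cdot> k)" unfolding annihilated_iff[OF qi] tm(3) by blast
    then have "zero_arrow A (m \<cdot> (t \<cdot> k))" using comp_assoc[OF k(1) tm(1,2)] by simp
    then show ?thesis using monic_cancel_zero[OF tm(5,2) comp_hom[OF k(1) tm(1)]] by blast
  qed
  have "\<exists>v \<in> Hom A j' j. v \<cdot> t' = t"
    by (rule epic_factors[OF tm'(4,1) tm(1)]) (rule ker_t)
  then obtain v where v: "v \<in> Hom A j' j" "v \<cdot> t' = t" ..
  have um: "u \<cdot> m \<in> Hom A j e'" using comp_hom[OF tm(2) u(1)] .
  have ker_t': "zero_arrow A (t' \<cdot> k)" if k: "k \<in> Hom A x a" "zero_arrow A (t \<cdot> k)" for x k
  proof -
    have "zero_arrow A ((u \<cdot> m) \<cdot> (t \<cdot> k))"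
      by (rule zero_arrow_comp_left[OF k(2) comp_hom[OF k(1) tm(1)] um])
    moreover have "(u \<cdot> m) \<cdot> (t \<cdot> k) = m' \<cdot> (t' \<cdot> k)"
      using comp_assoc[OF k(1) tm(1) um] comp_assoc[OF tm(1,2) u(1)] comp_assoc[OF i q(1) u(1)]
        comp_assoc[OF k(1) tm'(1,2)] tm(3) tm'(3) u(2) by simp
    ultimately have "zero_arrow A (m' \<cdot> (t' \<cdot> k))" by simp
    then show ?thesis using monic_cancel_zero[OF tm'(5,2) comp_hom[OF k(1) tm'(1)]] by blast
  qed
  have "\<exists>v' \<in> Hom A j j'. v' \<cdot> t = t'"
    by (rule epic_factors[OF tm(4,1) tm'(1)]) (rule ker_t')
  then obtain v' where v': "v' \<in> Hom A j j'" "v' \<cdot> t = t'" ..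
  have m'v': "m' \<cdot> v' = u \<cdot> m"
  proof (rule epicD[OF tm(4,1) comp_hom[OF v'(1) tm'(2)] um])
    show "(m' \<cdot> v') \<cdot> t = (u \<cdot> m) \<cdot> t"
      using comp_assoc[OF tm(1) v'(1) tm'(2)] comp_assoc[OF tm(1,2) u(1)] comp_assoc[OF i q(1) u(1)]
        v'(2) tm'(3) tm(3) u(2) by simp
  qed
  have vv': "v \<cdot> v' = Idt A j"
  proof (rule epicD[OF tm(4,1) comp_hom[OF v'(1) v(1)] idt_hom[OF hom_obj(2)[OF tm(1)]]])
    show "(v \<cdot> v') \<cdot> t = Idt A j \<cdot> t"
      using comp_assoc[OF tm(1) v'(1) v(1)] v'(2) v(2) idt_comp[OF tm(1)] by simp
  qed
  have "u \<cdot> (q \<cdot> f) = q' \<cdot> f" using comp_assoc[OF fh q(1) u(1)] u(2) by simp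
  moreover have "u \<cdot> (q \<cdot> f) = m' \<cdot> (v' \<cdot> h)"
    using comp_assoc[OF h(1) tm(2) u(1)] comp_assoc[OF h(1) v'(1) tm'(2)] h(2) m'v' by simp
  ultimately have "zero_arrow A (m' \<cdot> (v' \<cdot> h))" using q'f by simp
  then have "zero_arrow A (v' \<cdot> h)"
    using monic_cancel_zero[OF tm'(5,2) comp_hom[OF h(1) v'(1)]] by blast
  then have "zero_arrow A (v \<cdot> (v' \<cdot> h))"
    using zero_arrow_comp_left[OF _ comp_hom[OF h(1) v'(1)] v(1)] by blast
  then have "zero_arrow A h" using comp_assoc[OF h(1) v'(1) v(1)] vv' idt_comp[OF h(1)] by simp
  then have "zero_arrow A (m \<cdot> h)" using zero_arrow_comp_left[OF _ h(1) tm(2)] by blast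
  then show "f \<in> S" using fh h(2) unfolding q(3) annihilated_iff[OF q(1)] by auto
qed

text \<open>The inclusion order of the sets is the order \<^const>\<open>sub_le\<close> of the monomorphisms that represent
  them.\<close>

lemma noetherian_object_subobjects:
  assumes "noetherian_object A c"
  shows "ascending_chain_condition (subobjects c)"
  unfolding ascending_chain_condition_def
proof (intro allI impI)
  fix s :: "nat \<Rightarrow> 'n set" assume s: "range s \<subseteq> subobjects c \<and> mono s"
  then have sS: "s n \<in> subobjects c" for n by blast
  have "\<forall>n. \<exists>m. m \<in> Hom A (Dom A m) c \<and> monic A m \<and>
      (\<forall>a. \<forall>f \<in> Hom A a c. f \<in> s n \<longleftrightarrow> (\<exists>h \<in> Hom A a (Dom A m). m \<cdot> h = f))"
  proof
    fix n
    obtain x k where k: "k \<in> Hom A x c" "monic A k"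
      "\<forall>a. \<forall>f \<in> Hom A a c. f \<in> s n \<longleftrightarrow> (\<exists>h \<in> Hom A a x. k \<cdot> h = f)"
      using subobject_generator[OF sS] .
    then show "\<exists>m. m \<in> Hom A (Dom A m) c \<and> monic A m \<and>
      (\<forall>a. \<forall>f \<in> Hom A a c. f \<in> s n \<longleftrightarrow> (\<exists>h \<in> Hom A a (Dom A m). m \<cdot> h = f))"
      using HomD(2)[OF k(1)] by (intro exI[of _ k]) simp
  qed
  from choice[OF this] obtain m where m_all: "\<forall>n. m n \<in> Hom A (Dom A (m n)) c \<and> monic A (m n) \<and>
      (\<forall>a. \<forall>f \<in> Hom A a c. f \<in> s n \<longleftrightarrow> (\<exists>h \<in> Hom A a (Dom A (m n)). m n \<cdot> h = f))" ..
  have m: "m n \<in> Hom A (Dom A (m n)) c" "monic A (m n)" for n using m_all by simp_all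
  have m_iff: "f \<in> s n \<longleftrightarrow> (\<exists>h \<in> Hom A a (Dom A (m n)). m n \<cdot> h = f)" if "f \<in> Hom A a c" for f a n
    using m_all that by blast
  have le: "sub_le A (m n) (m k) \<longleftrightarrow> s n \<subseteq> s k" for n k
  proof
    assume "sub_le A (m n) (m k)"
    then obtain h where h: "h \<in> Hom A (Dom A (m n)) (Dom A (m k))" "m n = m k \<cdot> h"
      by (auto simp: sub_le_def)
    show "s n \<subseteq> s k"
    proof
      fix f assume f: "f \<in> s n"
      note fh = subobject_hom[OF sS f]
      obtain g where g: "g \<in> Hom A (Dom A f) (Dom A (m n))" "m n \<cdot> g = f"
        using m_iff[OF fh] f by blast
      have "m k \<cdot> (h \<cdot> g) = f" using comp_assoc[OF g(1) h(1) m(1)] h(2) g(2) by simp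
      then show "f \<in> s k" using m_iff[OF fh] comp_hom[OF g(1) h(1)] by blast
    qed
  next
    assume le: "s n \<subseteq> s k"
    have "m n \<in> s n"
      using m_iff[OF m(1)] idt_hom[OF hom_obj(1)[OF m(1)]] comp_idt[OF m(1)] by blast
    then have "m n \<in> s k" using le by blast
    then obtain h where h: "h \<in> Hom A (Dom A (m n)) (Dom A (m k))" "m k \<cdot> h = m n"
      using m_iff[OF m(1)] by blast
    then show "sub_le A (m n) (m k)" unfolding sub_le_def by (intro bexI[OF _ h(1)]) simp
  qed
  have "\<forall>n. monic A (m n) \<and> Cod A (m n) = c" using m(2) HomD(3)[OF m(1)] by blast
  moreover have "\<forall>n. sub_le A (m n) (m (Suc n))"
    unfolding le using s by (simp add: mono_iff_le_Suc)
  ultimately obtain N where "\<forall>n \<ge> N. sub_le A (m n) (m N) \<and> sub_le A (m N) (m n)"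
    using assms unfolding noetherian_object_def by blast
  then show "\<exists>N. \<forall>n \<ge> N. s n = s N" unfolding le by blast
qed

text \<open>A subobject of \<open>d\<close> is recovered from its preimage in \<open>b\<close>: if \<open>q\<close> is the quotient by the
  former, \<open>q p\<close> is the quotient by the latter.\<close>

lemma ascending_chain_condition_quotient:
  assumes p: "p \<in> Hom A b d" "epic A p" and acc: "ascending_chain_condition (subobjects b)"
  shows "ascending_chain_condition (subobjects d)"
  unfolding ascending_chain_condition_def
proof (intro allI impI)
  fix s :: "nat \<Rightarrow> 'n set" assume s: "range s \<subseteq> subobjects d \<and> mono s"
  have sS: "s n \<in> subobjects d" for n using s by blast
  have reflect: "S \<subseteq> S'" if S: "S \<in> subobjects d" "S' \<in> subobjects d" "preimage p S \<subseteq> preimage p S'" for S S'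
  proof -
    obtain e q where q: "q \<in> Hom A d e" "epic A q" "S = annihilated q" using subobjectE[OF S(1)] .
    obtain e' q' where q': "q' \<in> Hom A d e'" "epic A q'" "S' = annihilated q'" using subobjectE[OF S(2)] .
    have qp: "q \<cdot> p \<in> Hom A b e" and q'p: "q' \<cdot> p \<in> Hom A b e'"
      using comp_hom[OF p(1) q(1)] comp_hom[OF p(1) q'(1)] .
    have "epic A (q \<cdot> p)"
    proof (rule epicI_zero[OF qp])
      fix c g assume g: "g \<in> Hom A e c" "zero_arrow A (g \<cdot> (q \<cdot> p))"
      then have "zero_arrow A ((g \<cdot> q) \<cdot> p)" using comp_assoc[OF p(1) q(1) g(1)] by simp
      then have "zero_arrow A (g \<cdot> q)"
        using epic_cancel_zero[OF p(2,1) comp_hom[OF q(1) g(1)]] by blast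
      then show "zero_arrow A g" using epic_cancel_zero[OF q(2,1) g(1)] by blast
    qed
    moreover have "annihilated (q \<cdot> p) \<subseteq> annihilated (q' \<cdot> p)"
      using S(3) unfolding q(3) q'(3) preimage_annihilated[OF p(1) q(1)] preimage_annihilated[OF p(1) q'(1)] .
    ultimately obtain u where u: "u \<in> Hom A e e'" "u \<cdot> (q \<cdot> p) = q' \<cdot> p"
      using annihilated_mono_factor[OF qp _ q'p] by blast
    then have "u \<cdot> q = q'"
      using epicD[OF p(2,1) comp_hom[OF q(1) u(1)] q'(1)] comp_assoc[OF p(1) q(1) u(1)] by simp
    then show ?thesis using annihilated_mono[OF q(1) u(1)] q(3) q'(3) by simp
  qed
  have "range (\<lambda>n. preimage p (s n)) \<subseteq> subobjects b" using preimage_is_subobject[OF p(1) sS] by blast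
  moreover have "mono (\<lambda>n. preimage p (s n))"
    using s preimage_mono by (auto simp: mono_def)
  ultimately obtain N where "\<forall>n \<ge> N. preimage p (s n) = preimage p (s N)"
    using acc unfolding ascending_chain_condition_def by blast
  then have "\<forall>n \<ge> N. s n = s N" using reflect[OF sS sS] by blast
  then show "\<exists>N. \<forall>n \<ge> N. s n = s N" ..
qed

end

section \<open>Functors to an abelian category\<close>

locale functors_to_abelian = M: category M + abelian A
  for M :: "('o, 'm, 'w) cat_scheme" and A :: "('p, 'n, 'y) cat_scheme" (structure)
begin

lemma Fct_hom:
  "t \<in> Hom (Fct M A) F G \<longleftrightarrow> natural_transformation M A t \<and> NDom t = F \<and> NCod t = G"
  by (auto simp: Hom_def Fct_def)

lemma Fct_obj: "F \<in> Obj (Fct M A) \<longleftrightarrow> cat_functor M A F"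
  by (simp add: Fct_def)

lemma natural_functors:
  assumes "t \<in> Hom (Fct M A) F G"
  shows "cat_functor M A F" "cat_functor M A G"
  using assms unfolding Fct_hom by (auto simp: natural_transformation_def)

lemma natural_component:
  assumes "t \<in> Hom (Fct M A) F G" "a \<in> Obj M"
  shows "NComp t a \<in> Hom A (FObj F a) (FObj G a)"
  using assms unfolding Fct_hom by (auto simp: natural_transformation_def)

lemma natural_square:
  assumes "t \<in> Hom (Fct M A) F G" "\<phi> \<in> Hom M a b"
  shows "NComp t b \<cdot> FArr F \<phi> = FArr G \<phi> \<cdot> NComp t a"
  using assms M.hom_obj[OF assms(2)] unfolding Fct_hom by (auto simp: natural_transformation_def)

lemma naturalI:
  assumes "cat_functor M A F" "cat_functor M A G"
    "\<And>a. a \<in> Obj M \<Longrightarrow> \<tau> a \<in> Hom A (FObj F a) (FObj G a)"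
    "\<And>\<phi> a b. \<phi> \<in> Hom M a b \<Longrightarrow> \<tau> b \<cdot> FArr F \<phi> = FArr G \<phi> \<cdot> \<tau> a"
  shows "\<lparr>NDom = F, NCod = G, NComp = (\<lambda>a \<in> Obj M. \<tau> a)\<rparr> \<in> Hom (Fct M A) F G"
  using assms unfolding Fct_hom by (auto simp: natural_transformation_def)

lemma natural_eqI:
  assumes "t \<in> Hom (Fct M A) F G" "t' \<in> Hom (Fct M A) F G"
    "\<And>a. a \<in> Obj M \<Longrightarrow> NComp t a = NComp t' a"
  shows "t = t'"
proof -
  have "NComp t = NComp t'"
    using assms unfolding Fct_hom natural_transformation_def
    by (intro extensionalityI[of _ "Obj M"]) auto
  then show ?thesis
    using assms(1,2) unfolding Fct_hom by (cases t, cases t') simp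
qed

lemma Fct_comp_component: "a \<in> Obj M \<Longrightarrow> NComp (s \<cdot>\<^bsub>Fct M A\<^esub> t) a = NComp s a \<cdot> NComp t a"
  by (simp add: Fct_def)

lemma Fct_idt_component: "a \<in> Obj M \<Longrightarrow> NComp (Idt (Fct M A) F) a = Idt A (FObj F a)"
  by (simp add: Fct_def)

lemma Fct_comp_hom:
  assumes t: "t \<in> Hom (Fct M A) F G" and s: "s \<in> Hom (Fct M A) G H"
  shows "s \<cdot>\<^bsub>Fct M A\<^esub> t \<in> Hom (Fct M A) F H"
proof -
  have eq: "s \<cdot>\<^bsub>Fct M A\<^esub> t = \<lparr>NDom = F, NCod = H, NComp = (\<lambda>a \<in> Obj M. NComp s a \<cdot> NComp t a)\<rparr>"
    using s t unfolding Fct_hom by (simp add: Fct_def)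
  show ?thesis
    unfolding eq
  proof (rule naturalI[OF natural_functors(1)[OF t] natural_functors(2)[OF s]])
    show "NComp s a \<cdot> NComp t a \<in> Hom A (FObj F a) (FObj H a)" if "a \<in> Obj M" for a
      using comp_hom[OF natural_component[OF t that] natural_component[OF s that]] .
  next
    fix \<phi> a b assume \<phi>: "\<phi> \<in> Hom M a b"
    note ab = M.hom_obj[OF \<phi>]
    note F = cat_functor.map_hom[OF natural_functors(1)[OF t] \<phi>]
    note G = cat_functor.map_hom[OF natural_functors(2)[OF t] \<phi>]
    note H = cat_functor.map_hom[OF natural_functors(2)[OF s] \<phi>]
    note ta = natural_component[OF t ab(1)] and tb = natural_component[OF t ab(2)]
    note sa = natural_component[OF s ab(1)] and sb = natural_component[OF s ab(2)]
    show "(NComp s b \<cdot> NComp t b) \<cdot> FArr F \<phi> = FArr H \<phi> \<cdot> (NComp s a \<cdot> NComp t a)"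
      using comp_assoc[OF F tb sb] comp_assoc[OF ta G sb] comp_assoc[OF ta sa H]
        natural_square[OF t \<phi>] natural_square[OF s \<phi>] by simp
  qed
qed

lemma Fct_idt_hom:
  assumes F: "cat_functor M A F"
  shows "Idt (Fct M A) F \<in> Hom (Fct M A) F F"
proof -
  have eq: "Idt (Fct M A) F = \<lparr>NDom = F, NCod = F, NComp = (\<lambda>a \<in> Obj M. Idt A (FObj F a))\<rparr>"
    by (simp add: Fct_def)
  show ?thesis
    unfolding eq
  proof (rule naturalI[OF F F])
    show "Idt A (FObj F a) \<in> Hom A (FObj F a) (FObj F a)" if "a \<in> Obj M" for a
      using idt_hom cat_functor.map_obj[OF F that] by blast
    show "Idt A (FObj F b) \<cdot> FArr F \<phi> = FArr F \<phi> \<cdot> Idt A (FObj F a)" if "\<phi> \<in> Hom M a b" for \<phi> a b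
      using idt_comp[OF cat_functor.map_hom[OF F that]] comp_idt[OF cat_functor.map_hom[OF F that]]
      by simp
  qed
qed

lemma zero_natural:
  assumes F: "cat_functor M A F" and G: "cat_functor M A G"
  obtains t where "t \<in> Hom (Fct M A) F G" "\<forall>a \<in> Obj M. zero_arrow A (NComp t a)"
proof -
  have "\<forall>a. \<exists>f. a \<in> Obj M \<longrightarrow> f \<in> Hom A (FObj F a) (FObj G a) \<and> zero_arrow A f"
    using zero_arrow_exists cat_functor.map_obj[OF F] cat_functor.map_obj[OF G] by metis
  from choice[OF this] obtain z where
    "\<forall>a. a \<in> Obj M \<longrightarrow> z a \<in> Hom A (FObj F a) (FObj G a) \<and> zero_arrow A (z a)" ..
  then have z: "z a \<in> Hom A (FObj F a) (FObj G a)" "zero_arrow A (z a)" if "a \<in> Obj M" for a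
    using that by simp_all
  show thesis
  proof (rule that)
    show "\<lparr>NDom = F, NCod = G, NComp = (\<lambda>a \<in> Obj M. z a)\<rparr> \<in> Hom (Fct M A) F G"
    proof (rule naturalI[OF F G z(1)])
      fix \<phi> a b assume \<phi>: "\<phi> \<in> Hom M a b"
      note ab = M.hom_obj[OF \<phi>]
      note F\<phi> = cat_functor.map_hom[OF F \<phi>] and G\<phi> = cat_functor.map_hom[OF G \<phi>]
      show "z b \<cdot> FArr F \<phi> = FArr G \<phi> \<cdot> z a"
        by (rule zero_arrow_unique[OF zero_arrow_comp_right[OF z(2)[OF ab(2)] F\<phi> z(1)[OF ab(2)]]
              zero_arrow_comp_left[OF z(2)[OF ab(1)] z(1)[OF ab(1)] G\<phi>]
              comp_hom[OF F\<phi> z(1)[OF ab(2)]] comp_hom[OF z(1)[OF ab(1)] G\<phi>]])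
    qed
  qed (use z(2) in simp)
qed

text \<open>A zero object of the functor category has only one endomorphism, and the family of zero arrows
  is one.\<close>

lemma zero_functor_identities:
  assumes Z: "zero_object (Fct M A) Z" and a: "a \<in> Obj M"
  shows "zero_arrow A (Idt A (FObj Z a))"
proof -
  have fZ: "cat_functor M A Z"
    using Z unfolding zero_object_def initial_object_def Fct_obj by blast
  obtain t where t: "t \<in> Hom (Fct M A) Z Z" "\<forall>a \<in> Obj M. zero_arrow A (NComp t a)"
    using zero_natural[OF fZ fZ] .
  have "\<exists>!t. t \<in> Hom (Fct M A) Z Z"
    using Z unfolding zero_object_def initial_object_def by blast
  then have "t = Idt (Fct M A) Z" using t(1) Fct_idt_hom[OF fZ] by (rule ex1_unique)
  then show ?thesis using t(2) a Fct_idt_component[OF a] by metis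
qed

lemma zero_arrow_component:
  assumes t: "t \<in> Hom (Fct M A) F G" and zero: "zero_arrow (Fct M A) t" and a: "a \<in> Obj M"
  shows "zero_arrow A (NComp t a)"
proof -
  obtain Z g h where Z: "zero_object (Fct M A) Z" and g: "g \<in> Hom (Fct M A) F Z"
    and h: "h \<in> Hom (Fct M A) Z G" and gh: "t = h \<cdot>\<^bsub>Fct M A\<^esub> g"
    using zero HomD[OF t] unfolding zero_arrow_def by auto
  note ga = natural_component[OF g a] and ha = natural_component[OF h a]
  have "zero_arrow A (Idt A (FObj Z a) \<cdot> NComp g a)"
    by (rule zero_arrow_comp_right[OF zero_functor_identities[OF Z a] ga idt_hom[OF hom_obj(2)[OF ga]]])
  then have "zero_arrow A (NComp g a)" using idt_comp[OF ga] by simp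
  from zero_arrow_comp_left[OF this ga ha] show ?thesis
    unfolding gh Fct_comp_component[OF a] .
qed

lemma zero_functor_exists:
  obtains Z where "zero_object (Fct M A) Z"
proof -
  obtain z where z: "zero_object A z" using zero_object_exists .
  have zo: "z \<in> Obj A" using z by (simp add: zero_object_def initial_object_def)
  define Z :: "('o, 'm, 'p, 'n) ftor" where "Z = \<lparr>FObj = (\<lambda>_. z), FArr = (\<lambda>_. Idt A z)\<rparr>"
  have fZ: "cat_functor M A Z"
    using idt_hom[OF zo] idt_comp[OF idt_hom[OF zo]] M.category_axioms category_axioms zo
    by (simp add: Z_def cat_functor_def)
  have uniq: "f = g" if "f \<in> Hom A z c \<and> g \<in> Hom A z c \<or> f \<in> Hom A c z \<and> g \<in> Hom A c z" for f g c
    using that zero_object_arrows[OF z] hom_obj by metis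
  have "\<exists>!t. t \<in> Hom (Fct M A) Z G" "\<exists>!t. t \<in> Hom (Fct M A) G Z" if "G \<in> Obj (Fct M A)" for G
  proof -
    have fG: "cat_functor M A G" using that by (simp add: Fct_obj)
    show "\<exists>!t. t \<in> Hom (Fct M A) Z G"
    proof (rule ex_ex1I)
      show "\<exists>t. t \<in> Hom (Fct M A) Z G" using zero_natural[OF fZ fG] by blast
      show "s = t" if "s \<in> Hom (Fct M A) Z G" "t \<in> Hom (Fct M A) Z G" for s t
        using that natural_component[OF that(1)] natural_component[OF that(2)]
        by (intro natural_eqI[OF that] uniq) (auto simp: Z_def)
    qed
    show "\<exists>!t. t \<in> Hom (Fct M A) G Z"
    proof (rule ex_ex1I)
      show "\<exists>t. t \<in> Hom (Fct M A) G Z" using zero_natural[OF fG fZ] by blast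
      show "s = t" if "s \<in> Hom (Fct M A) G Z" "t \<in> Hom (Fct M A) G Z" for s t
        using that natural_component[OF that(1)] natural_component[OF that(2)]
        by (intro natural_eqI[OF that] uniq) (auto simp: Z_def)
    qed
  qed
  then have "zero_object (Fct M A) Z"
    using fZ by (simp add: zero_object_def initial_object_def terminal_object_def Fct_obj)
  with that show thesis .
qed

lemma zero_arrowI_component:
  assumes t: "t \<in> Hom (Fct M A) F G" and zero: "\<And>a. a \<in> Obj M \<Longrightarrow> zero_arrow A (NComp t a)"
  shows "zero_arrow (Fct M A) t"
proof -
  obtain Z where Z: "zero_object (Fct M A) Z" using zero_functor_exists .
  then have fZ: "cat_functor M A Z" by (simp add: zero_object_def initial_object_def Fct_obj)
  obtain g where g: "g \<in> Hom (Fct M A) F Z" using zero_natural[OF natural_functors(1)[OF t] fZ] .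
  obtain h where h: "h \<in> Hom (Fct M A) Z G" using zero_natural[OF fZ natural_functors(2)[OF t]] .
  have "zero_arrow A (NComp (h \<cdot>\<^bsub>Fct M A\<^esub> g) a)" if a: "a \<in> Obj M" for a
  proof -
    note ga = natural_component[OF g a] and ha = natural_component[OF h a]
    have "zero_arrow A (Idt A (FObj Z a) \<cdot> NComp g a)"
      by (rule zero_arrow_comp_right[OF zero_functor_identities[OF Z a] ga idt_hom[OF hom_obj(2)[OF ga]]])
    then have "zero_arrow A (NComp g a)" using idt_comp[OF ga] by simp
    from zero_arrow_comp_left[OF this ga ha] show ?thesis unfolding Fct_comp_component[OF a] .
  qed
  then have "t = h \<cdot>\<^bsub>Fct M A\<^esub> g"
    using Fct_comp_hom[OF g h] t zero
    by (intro natural_eqI[OF t Fct_comp_hom[OF g h]]) (blast intro: zero_arrow_unique natural_component)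
  then show ?thesis
    using Z g h HomD[OF t] unfolding zero_arrow_def by blast
qed

text \<open>Kernels and cokernels of natural transformations are functors because their action on arrows
  is forced by a commuting square. Here \<open>R\<close> is that square.\<close>

lemma functor_from_relation:
  assumes obj: "\<And>a. a \<in> Obj M \<Longrightarrow> K a \<in> Obj A"
    and ex1: "\<And>a b \<phi>. \<phi> \<in> Hom M a b \<Longrightarrow> \<exists>!h. h \<in> Hom A (K a) (K b) \<and> R a b \<phi> h"
    and idt: "\<And>a. a \<in> Obj M \<Longrightarrow> R a a (Idt M a) (Idt A (K a))"
    and comp: "\<And>a b c \<phi> \<psi> h k. \<phi> \<in> Hom M a b \<Longrightarrow> \<psi> \<in> Hom M b c \<Longrightarrow> h \<in> Hom A (K a) (K b) \<Longrightarrow>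
      k \<in> Hom A (K b) (K c) \<Longrightarrow> R a b \<phi> h \<Longrightarrow> R b c \<psi> k \<Longrightarrow> R a c (\<psi> \<cdot>\<^bsub>M\<^esub> \<phi>) (k \<cdot> h)"
  obtains G where "cat_functor M A G" "FObj G = K"
    "\<forall>a b. \<forall>\<phi> \<in> Hom M a b. R a b \<phi> (FArr G \<phi>)"
proof -
  define arr where "arr \<phi> = (THE h. h \<in> Hom A (K (Dom M \<phi>)) (K (Cod M \<phi>)) \<and>
    R (Dom M \<phi>) (Cod M \<phi>) \<phi> h)" for \<phi>
  have arr: "arr \<phi> \<in> Hom A (K a) (K b) \<and> R a b \<phi> (arr \<phi>)" if "\<phi> \<in> Hom M a b" for a b \<phi>
    using theI'[OF ex1[OF that]] HomD[OF that] by (simp add: arr_def)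
  have uniq: "arr \<phi> = h" if "\<phi> \<in> Hom M a b" "h \<in> Hom A (K a) (K b)" "R a b \<phi> h" for a b \<phi> h
    by (rule ex1_unique[OF ex1[OF that(1)]]) (use arr that in simp_all)
  have "cat_functor M A \<lparr>FObj = K, FArr = arr\<rparr>"
  proof (rule cat_functor.intro)
    show "category M" "category A" using M.category_axioms category_axioms .
    fix a assume a: "a \<in> Obj M"
    show "FObj \<lparr>FObj = K, FArr = arr\<rparr> a \<in> Obj A" using obj a by simp
    show "FArr \<lparr>FObj = K, FArr = arr\<rparr> (Idt M a) = Idt A (FObj \<lparr>FObj = K, FArr = arr\<rparr> a)"
      using uniq[OF M.idt_hom[OF a] idt_hom[OF obj[OF a]] idt[OF a]] by simp
  next
    fix \<phi> a b assume \<phi>: "\<phi> \<in> Hom M a b"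
    show "FArr \<lparr>FObj = K, FArr = arr\<rparr> \<phi> \<in>
        Hom A (FObj \<lparr>FObj = K, FArr = arr\<rparr> a) (FObj \<lparr>FObj = K, FArr = arr\<rparr> b)"
      using arr[OF \<phi>] by simp
    fix \<psi> c assume \<psi>: "\<psi> \<in> Hom M b c"
    show "FArr \<lparr>FObj = K, FArr = arr\<rparr> (\<psi> \<cdot>\<^bsub>M\<^esub> \<phi>) =
        FArr \<lparr>FObj = K, FArr = arr\<rparr> \<psi> \<cdot> FArr \<lparr>FObj = K, FArr = arr\<rparr> \<phi>"
      using uniq[OF M.comp_hom[OF \<phi> \<psi>] comp_hom comp[OF \<phi> \<psi>], of "arr \<phi>" "K b" "arr \<psi>"]
        arr[OF \<phi>] arr[OF \<psi>] by simp
  qed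
  with that[of "\<lparr>FObj = K, FArr = arr\<rparr>"] arr show thesis by simp
qed

text \<open>The componentwise kernels of \<open>t\<close> form a functor whose inclusion is equalised by \<open>t\<close> with the zero
  transformation, so they vanish when \<open>t\<close> is monic.\<close>

lemma natural_monic_component:
  assumes t: "t \<in> Hom (Fct M A) G F" and mono: "monic (Fct M A) t" and a: "a \<in> Obj M"
  shows "monic A (NComp t a)"
proof -
  note fG = natural_functors(1)[OF t] and fF = natural_functors(2)[OF t]
  have "\<forall>b. \<exists>k. b \<in> Obj M \<longrightarrow> is_kernel A (NComp t b) k"
    using abelian HomD(1)[OF natural_component[OF t]] by (auto simp: abelian_category_def)
  from choice[OF this] obtain k where "\<forall>b. b \<in> Obj M \<longrightarrow> is_kernel A (NComp t b) (k b)" ..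
  then have ker: "is_kernel A (NComp t b) (k b)" if "b \<in> Obj M" for b using that by simp
  define K where "K b = Dom A (k b)" for b
  have k: "k b \<in> Hom A (K b) (FObj G b)" "zero_arrow A (NComp t b \<cdot> k b)" "monic A (k b)"
    if "b \<in> Obj M" for b
    unfolding K_def using is_kernelD(1-3)[OF ker[OF that] natural_component[OF t that]] .
  have k_univ: "\<exists>h \<in> Hom A c (K b). k b \<cdot> h = g"
    if "b \<in> Obj M" "g \<in> Hom A c (FObj G b)" "zero_arrow A (NComp t b \<cdot> g)" for b c g
    unfolding K_def using is_kernelD(4)[OF ker[OF that(1)] natural_component[OF t that(1)] that(2,3)] .
  have "\<exists>H. cat_functor M A H \<and> FObj H = K \<and>
    (\<forall>b c. \<forall>\<phi> \<in> Hom M b c. k c \<cdot> FArr H \<phi> = FArr G \<phi> \<cdot> k b)"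
  proof (rule functor_from_relation[of K "\<lambda>b c \<phi> h. k c \<cdot> h = FArr G \<phi> \<cdot> k b"])
    show "K b \<in> Obj A" if "b \<in> Obj M" for b using hom_obj(1)[OF k(1)[OF that]] .
    show "k b \<cdot> Idt A (K b) = FArr G (Idt M b) \<cdot> k b" if "b \<in> Obj M" for b
      using cat_functor.map_idt[OF fG that] comp_idt[OF k(1)[OF that]] idt_comp[OF k(1)[OF that]]
      by simp
  next
    fix b c \<phi> assume \<phi>: "\<phi> \<in> Hom M b c"
    note bc = M.hom_obj[OF \<phi>]
    note G\<phi> = cat_functor.map_hom[OF fG \<phi>] and F\<phi> = cat_functor.map_hom[OF fF \<phi>]
    note kb = k[OF bc(1)] and kc = k[OF bc(2)]
    note tb = natural_component[OF t bc(1)] and tc = natural_component[OF t bc(2)]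
    have "NComp t c \<cdot> (FArr G \<phi> \<cdot> k b) = FArr F \<phi> \<cdot> (NComp t b \<cdot> k b)"
      using comp_assoc[OF kb(1) G\<phi> tc] comp_assoc[OF kb(1) tb F\<phi>] natural_square[OF t \<phi>] by simp
    then have "zero_arrow A (NComp t c \<cdot> (FArr G \<phi> \<cdot> k b))"
      using zero_arrow_comp_left[OF kb(2) comp_hom[OF kb(1) tb] F\<phi>] by simp
    from k_univ[OF bc(2) comp_hom[OF kb(1) G\<phi>] this]
    show "\<exists>!h. h \<in> Hom A (K b) (K c) \<and> k c \<cdot> h = FArr G \<phi> \<cdot> k b"
      using monicD[OF kc(3,1)] by (intro ex_ex1I) auto
    fix d \<psi> h l
    assume \<psi>: "\<psi> \<in> Hom M c d" and h: "h \<in> Hom A (K b) (K c)" and l: "l \<in> Hom A (K c) (K d)"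
      and eq: "k c \<cdot> h = FArr G \<phi> \<cdot> k b" "k d \<cdot> l = FArr G \<psi> \<cdot> k c"
    note G\<psi> = cat_functor.map_hom[OF fG \<psi>] and kd = k[OF M.hom_obj(2)[OF \<psi>]]
    show "k d \<cdot> (l \<cdot> h) = FArr G (\<psi> \<cdot>\<^bsub>M\<^esub> \<phi>) \<cdot> k b"
      using cat_functor.map_comp[OF fG \<phi> \<psi>] comp_assoc[OF h l kd(1)] comp_assoc[OF h kc(1) G\<psi>]
        comp_assoc[OF kb(1) G\<phi> G\<psi>] eq by simp
  qed blast
  then obtain H where H: "cat_functor M A H" "FObj H = K"
    and H_nat: "\<And>b c \<phi>. \<phi> \<in> Hom M b c \<Longrightarrow> k c \<cdot> FArr H \<phi> = FArr G \<phi> \<cdot> k b"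
    by blast
  define \<kappa> where "\<kappa> = \<lparr>NDom = H, NCod = G, NComp = (\<lambda>b \<in> Obj M. k b)\<rparr>"
  have \<kappa>: "\<kappa> \<in> Hom (Fct M A) H G"
    unfolding \<kappa>_def using k(1) H_nat by (intro naturalI H(1) fG) (simp_all add: H(2))
  obtain o' where o': "o' \<in> Hom (Fct M A) H G" "\<forall>b \<in> Obj M. zero_arrow A (NComp o' b)"
    using zero_natural[OF H(1) fG] .
  have "t \<cdot>\<^bsub>Fct M A\<^esub> \<kappa> = t \<cdot>\<^bsub>Fct M A\<^esub> o'"
  proof (rule natural_eqI[OF Fct_comp_hom[OF \<kappa> t] Fct_comp_hom[OF o'(1) t]])
    fix b assume b: "b \<in> Obj M"
    note tb = natural_component[OF t b] and ob = natural_component[OF o'(1) b]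
    have "zero_arrow A (NComp t b \<cdot> NComp o' b)"
      using zero_arrow_comp_left[OF _ ob tb] o'(2) b by blast
    moreover have "FObj H b = K b" by (simp add: H(2))
    ultimately show "NComp (t \<cdot>\<^bsub>Fct M A\<^esub> \<kappa>) b = NComp (t \<cdot>\<^bsub>Fct M A\<^esub> o') b"
      using zero_arrow_unique[OF k(2)[OF b] _ comp_hom[OF k(1)[OF b] tb]] comp_hom[OF ob tb] b
      by (simp add: Fct_comp_component \<kappa>_def)
  qed
  then have "\<kappa> = o'"
    using mono \<kappa> o'(1) HomD[OF t] unfolding monic_def by (simp add: Fct_def)
  then have ka: "zero_arrow A (k a)" using o'(2) a by (auto simp: \<kappa>_def)
  show ?thesis
  proof (rule monicI_zero[OF natural_component[OF t a]])
    fix c g assume g: "g \<in> Hom A c (FObj G a)" "zero_arrow A (NComp t a \<cdot> g)"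
    then obtain h where h: "h \<in> Hom A c (K a)" "k a \<cdot> h = g" using k_univ[OF a] by blast
    then show "zero_arrow A g" using zero_arrow_comp_right[OF ka h(1) k(1)[OF a]] by simp
  qed
qed

text \<open>The families are empty outside the objects of \<open>M\<close>, so that the pointwise order on functions is the
  inclusion order of subfunctors.\<close>

definition subfunctors :: "('o, 'm, 'p, 'n) ftor \<Rightarrow> ('o \<Rightarrow> 'n set) set" where
  "subfunctors F = {S. (\<forall>a \<in> Obj M. S a \<in> subobjects (FObj F a)) \<and> (\<forall>a. a \<notin> Obj M \<longrightarrow> S a = {}) \<and>
    (\<forall>a b. \<forall>\<phi> \<in> Hom M a b. \<forall>f \<in> S a. FArr F \<phi> \<cdot> f \<in> S b)}"

lemma subfunctor_subobject: "S \<in> subfunctors F \<Longrightarrow> a \<in> Obj M \<Longrightarrow> S a \<in> subobjects (FObj F a)"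
  by (simp add: subfunctors_def)

lemma subfunctor_closed: "S \<in> subfunctors F \<Longrightarrow> \<phi> \<in> Hom M a b \<Longrightarrow> f \<in> S a \<Longrightarrow> FArr F \<phi> \<cdot> f \<in> S b"
  unfolding subfunctors_def by blast

lemma subfunctor_outside: "S \<in> subfunctors F \<Longrightarrow> a \<notin> Obj M \<Longrightarrow> S a = {}"
  by (simp add: subfunctors_def)

lemma subfunctor_leI:
  assumes "S \<in> subfunctors F" "\<And>a. a \<in> Obj M \<Longrightarrow> S a \<subseteq> S' a"
  shows "S \<le> S'"
  using assms subfunctor_outside[OF assms(1)] by (auto simp: le_fun_def)

lemma subobject_of_monic:
  assumes m: "m \<in> Hom A x c" "monic A m"
  shows "{f. \<exists>h \<in> Hom A (Dom A f) x. m \<cdot> h = f} \<in> subobjects c"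
proof -
  obtain d q where q: "q \<in> Hom A c d" "zero_arrow A (q \<cdot> m)"
    "\<forall>a. \<forall>g \<in> Hom A a c. zero_arrow A (q \<cdot> g) \<longrightarrow> (\<exists>h \<in> Hom A a x. m \<cdot> h = g)"
    using monic_factors[OF m(2,1)] .
  have "f \<in> {f. \<exists>h \<in> Hom A (Dom A f) x. m \<cdot> h = f} \<longleftrightarrow> f \<in> annihilated q" for f
  proof
    assume "f \<in> {f. \<exists>h \<in> Hom A (Dom A f) x. m \<cdot> h = f}"
    then obtain h where h: "h \<in> Hom A (Dom A f) x" "m \<cdot> h = f" by blast
    have "zero_arrow A (q \<cdot> f)"
      using zero_arrow_comp_right[OF q(2) h(1) comp_hom[OF m(1) q(1)]] comp_assoc[OF h(1) m(1) q(1)] h(2)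
      by simp
    then show "f \<in> annihilated q"
      using comp_hom[OF h(1) m(1)] h(2) unfolding annihilated_iff[OF q(1)] by blast
  next
    assume f: "f \<in> annihilated q"
    then have "f \<in> Hom A (Dom A f) c" using HomD[OF q(1)] by (simp add: annihilated_def Hom_def)
    then show "f \<in> {f. \<exists>h \<in> Hom A (Dom A f) x. m \<cdot> h = f}"
      using q(3) f by (simp add: annihilated_def)
  qed
  then have "{f. \<exists>h \<in> Hom A (Dom A f) x. m \<cdot> h = f} = annihilated q" by blast
  then show ?thesis using annihilated_is_subobject[OF q(1)] by simp
qed

text \<open>A monomorphism into \<open>F\<close> gives the family of the arrows that factor through its components.
  Conversely an inclusion of these families yields arrows between the sources of two
  monomorphisms, and these are natural because the components are monic.\<close>

lemma noetherian_functorI: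
  assumes F: "cat_functor M A F" and acc: "ascending_chain_condition (subfunctors F)"
  shows "noetherian_object (Fct M A) F"
  unfolding noetherian_object_def
proof (intro conjI allI impI)
  show "F \<in> Obj (Fct M A)" using F by (simp add: Fct_obj)
  fix m :: "nat \<Rightarrow> ('o, 'm, 'p, 'n) ntrans"
  assume m_all: "(\<forall>n. monic (Fct M A) (m n) \<and> Cod (Fct M A) (m n) = F) \<and>
    (\<forall>n. sub_le (Fct M A) (m n) (m (Suc n)))"
  define G where "G n = Dom (Fct M A) (m n)" for n
  have m: "m n \<in> Hom (Fct M A) (G n) F" "monic (Fct M A) (m n)" for n
    using m_all by (auto simp: G_def monic_def Hom_def)
  define S where "S n a = {f. a \<in> Obj M \<and> (\<exists>h \<in> Hom A (Dom A f) (FObj (G n) a). NComp (m n) a \<cdot> h = f)}" for n a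
  have mono: "monic A (NComp (m n) a)" if "a \<in> Obj M" for n a
    using natural_monic_component[OF m that] .
  have sub: "S n \<in> subfunctors F" for n
    unfolding subfunctors_def mem_Collect_eq
  proof (intro conjI ballI allI impI)
    show "S n a \<in> subobjects (FObj F a)" if "a \<in> Obj M" for a
      using subobject_of_monic[OF natural_component[OF m(1) that] mono[OF that]] that by (simp add: S_def)
    show "S n a = {}" if "a \<notin> Obj M" for a using that by (simp add: S_def)
    fix a b \<phi> f assume \<phi>: "\<phi> \<in> Hom M a b" and f: "f \<in> S n a"
    note ab = M.hom_obj[OF \<phi>]
    obtain h where h: "h \<in> Hom A (Dom A f) (FObj (G n) a)" "NComp (m n) a \<cdot> h = f"
      using f by (auto simp: S_def)
    note ma = natural_component[OF m(1)[of n] ab(1)] and mb = natural_component[OF m(1)[of n] ab(2)]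
    note F\<phi> = cat_functor.map_hom[OF F \<phi>]
    note G\<phi> = cat_functor.map_hom[OF natural_functors(1)[OF m(1)[of n]] \<phi>]
    have "NComp (m n) b \<cdot> (FArr (G n) \<phi> \<cdot> h) = FArr F \<phi> \<cdot> f"
      using comp_assoc[OF h(1) G\<phi> mb] comp_assoc[OF h(1) ma F\<phi>] natural_square[OF m(1) \<phi>, of n] h(2)
      by simp
    moreover have "FArr (G n) \<phi> \<cdot> h \<in> Hom A (Dom A (FArr F \<phi> \<cdot> f)) (FObj (G n) b)"
      using comp_hom[OF h(1) G\<phi>] HomD(2)[OF comp_hom[OF comp_hom[OF h(1) ma] F\<phi>]] h(2) by simp
    ultimately show "FArr F \<phi> \<cdot> f \<in> S n b" using ab(2) by (auto simp: S_def)
  qed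
  have le: "S n \<le> S k" if le: "sub_le (Fct M A) (m n) (m k)" for n k
  proof (rule subfunctor_leI[OF sub])
    fix a assume a: "a \<in> Obj M"
    obtain t where t: "t \<in> Hom (Fct M A) (G n) (G k)" "m n = m k \<cdot>\<^bsub>Fct M A\<^esub> t"
      using le by (auto simp: sub_le_def G_def)
    show "S n a \<subseteq> S k a"
    proof
      fix f assume "f \<in> S n a"
      then obtain h where h: "h \<in> Hom A (Dom A f) (FObj (G n) a)" "NComp (m n) a \<cdot> h = f"
        by (auto simp: S_def)
      have "NComp (m k) a \<cdot> (NComp t a \<cdot> h) = f"
        using comp_assoc[OF h(1) natural_component[OF t(1) a] natural_component[OF m(1) a]] h(2)
          Fct_comp_component[OF a, of "m k" t] t(2) by simp
      then show "f \<in> S k a"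
        using comp_hom[OF h(1) natural_component[OF t(1) a]] a by (auto simp: S_def)
    qed
  qed
  have ge: "sub_le (Fct M A) (m n) (m k)" if le: "S n \<le> S k" for n k
  proof -
    have "\<forall>a. \<exists>h. a \<in> Obj M \<longrightarrow> h \<in> Hom A (FObj (G n) a) (FObj (G k) a) \<and>
        NComp (m k) a \<cdot> h = NComp (m n) a"
    proof
      fix a
      show "\<exists>h. a \<in> Obj M \<longrightarrow> h \<in> Hom A (FObj (G n) a) (FObj (G k) a) \<and>
        NComp (m k) a \<cdot> h = NComp (m n) a"
      proof (cases "a \<in> Obj M")
        case True
        note mn = natural_component[OF m(1)[of n] True]
        have "NComp (m n) a \<in> S n a"
          using comp_idt[OF mn] idt_hom[OF hom_obj(1)[OF mn]] HomD(2)[OF mn] True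
          by (auto simp: S_def)
        then have "NComp (m n) a \<in> S k a" using le by (auto simp: le_fun_def)
        then show ?thesis using HomD(2)[OF mn] by (auto simp: S_def)
      qed simp
    qed
    from choice[OF this] obtain h where "\<forall>a. a \<in> Obj M \<longrightarrow>
      h a \<in> Hom A (FObj (G n) a) (FObj (G k) a) \<and> NComp (m k) a \<cdot> h a = NComp (m n) a" ..
    then have h: "h a \<in> Hom A (FObj (G n) a) (FObj (G k) a)" "NComp (m k) a \<cdot> h a = NComp (m n) a"
      if "a \<in> Obj M" for a using that by simp_all
    define t where "t = \<lparr>NDom = G n, NCod = G k, NComp = (\<lambda>a \<in> Obj M. h a)\<rparr>"
    have t: "t \<in> Hom (Fct M A) (G n) (G k)"
      unfolding t_def
    proof (rule naturalI[OF natural_functors(1)[OF m(1)] natural_functors(1)[OF m(1)] h(1)])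
      fix \<phi> a b assume \<phi>: "\<phi> \<in> Hom M a b"
      note ab = M.hom_obj[OF \<phi>]
      note F\<phi> = cat_functor.map_hom[OF F \<phi>]
      note Gn\<phi> = cat_functor.map_hom[OF natural_functors(1)[OF m(1)[of n]] \<phi>]
      note Gk\<phi> = cat_functor.map_hom[OF natural_functors(1)[OF m(1)[of k]] \<phi>]
      note mka = natural_component[OF m(1)[of k] ab(1)] and mkb = natural_component[OF m(1)[of k] ab(2)]
      note ha = h[OF ab(1)] and hb = h[OF ab(2)]
      show "h b \<cdot> FArr (G n) \<phi> = FArr (G k) \<phi> \<cdot> h a"
      proof (rule monicD[OF mono[OF ab(2)] mkb comp_hom[OF Gn\<phi> hb(1)] comp_hom[OF ha(1) Gk\<phi>]])
        show "NComp (m k) b \<cdot> (h b \<cdot> FArr (G n) \<phi>) = NComp (m k) b \<cdot> (FArr (G k) \<phi> \<cdot> h a)"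
          using comp_assoc[OF Gn\<phi> hb(1) mkb] comp_assoc[OF ha(1) Gk\<phi> mkb] comp_assoc[OF ha(1) mka F\<phi>]
            natural_square[OF m(1) \<phi>, of n] natural_square[OF m(1) \<phi>, of k] ha(2) hb(2) by simp
      qed
    qed
    have "m n = m k \<cdot>\<^bsub>Fct M A\<^esub> t"
      by (rule natural_eqI[OF m(1) Fct_comp_hom[OF t m(1)]])
        (simp add: Fct_comp_component t_def h(2))
    with t show ?thesis unfolding sub_le_def G_def[symmetric] by blast
  qed
  have "mono S" using le m_all by (intro incseq_SucI) blast
  moreover have "range S \<subseteq> subfunctors F" using sub by blast
  ultimately obtain N where "\<forall>n \<ge> N. S n = S N"
    using acc unfolding ascending_chain_condition_def by blast
  then have "\<forall>n \<ge> N. sub_le (Fct M A) (m n) (m N) \<and> sub_le (Fct M A) (m N) (m n)"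
    using ge by (metis order_refl)
  then show "\<exists>N. \<forall>n \<ge> N. sub_le (Fct M A) (m n) (m N) \<and> sub_le (Fct M A) (m N) (m n)" ..
qed

subsection \<open>Cokernels of natural transformations\<close>

lemma componentwise_cokernel:
  assumes t: "t \<in> Hom (Fct M A) F G"
  obtains Q c where "c \<in> Hom (Fct M A) G Q" "\<forall>a \<in> Obj M. is_cokernel A (NComp t a) (NComp c a)"
proof -
  note fF = natural_functors(1)[OF t] and fG = natural_functors(2)[OF t]
  have "\<forall>b. \<exists>c. b \<in> Obj M \<longrightarrow> is_cokernel A (NComp t b) c"
    using abelian HomD(1)[OF natural_component[OF t]] by (auto simp: abelian_category_def)
  from choice[OF this] obtain c where "\<forall>b. b \<in> Obj M \<longrightarrow> is_cokernel A (NComp t b) (c b)" ..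
  then have coker: "is_cokernel A (NComp t b) (c b)" if "b \<in> Obj M" for b using that by simp
  define K where "K b = Cod A (c b)" for b
  have c: "c b \<in> Hom A (FObj G b) (K b)" "zero_arrow A (c b \<cdot> NComp t b)" "epic A (c b)"
    if "b \<in> Obj M" for b
    unfolding K_def using is_cokernelD(1-3)[OF coker[OF that] natural_component[OF t that]] .
  have c_univ: "\<exists>h \<in> Hom A (K b) d. h \<cdot> c b = g"
    if "b \<in> Obj M" "g \<in> Hom A (FObj G b) d" "zero_arrow A (g \<cdot> NComp t b)" for b d g
    unfolding K_def using is_cokernelD(4)[OF coker[OF that(1)] natural_component[OF t that(1)] that(2,3)] .
  have "\<exists>H. cat_functor M A H \<and> FObj H = K \<and>
    (\<forall>a b. \<forall>\<phi> \<in> Hom M a b. FArr H \<phi> \<cdot> c a = c b \<cdot> FArr G \<phi>)"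
  proof (rule functor_from_relation[of K "\<lambda>a b \<phi> h. h \<cdot> c a = c b \<cdot> FArr G \<phi>"])
    show "K b \<in> Obj A" if "b \<in> Obj M" for b using hom_obj(2)[OF c(1)[OF that]] .
    show "Idt A (K b) \<cdot> c b = c b \<cdot> FArr G (Idt M b)" if "b \<in> Obj M" for b
      using cat_functor.map_idt[OF fG that] comp_idt[OF c(1)[OF that]] idt_comp[OF c(1)[OF that]]
      by simp
  next
    fix a b \<phi> assume \<phi>: "\<phi> \<in> Hom M a b"
    note ab = M.hom_obj[OF \<phi>]
    note G\<phi> = cat_functor.map_hom[OF fG \<phi>] and F\<phi> = cat_functor.map_hom[OF fF \<phi>]
    note ca = c[OF ab(1)] and cb = c[OF ab(2)]
    note ta = natural_component[OF t ab(1)] and tb = natural_component[OF t ab(2)]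
    have "(c b \<cdot> FArr G \<phi>) \<cdot> NComp t a = (c b \<cdot> NComp t b) \<cdot> FArr F \<phi>"
      using comp_assoc[OF ta G\<phi> cb(1)] comp_assoc[OF F\<phi> tb cb(1)] natural_square[OF t \<phi>] by simp
    then have "zero_arrow A ((c b \<cdot> FArr G \<phi>) \<cdot> NComp t a)"
      using zero_arrow_comp_right[OF cb(2) F\<phi> comp_hom[OF tb cb(1)]] by simp
    from c_univ[OF ab(1) comp_hom[OF G\<phi> cb(1)] this]
    show "\<exists>!h. h \<in> Hom A (K a) (K b) \<and> h \<cdot> c a = c b \<cdot> FArr G \<phi>"
      using epicD[OF ca(3,1)] by (intro ex_ex1I) auto
    fix d \<psi> h l
    assume \<psi>: "\<psi> \<in> Hom M b d" and h: "h \<in> Hom A (K a) (K b)" and l: "l \<in> Hom A (K b) (K d)"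
      and eq: "h \<cdot> c a = c b \<cdot> FArr G \<phi>" "l \<cdot> c b = c d \<cdot> FArr G \<psi>"
    note G\<psi> = cat_functor.map_hom[OF fG \<psi>] and cd = c[OF M.hom_obj(2)[OF \<psi>]]
    show "(l \<cdot> h) \<cdot> c a = c d \<cdot> FArr G (\<psi> \<cdot>\<^bsub>M\<^esub> \<phi>)"
      using cat_functor.map_comp[OF fG \<phi> \<psi>] comp_assoc[OF ca(1) h l] comp_assoc[OF G\<phi> cb(1) l]
        comp_assoc[OF G\<phi> G\<psi> cd(1)] eq by simp
  qed blast
  then obtain H where H: "cat_functor M A H" "FObj H = K"
    and H_nat: "\<And>a b \<phi>. \<phi> \<in> Hom M a b \<Longrightarrow> FArr H \<phi> \<cdot> c a = c b \<cdot> FArr G \<phi>"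
    by blast
  have "\<lparr>NDom = G, NCod = H, NComp = (\<lambda>b \<in> Obj M. c b)\<rparr> \<in> Hom (Fct M A) G H"
    using c(1) H_nat by (intro naturalI H(1) fG) (simp_all add: H(2))
  with that show thesis using coker by simp
qed

lemma is_cokernelI_component:
  assumes t: "t \<in> Hom (Fct M A) F G" and c: "c \<in> Hom (Fct M A) G Q"
    and coker: "\<And>a. a \<in> Obj M \<Longrightarrow> is_cokernel A (NComp t a) (NComp c a)"
  shows "is_cokernel (Fct M A) t c"
proof -
  have cD: "zero_arrow A (NComp c a \<cdot> NComp t a)" "epic A (NComp c a)" if "a \<in> Obj M" for a
    using is_cokernelD(2,3)[OF coker[OF that] natural_component[OF t that]] .
  have c_univ: "\<exists>h \<in> Hom A (FObj Q a) d. h \<cdot> NComp c a = g"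
    if "a \<in> Obj M" "g \<in> Hom A (FObj G a) d" "zero_arrow A (g \<cdot> NComp t a)" for a d g
    using is_cokernelD(4)[OF coker[OF that(1)] natural_component[OF t that(1)] that(2,3)]
      HomD(3)[OF natural_component[OF c that(1)]] by simp
  have "zero_arrow (Fct M A) (c \<cdot>\<^bsub>Fct M A\<^esub> t)"
    by (rule zero_arrowI_component[OF Fct_comp_hom[OF t c]]) (simp add: Fct_comp_component cD(1))
  moreover have "\<exists>!h. h \<in> Hom (Fct M A) Q R \<and> h \<cdot>\<^bsub>Fct M A\<^esub> c = g"
    if g: "g \<in> Hom (Fct M A) G R" "zero_arrow (Fct M A) (g \<cdot>\<^bsub>Fct M A\<^esub> t)" for g R
  proof (rule ex_ex1I)
    note fQ = natural_functors(2)[OF c] and fR = natural_functors(2)[OF g(1)]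
      and fG = natural_functors(1)[OF g(1)]
    have "\<forall>a. \<exists>h. a \<in> Obj M \<longrightarrow> h \<in> Hom A (FObj Q a) (FObj R a) \<and> h \<cdot> NComp c a = NComp g a"
    proof
      fix a
      show "\<exists>h. a \<in> Obj M \<longrightarrow> h \<in> Hom A (FObj Q a) (FObj R a) \<and> h \<cdot> NComp c a = NComp g a"
      proof (cases "a \<in> Obj M")
        case True
        have "zero_arrow A (NComp g a \<cdot> NComp t a)"
          using zero_arrow_component[OF Fct_comp_hom[OF t g(1)] g(2) True]
          by (simp add: Fct_comp_component True)
        from c_univ[OF True natural_component[OF g(1) True] this] show ?thesis by blast
      qed simp
    qed
    from choice[OF this] obtain h where "\<forall>a. a \<in> Obj M \<longrightarrow>
      h a \<in> Hom A (FObj Q a) (FObj R a) \<and> h a \<cdot> NComp c a = NComp g a" ..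
    then have h: "h a \<in> Hom A (FObj Q a) (FObj R a)" "h a \<cdot> NComp c a = NComp g a"
      if "a \<in> Obj M" for a using that by simp_all
    define \<eta> where "\<eta> = \<lparr>NDom = Q, NCod = R, NComp = (\<lambda>a \<in> Obj M. h a)\<rparr>"
    have \<eta>: "\<eta> \<in> Hom (Fct M A) Q R"
      unfolding \<eta>_def
    proof (rule naturalI[OF fQ fR h(1)])
      fix \<phi> a b assume \<phi>: "\<phi> \<in> Hom M a b"
      note ab = M.hom_obj[OF \<phi>]
      note Q\<phi> = cat_functor.map_hom[OF fQ \<phi>] and R\<phi> = cat_functor.map_hom[OF fR \<phi>]
        and G\<phi> = cat_functor.map_hom[OF fG \<phi>]
      note ca = natural_component[OF c ab(1)] and cb = natural_component[OF c ab(2)]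
      note ha = h[OF ab(1)] and hb = h[OF ab(2)]
      show "h b \<cdot> FArr Q \<phi> = FArr R \<phi> \<cdot> h a"
      proof (rule epicD[OF cD(2)[OF ab(1)] ca comp_hom[OF Q\<phi> hb(1)] comp_hom[OF ha(1) R\<phi>]])
        show "(h b \<cdot> FArr Q \<phi>) \<cdot> NComp c a = (FArr R \<phi> \<cdot> h a) \<cdot> NComp c a"
          using comp_assoc[OF ca Q\<phi> hb(1)] comp_assoc[OF ca ha(1) R\<phi>] comp_assoc[OF G\<phi> cb hb(1)]
            natural_square[OF c \<phi>] natural_square[OF g(1) \<phi>] ha(2) hb(2) by simp
      qed
    qed
    have "\<eta> \<cdot>\<^bsub>Fct M A\<^esub> c = g"
      by (rule natural_eqI[OF Fct_comp_hom[OF c \<eta>] g(1)]) (simp add: Fct_comp_component \<eta>_def h(2))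
    with \<eta> show "\<exists>h. h \<in> Hom (Fct M A) Q R \<and> h \<cdot>\<^bsub>Fct M A\<^esub> c = g" by blast
  next
    fix h k assume h: "h \<in> Hom (Fct M A) Q R \<and> h \<cdot>\<^bsub>Fct M A\<^esub> c = g"
      and k: "k \<in> Hom (Fct M A) Q R \<and> k \<cdot>\<^bsub>Fct M A\<^esub> c = g"
    show "h = k"
    proof (rule natural_eqI[OF conjunct1[OF h] conjunct1[OF k]])
      fix a assume a: "a \<in> Obj M"
      have "NComp h a \<cdot> NComp c a = NComp k a \<cdot> NComp c a"
        using Fct_comp_component[OF a, of h c] Fct_comp_component[OF a, of k c] h k by simp
      then show "NComp h a = NComp k a"
        using epicD[OF cD(2)[OF a] natural_component[OF c a] natural_component[OF conjunct1[OF h] a]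
          natural_component[OF conjunct1[OF k] a]] by simp
    qed
  qed
  ultimately show ?thesis
    using HomD[OF t] HomD[OF c] unfolding is_cokernel_def by (simp add: Hom_def)
qed

text \<open>\<^const>\<open>delta\<close> is an unspecified cokernel in the functor category. By the uniqueness of cokernels it is
  isomorphic to the one formed componentwise, from which it inherits the universal property at
  each object.\<close>

lemma cokernel_component:
  assumes p: "is_cokernel (Fct M A) t p" and t: "t \<in> Hom (Fct M A) F G"
  shows "p \<in> Hom (Fct M A) G (Cod (Fct M A) p)"
    and "a \<in> Obj M \<Longrightarrow> epic A (NComp p a)"
    and "a \<in> Obj M \<Longrightarrow> g \<in> Hom A (FObj G a) b \<Longrightarrow> zero_arrow A (g \<cdot> NComp t a) \<Longrightarrow>
      \<exists>h \<in> Hom A (FObj (Cod (Fct M A) p) a) b. h \<cdot> NComp p a = g"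
proof -
  define D where "D = Cod (Fct M A) p"
  have ph: "p \<in> Hom (Fct M A) G D" and zp: "zero_arrow (Fct M A) (p \<cdot>\<^bsub>Fct M A\<^esub> t)"
    using p HomD[OF t] by (auto simp: is_cokernel_def Hom_def D_def)
  then show "p \<in> Hom (Fct M A) G (Cod (Fct M A) p)" by (simp add: D_def)
  have p_univ: "\<exists>!h. h \<in> Hom (Fct M A) D R \<and> h \<cdot>\<^bsub>Fct M A\<^esub> p = g"
    if g: "g \<in> Hom (Fct M A) G R" "zero_arrow (Fct M A) (g \<cdot>\<^bsub>Fct M A\<^esub> t)" for g R
  proof -
    have "\<forall>g \<in> Arr (Fct M A). Dom (Fct M A) g = Cod (Fct M A) t \<and>
        zero_arrow (Fct M A) (g \<cdot>\<^bsub>Fct M A\<^esub> t) \<longrightarrow>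
        (\<exists>!h. h \<in> Hom (Fct M A) (Cod (Fct M A) p) (Cod (Fct M A) g) \<and> h \<cdot>\<^bsub>Fct M A\<^esub> p = g)"
      using p unfolding is_cokernel_def by (elim conjE)
    from this[rule_format, OF HomD(1)[OF g(1)]] show ?thesis
      using HomD[OF t] HomD[OF g(1)] g(2) by (simp only: simp_thms D_def)
  qed
  obtain Q c where c: "c \<in> Hom (Fct M A) G Q" "\<forall>a \<in> Obj M. is_cokernel A (NComp t a) (NComp c a)"
    using componentwise_cokernel[OF t] .
  have zc: "zero_arrow (Fct M A) (c \<cdot>\<^bsub>Fct M A\<^esub> t)"
    and c_univ: "\<exists>k \<in> Hom (Fct M A) Q D. k \<cdot>\<^bsub>Fct M A\<^esub> c = p"
  proof -
    have coker: "is_cokernel (Fct M A) t c"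
      using is_cokernelI_component[OF t c(1)] c(2) by blast
    then show "zero_arrow (Fct M A) (c \<cdot>\<^bsub>Fct M A\<^esub> t)" by (simp add: is_cokernel_def)
    have "\<forall>g \<in> Arr (Fct M A). Dom (Fct M A) g = Cod (Fct M A) t \<and>
        zero_arrow (Fct M A) (g \<cdot>\<^bsub>Fct M A\<^esub> t) \<longrightarrow>
        (\<exists>!h. h \<in> Hom (Fct M A) (Cod (Fct M A) c) (Cod (Fct M A) g) \<and> h \<cdot>\<^bsub>Fct M A\<^esub> c = g)"
      using coker unfolding is_cokernel_def by (elim conjE)
    from this[rule_format, OF HomD(1)[OF ph]]
    have "\<exists>!k. k \<in> Hom (Fct M A) Q D \<and> k \<cdot>\<^bsub>Fct M A\<^esub> c = p"
      using HomD[OF t] HomD[OF ph] HomD[OF c(1)] zp by (simp only: simp_thms)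
    from ex1_implies_ex[OF this] show "\<exists>k \<in> Hom (Fct M A) Q D. k \<cdot>\<^bsub>Fct M A\<^esub> c = p"
      by (simp only: Bex_def)
  qed
  obtain k where k: "k \<in> Hom (Fct M A) Q D" "k \<cdot>\<^bsub>Fct M A\<^esub> c = p" using c_univ ..
  obtain h where h: "h \<in> Hom (Fct M A) D Q" "h \<cdot>\<^bsub>Fct M A\<^esub> p = c"
    using ex1_implies_ex[OF p_univ[OF c(1) zc]] by (elim exE conjE)
  note kh = Fct_comp_hom[OF h(1) k(1)]
  have kc: "NComp k a \<cdot> NComp c a = NComp p a" and hp: "NComp h a \<cdot> NComp p a = NComp c a"
    if "a \<in> Obj M" for a
    using Fct_comp_component[OF that, of k c] Fct_comp_component[OF that, of h p] k(2) h(2) by simp_all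
  have "k \<cdot>\<^bsub>Fct M A\<^esub> h = Idt (Fct M A) D"
  proof (rule ex1_unique[OF p_univ[OF ph zp]])
    have "(k \<cdot>\<^bsub>Fct M A\<^esub> h) \<cdot>\<^bsub>Fct M A\<^esub> p = p"
    proof (rule natural_eqI[OF Fct_comp_hom[OF ph kh] ph])
      fix a assume a: "a \<in> Obj M"
      show "NComp ((k \<cdot>\<^bsub>Fct M A\<^esub> h) \<cdot>\<^bsub>Fct M A\<^esub> p) a = NComp p a"
        using comp_assoc[OF natural_component[OF ph a] natural_component[OF h(1) a]
          natural_component[OF k(1) a]] kc[OF a] hp[OF a] a by (simp add: Fct_comp_component)
    qed
    then show "k \<cdot>\<^bsub>Fct M A\<^esub> h \<in> Hom (Fct M A) D D \<and> (k \<cdot>\<^bsub>Fct M A\<^esub> h) \<cdot>\<^bsub>Fct M A\<^esub> p = p"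
      using kh by blast
    note iD = Fct_idt_hom[OF natural_functors(2)[OF ph]]
    have "Idt (Fct M A) D \<cdot>\<^bsub>Fct M A\<^esub> p = p"
      by (rule natural_eqI[OF Fct_comp_hom[OF ph iD] ph])
        (simp add: Fct_comp_component Fct_idt_component idt_comp[OF natural_component[OF ph]])
    then show "Idt (Fct M A) D \<in> Hom (Fct M A) D D \<and> Idt (Fct M A) D \<cdot>\<^bsub>Fct M A\<^esub> p = p"
      using iD by blast
  qed
  then have kh_id: "NComp k a \<cdot> NComp h a = Idt A (FObj D a)" if "a \<in> Obj M" for a
    using Fct_comp_component[OF that, of k h] Fct_idt_component[OF that] by simp
  have cD: "epic A (NComp c a)" "\<And>b g. g \<in> Hom A (FObj G a) b \<Longrightarrow> zero_arrow A (g \<cdot> NComp t a) \<Longrightarrow>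
      \<exists>h \<in> Hom A (FObj Q a) b. h \<cdot> NComp c a = g" if "a \<in> Obj M" for a
    using is_cokernelD(3,4)[OF bspec[OF c(2) that] natural_component[OF t that]]
      HomD(3)[OF natural_component[OF c(1) that]] by simp_all
  show "epic A (NComp p a)" if a: "a \<in> Obj M" for a
  proof (rule epicI_zero[OF natural_component[OF ph a]])
    note ca = natural_component[OF c(1) a] and ka = natural_component[OF k(1) a]
      and ha = natural_component[OF h(1) a]
    fix b g assume g: "g \<in> Hom A (FObj D a) b" "zero_arrow A (g \<cdot> NComp p a)"
    then have "zero_arrow A ((g \<cdot> NComp k a) \<cdot> NComp c a)"
      using comp_assoc[OF ca ka g(1)] kc[OF a] by simp
    then have "zero_arrow A (g \<cdot> NComp k a)"
      using epic_cancel_zero[OF cD(1)[OF a] ca comp_hom[OF ka g(1)]] by blast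
    then have "zero_arrow A ((g \<cdot> NComp k a) \<cdot> NComp h a)"
      using zero_arrow_comp_right[OF _ ha comp_hom[OF ka g(1)]] by blast
    then show "zero_arrow A g"
      using comp_assoc[OF ha ka g(1)] kh_id[OF a] comp_idt[OF g(1)] by simp
  qed
  show "\<exists>h \<in> Hom A (FObj (Cod (Fct M A) p) a) b. h \<cdot> NComp p a = g"
    if a: "a \<in> Obj M" and g: "g \<in> Hom A (FObj G a) b" "zero_arrow A (g \<cdot> NComp t a)" for a b g
  proof -
    obtain u where u: "u \<in> Hom A (FObj Q a) b" "u \<cdot> NComp c a = g" using cD(2)[OF a g] ..
    note ha = natural_component[OF h(1) a]
    have "(u \<cdot> NComp h a) \<cdot> NComp p a = g"
      using comp_assoc[OF natural_component[OF ph a] ha u(1)] hp[OF a] u(2) by simp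
    then show ?thesis using comp_hom[OF ha u(1)] unfolding D_def by blast
  qed
qed

text \<open>All arrows into an object \<open>F a\<close> vanish, so \<open>F\<close> has only one subfunctor.\<close>

lemma acc_subfunctors_zero:
  assumes "zero_object (Fct M A) F"
  shows "ascending_chain_condition (subfunctors F)"
proof -
  have "S a = {f. \<exists>b. f \<in> Hom A b (FObj F a)}" if S: "S \<in> subfunctors F" and a: "a \<in> Obj M" for S a
  proof -
    obtain q d where q: "q \<in> Hom A (FObj F a) d" "epic A q" "S a = annihilated q"
      using subobjectE[OF subfunctor_subobject[OF S a]] .
    have zid: "zero_arrow A (Idt A (FObj F a))" using zero_functor_identities[OF assms a] .
    have "zero_arrow A (q \<cdot> f)" if f: "f \<in> Hom A b (FObj F a)" for b f
      using zero_arrow_comp_left[OF zero_arrow_comp_right[OF zid f idt_hom[OF hom_obj(2)[OF f]]]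
        comp_hom[OF f idt_hom[OF hom_obj(2)[OF f]]] q(1)] idt_comp[OF f] by simp
    then show ?thesis unfolding q(3) using annihilated_iff[OF q(1)] by blast
  qed
  then have "S \<le> S'" if "S \<in> subfunctors F" "S' \<in> subfunctors F" for S S'
    using that by (intro subfunctor_leI[OF that(1)]) blast
  then have "S = S'" if "S \<in> subfunctors F" "S' \<in> subfunctors F" for S S'
    using that by (blast intro: antisym)
  then show ?thesis unfolding ascending_chain_condition_def by blast
qed

end

section \<open>Saturations and leading parts\<close>

locale monoidal_to_abelian = functors_to_abelian M A + M: symmetric_monoidal_category M
  for M :: "('o, 'm, 'w) smcat_scheme" and A :: "('p, 'n, 'y) cat_scheme" (structure) +
  assumes initial: "initial_object M (unit_obj M)"
begin

text \<open>The canonical map \<open>y \<cong> 0 + y \<rightarrow> x + y\<close>, whose image under \<open>F\<close> is the component of \<^const>\<open>to_tau\<close>.\<close>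

definition summand :: "'o \<Rightarrow> 'o \<Rightarrow> 'm" where
  "summand x y = plus_arr M (from_unit M x) (Idt M y) \<cdot>\<^bsub>M\<^esub> inverse_arr M (lunit M y)"

lemma from_unit_hom:
  assumes "x \<in> Obj M" shows "from_unit M x \<in> Hom M (unit_obj M) x"
proof -
  have "\<exists>!f. f \<in> Hom M (unit_obj M) x" using initial assms by (simp add: initial_object_def)
  from theI'[OF this] show ?thesis by (simp add: from_unit_def)
qed

lemma summand_hom:
  assumes x: "x \<in> Obj M" and y: "y \<in> Obj M"
  shows "summand x y \<in> Hom M y (plus_obj M x y)"
proof -
  obtain g where "g \<in> Hom M y (plus_obj M (unit_obj M) y)" "inverse_arr M (lunit M y) = g"
    using M.isomorphism_hom_inverse[OF M.lunit_iso[OF y] M.lunit_hom[OF y]] .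
  then show ?thesis
    unfolding summand_def
    using M.comp_hom M.plus_hom[OF from_unit_hom[OF x] M.idt_hom[OF y]] by blast
qed

lemma summand_natural:
  assumes x: "x \<in> Obj M" and \<phi>: "\<phi> \<in> Hom M y y'"
  shows "summand x y' \<cdot>\<^bsub>M\<^esub> \<phi> = plus_arr M (Idt M x) \<phi> \<cdot>\<^bsub>M\<^esub> summand x y"
proof -
  note yy' = M.hom_obj[OF \<phi>]
  note l = M.lunit_hom[OF yy'(1)] and l' = M.lunit_hom[OF yy'(2)]
  obtain g where g: "g \<in> Hom M y (plus_obj M (unit_obj M) y)" "g \<cdot>\<^bsub>M\<^esub> lunit M y = Idt M (plus_obj M (unit_obj M) y)"
    "lunit M y \<cdot>\<^bsub>M\<^esub> g = Idt M y" "inverse_arr M (lunit M y) = g"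
    using M.isomorphism_hom_inverse[OF M.lunit_iso[OF yy'(1)] l] .
  obtain g' where g': "g' \<in> Hom M y' (plus_obj M (unit_obj M) y')"
    "g' \<cdot>\<^bsub>M\<^esub> lunit M y' = Idt M (plus_obj M (unit_obj M) y')"
    "lunit M y' \<cdot>\<^bsub>M\<^esub> g' = Idt M y'" "inverse_arr M (lunit M y') = g'"
    using M.isomorphism_hom_inverse[OF M.lunit_iso[OF yy'(2)] l'] .
  define s where "s = plus_arr M (Idt M (unit_obj M)) \<phi>"
  have s: "s \<in> Hom M (plus_obj M (unit_obj M) y) (plus_obj M (unit_obj M) y')"
    unfolding s_def using M.plus_hom[OF M.idt_hom[OF M.unit_obj] \<phi>] .
  have sg: "s \<cdot>\<^bsub>M\<^esub> g = g' \<cdot>\<^bsub>M\<^esub> \<phi>"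
  proof -
    have "s \<cdot>\<^bsub>M\<^esub> g = (g' \<cdot>\<^bsub>M\<^esub> lunit M y') \<cdot>\<^bsub>M\<^esub> (s \<cdot>\<^bsub>M\<^esub> g)"
      using g'(2) M.idt_comp[OF M.comp_hom[OF g(1) s]] by simp
    also have "\<dots> = g' \<cdot>\<^bsub>M\<^esub> ((lunit M y' \<cdot>\<^bsub>M\<^esub> s) \<cdot>\<^bsub>M\<^esub> g)"
      using M.comp_assoc[OF M.comp_hom[OF g(1) s] l' g'(1)] M.comp_assoc[OF g(1) s l'] by simp
    also have "\<dots> = g' \<cdot>\<^bsub>M\<^esub> (\<phi> \<cdot>\<^bsub>M\<^esub> (lunit M y \<cdot>\<^bsub>M\<^esub> g))"
      using M.lunit_natural[OF \<phi>] M.comp_assoc[OF g(1) l \<phi>] by (simp add: s_def)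
    finally show ?thesis using g(3) M.comp_idt[OF \<phi>] by simp
  qed
  note f = from_unit_hom[OF x]
  define e where "e = plus_arr M (from_unit M x) (Idt M y)"
  define e' where "e' = plus_arr M (from_unit M x) (Idt M y')"
  define t where "t = plus_arr M (Idt M x) \<phi>"
  have e: "e \<in> Hom M (plus_obj M (unit_obj M) y) (plus_obj M x y)"
    and e': "e' \<in> Hom M (plus_obj M (unit_obj M) y') (plus_obj M x y')"
    and t: "t \<in> Hom M (plus_obj M x y) (plus_obj M x y')"
    unfolding e_def e'_def t_def
    using M.plus_hom[OF f M.idt_hom[OF yy'(1)]] M.plus_hom[OF f M.idt_hom[OF yy'(2)]]
      M.plus_hom[OF M.idt_hom[OF x] \<phi>] .
  have "e' \<cdot>\<^bsub>M\<^esub> s = plus_arr M (from_unit M x) \<phi>"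
    using M.plus_comp[OF M.idt_hom[OF M.unit_obj] f \<phi> M.idt_hom[OF yy'(2)]]
      M.comp_idt[OF f] M.idt_comp[OF \<phi>] by (simp add: e'_def s_def)
  also have "\<dots> = t \<cdot>\<^bsub>M\<^esub> e"
    using M.plus_comp[OF f M.idt_hom[OF x] M.idt_hom[OF yy'(1)] \<phi>]
      M.idt_comp[OF f] M.comp_idt[OF \<phi>] by (simp add: e_def t_def)
  finally have "e' \<cdot>\<^bsub>M\<^esub> s = t \<cdot>\<^bsub>M\<^esub> e" .
  then have "(e' \<cdot>\<^bsub>M\<^esub> g') \<cdot>\<^bsub>M\<^esub> \<phi> = t \<cdot>\<^bsub>M\<^esub> (e \<cdot>\<^bsub>M\<^esub> g)"
    using M.comp_assoc[OF \<phi> g'(1) e'] M.comp_assoc[OF g(1) s e'] M.comp_assoc[OF g(1) e t] sg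
    by simp
  then show ?thesis by (simp add: summand_def g(4) g'(4) e_def e'_def t_def)
qed

lemma tau_functor:
  assumes F: "cat_functor M A F" and x: "x \<in> Obj M"
  shows "cat_functor M A (tau M x F)"
proof (rule cat_functor.intro)
  show "category M" "category A" using M.category_axioms category_axioms .
  note ix = M.idt_hom[OF x]
  fix a assume a: "a \<in> Obj M"
  show "FObj (tau M x F) a \<in> Obj A"
    using cat_functor.map_obj[OF F M.plus_obj[OF x a]] by (simp add: tau_def)
  show "FArr (tau M x F) (Idt M a) = Idt A (FObj (tau M x F) a)"
    using cat_functor.map_idt[OF F M.plus_obj[OF x a]] M.plus_idt[OF x a] by (simp add: tau_def)
next
  note ix = M.idt_hom[OF x]
  fix \<phi> a b assume \<phi>: "\<phi> \<in> Hom M a b"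
  show "FArr (tau M x F) \<phi> \<in> Hom A (FObj (tau M x F) a) (FObj (tau M x F) b)"
    using cat_functor.map_hom[OF F M.plus_hom[OF ix \<phi>]] by (simp add: tau_def)
  fix \<psi> c assume \<psi>: "\<psi> \<in> Hom M b c"
  show "FArr (tau M x F) (\<psi> \<cdot>\<^bsub>M\<^esub> \<phi>) = FArr (tau M x F) \<psi> \<cdot> FArr (tau M x F) \<phi>"
    using cat_functor.map_comp[OF F M.plus_hom[OF ix \<phi>] M.plus_hom[OF ix \<psi>]]
      M.plus_comp[OF ix ix \<phi> \<psi>] M.idt_comp[OF ix] by (simp add: tau_def)
qed

lemma summand_map_hom:
  assumes "cat_functor M A F" "x \<in> Obj M" "y \<in> Obj M"
  shows "FArr F (summand x y) \<in> Hom A (FObj F y) (FObj F (plus_obj M x y))"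
  using cat_functor.map_hom[OF assms(1) summand_hom[OF assms(2,3)]] .

lemma summand_map_natural:
  assumes F: "cat_functor M A F" and x: "x \<in> Obj M" and \<phi>: "\<phi> \<in> Hom M y y'"
  shows "FArr F (summand x y') \<cdot> FArr F \<phi> = FArr F (plus_arr M (Idt M x) \<phi>) \<cdot> FArr F (summand x y)"
  using cat_functor.map_comp[OF F \<phi> summand_hom[OF x M.hom_obj(2)[OF \<phi>]]]
    cat_functor.map_comp[OF F summand_hom[OF x M.hom_obj(1)[OF \<phi>]] M.plus_hom[OF M.idt_hom[OF x] \<phi>]]
    summand_natural[OF x \<phi>] by simp

lemma to_tau_hom:
  assumes F: "cat_functor M A F" and x: "x \<in> Obj M"
  shows "to_tau M x F \<in> Hom (Fct M A) F (tau M x F)"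
  unfolding to_tau_def summand_def[symmetric]
  using summand_map_hom[OF F x] summand_map_natural[OF F x]
  by (intro naturalI[OF F tau_functor[OF F x]]) (simp_all add: tau_def)

lemma to_tau_component: "y \<in> Obj M \<Longrightarrow> NComp (to_tau M x F) y = FArr F (summand x y)"
  by (simp add: to_tau_def summand_def)

lemma delta_projection_exists:
  assumes F: "cat_functor M A F" and x: "x \<in> Obj M"
  obtains p where "p \<in> Hom (Fct M A) (tau M x F) (delta M A x F)"
    "\<forall>y \<in> Obj M. epic A (NComp p y)"
    "\<forall>y \<in> Obj M. \<forall>c. \<forall>g \<in> Hom A (FObj F (plus_obj M x y)) c. zero_arrow A (g \<cdot> FArr F (summand x y)) \<longrightarrow>
      (\<exists>h \<in> Hom A (FObj (delta M A x F) y) c. h \<cdot> NComp p y = g)"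
proof -
  note t = to_tau_hom[OF F x]
  obtain Q c where c: "c \<in> Hom (Fct M A) (tau M x F) Q"
    "\<forall>a \<in> Obj M. is_cokernel A (NComp (to_tau M x F) a) (NComp c a)"
    using componentwise_cokernel[OF t] .
  have "is_cokernel (Fct M A) (to_tau M x F) c"
    using is_cokernelI_component[OF t c(1)] c(2) by blast
  then have "\<exists>G p. is_cokernel (Fct M A) (to_tau M x F) p \<and> Cod (Fct M A) p = G" by blast
  from someI_ex[OF this]
  have "\<exists>p. is_cokernel (Fct M A) (to_tau M x F) p \<and> Cod (Fct M A) p = delta M A x F"
    unfolding delta_def .
  then obtain p where p: "is_cokernel (Fct M A) (to_tau M x F) p" "Cod (Fct M A) p = delta M A x F"
    by blast
  show thesis
    using cokernel_component[OF p(1) t] p(2) by (intro that[of p]) (auto simp: to_tau_component tau_def)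
qed

text \<open>The elements of \<open>F y\<close> that enter \<open>S\<close> after adding the summand \<open>x\<close>.\<close>

definition saturation :: "('o, 'm, 'p, 'n) ftor \<Rightarrow> 'o \<Rightarrow> ('o \<Rightarrow> 'n set) \<Rightarrow> 'o \<Rightarrow> 'n set" where
  "saturation F x S y =
    (if y \<in> Obj M then preimage (FArr F (summand x y)) (S (plus_obj M x y)) else {})"

lemma saturation_mono: "S \<le> S' \<Longrightarrow> saturation F x S \<le> saturation F x S'"
  using preimage_mono by (simp add: saturation_def le_fun_def)

lemma saturation_subfunctor:
  assumes F: "cat_functor M A F" and x: "x \<in> Obj M" and S: "S \<in> subfunctors F"
  shows "saturation F x S \<in> subfunctors F"
  unfolding subfunctors_def mem_Collect_eq
proof (intro conjI ballI allI impI)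
  show "saturation F x S a \<in> subobjects (FObj F a)" if a: "a \<in> Obj M" for a
    using preimage_is_subobject[OF summand_map_hom[OF F x a]
        subfunctor_subobject[OF S M.plus_obj[OF x a]]] a by (simp add: saturation_def)
  show "saturation F x S a = {}" if "a \<notin> Obj M" for a using that by (simp add: saturation_def)
  fix a b \<phi> f assume \<phi>: "\<phi> \<in> Hom M a b" and f: "f \<in> saturation F x S a"
  note ab = M.hom_obj[OF \<phi>]
  note ia = summand_map_hom[OF F x ab(1)] and ib = summand_map_hom[OF F x ab(2)]
  note F\<phi> = cat_functor.map_hom[OF F \<phi>]
  have x\<phi>: "plus_arr M (Idt M x) \<phi> \<in> Hom M (plus_obj M x a) (plus_obj M x b)"
    using M.plus_hom[OF M.idt_hom[OF x] \<phi>] .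
  have fh: "f \<in> Hom A (Dom A f) (FObj F a)" and fS: "FArr F (summand x a) \<cdot> f \<in> S (plus_obj M x a)"
    using f ab(1) HomD(2)[OF ia] by (simp_all add: saturation_def preimage_def Hom_def)
  have "FArr F (summand x b) \<cdot> (FArr F \<phi> \<cdot> f) =
      FArr F (plus_arr M (Idt M x) \<phi>) \<cdot> (FArr F (summand x a) \<cdot> f)"
    using comp_assoc[OF fh F\<phi> ib] comp_assoc[OF fh ia cat_functor.map_hom[OF F x\<phi>]]
      summand_map_natural[OF F x \<phi>] by simp
  then have "FArr F (summand x b) \<cdot> (FArr F \<phi> \<cdot> f) \<in> S (plus_obj M x b)"
    using subfunctor_closed[OF S x\<phi> fS] by simp
  then show "FArr F \<phi> \<cdot> f \<in> saturation F x S b"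
    using HomD[OF comp_hom[OF fh F\<phi>]] HomD(2)[OF ib] ab(2) by (simp add: saturation_def preimage_def)
qed

lemma saturation_increasing:
  assumes F: "cat_functor M A F" and x: "x \<in> Obj M" and S: "S \<in> subfunctors F"
  shows "S \<le> saturation F x S"
proof (rule subfunctor_leI[OF S])
  fix a assume a: "a \<in> Obj M"
  show "S a \<subseteq> saturation F x S a"
  proof
    fix f assume f: "f \<in> S a"
    show "f \<in> saturation F x S a"
      using subfunctor_closed[OF S summand_hom[OF x a] f] a
        HomD[OF subobject_hom[OF subfunctor_subobject[OF S a] f]] HomD(2)[OF summand_map_hom[OF F x a]]
      by (simp add: saturation_def preimage_def)
  qed
qed

definition iterated_saturation ::
  "('o, 'm, 'p, 'n) ftor \<Rightarrow> (nat \<Rightarrow> 'o) \<Rightarrow> nat list \<Rightarrow> ('o \<Rightarrow> 'n set) \<Rightarrow> 'o \<Rightarrow> 'n set" where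
  "iterated_saturation F t w = fold (\<lambda>k. saturation F (t k)) w"

lemma iterated_saturation_mono:
  "S \<le> S' \<Longrightarrow> iterated_saturation F t w S \<le> iterated_saturation F t w S'"
  by (induction w arbitrary: S S') (simp_all add: iterated_saturation_def saturation_mono)

lemma iterated_saturation_subfunctor:
  assumes "cat_functor M A F" "\<And>k. k \<in> set w \<Longrightarrow> t k \<in> Obj M" "S \<in> subfunctors F"
  shows "iterated_saturation F t w S \<in> subfunctors F"
  using assms(2,3)
  by (induction w arbitrary: S) (simp_all add: iterated_saturation_def saturation_subfunctor[OF assms(1)])

text \<open>Saturation is monotone and enlarges subfunctors, so inserting a letter anywhere in the word
  enlarges the result.\<close>

lemma iterated_saturation_subseq:
  assumes F: "cat_functor M A F" and "subseq v w" "\<And>k. k \<in> set w \<Longrightarrow> t k \<in> Obj M" "S \<in> subfunctors F"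
  shows "iterated_saturation F t v S \<le> iterated_saturation F t w S"
  using assms(2-4)
proof (induction v w arbitrary: S rule: list_emb.induct)
  case (list_emb_Nil w)
  then show ?case
  proof (induction w arbitrary: S)
    case Nil
    show ?case by (simp add: iterated_saturation_def)
  next
    case (Cons k w)
    have "S \<le> saturation F (t k) S"
      using saturation_increasing[OF F _ Cons.prems(2)] Cons.prems(1) by simp
    also have "\<dots> \<le> iterated_saturation F t w (saturation F (t k) S)"
      using Cons.IH[OF _ saturation_subfunctor[OF F _ Cons.prems(2)]] Cons.prems(1)
      by (simp add: iterated_saturation_def)
    finally show ?case by (simp add: iterated_saturation_def)
  qed
next
  case (list_emb_Cons v w k)
  have "S \<le> saturation F (t k) S"
    using saturation_increasing[OF F _ list_emb_Cons.prems(2)] list_emb_Cons.prems(1) by simp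
  then have "iterated_saturation F t v S \<le> iterated_saturation F t v (saturation F (t k) S)"
    by (rule iterated_saturation_mono)
  also have "\<dots> \<le> iterated_saturation F t w (saturation F (t k) S)"
    using list_emb_Cons.IH[OF _ saturation_subfunctor[OF F _ list_emb_Cons.prems(2)]] list_emb_Cons.prems(1)
    by simp
  finally show ?case by (simp add: iterated_saturation_def)
next
  case (list_emb_Cons2 k l v w)
  then show ?case
    using list_emb_Cons2.IH[OF _ saturation_subfunctor[OF F _ list_emb_Cons2.prems(2)]]
    by (simp add: iterated_saturation_def)
qed

text \<open>The image of \<open>\<tau>\<^sub>x S\<close> in \<open>\<delta>\<^sub>x F\<close>, for \<open>p\<close> the projection \<open>\<tau>\<^sub>x F \<rightarrow> \<delta>\<^sub>x F\<close>.\<close>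

definition leading :: "('o, 'm, 'p, 'n) ntrans \<Rightarrow> 'o \<Rightarrow> ('o \<Rightarrow> 'n set) \<Rightarrow> 'o \<Rightarrow> 'n set" where
  "leading p x S y = (if y \<in> Obj M then direct_image (NComp p y) (S (plus_obj M x y)) else {})"

lemma leading_mono: "S \<le> S' \<Longrightarrow> leading p x S \<le> leading p x S'"
  using direct_image_mono by (simp add: leading_def le_fun_def)

lemma leading_subfunctor:
  assumes F: "cat_functor M A F" and x: "x \<in> Obj M" and p: "p \<in> Hom (Fct M A) (tau M x F) D"
    and S: "S \<in> subfunctors F"
  shows "leading p x S \<in> subfunctors D"
  unfolding subfunctors_def mem_Collect_eq
proof (intro conjI ballI allI impI)
  have pa: "NComp p a \<in> Hom A (FObj F (plus_obj M x a)) (FObj D a)" if "a \<in> Obj M" for a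
    using natural_component[OF p that] by (simp add: tau_def)
  show leading: "leading p x S a \<in> subobjects (FObj D a)" if a: "a \<in> Obj M" for a
    using direct_image_is_subobject[OF pa[OF a] subfunctor_subobject[OF S M.plus_obj[OF x a]]] a
    by (simp add: leading_def)
  show "leading p x S a = {}" if "a \<notin> Obj M" for a using that by (simp add: leading_def)
  fix a b \<phi> g assume \<phi>: "\<phi> \<in> Hom M a b" and g: "g \<in> leading p x S a"
  note ab = M.hom_obj[OF \<phi>]
  note D\<phi> = cat_functor.map_hom[OF natural_functors(2)[OF p] \<phi>]
  have gh: "g \<in> Hom A (Dom A g) (FObj D a)" using subobject_hom[OF leading[OF ab(1)] g] .
  have x\<phi>: "plus_arr M (Idt M x) \<phi> \<in> Hom M (plus_obj M x a) (plus_obj M x b)"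
    using M.plus_hom[OF M.idt_hom[OF x] \<phi>] .
  have "FArr D \<phi> \<cdot> g \<in> direct_image (NComp p b) (S (plus_obj M x b))"
    unfolding direct_image_iff[OF pa[OF ab(2)] comp_hom[OF gh D\<phi>]]
  proof (intro allI ballI impI)
    fix c s assume s: "s \<in> Hom A (FObj D b) c"
      "\<forall>f \<in> S (plus_obj M x b). zero_arrow A (s \<cdot> (NComp p b \<cdot> f))"
    have "zero_arrow A ((s \<cdot> FArr D \<phi>) \<cdot> (NComp p a \<cdot> f))" if f: "f \<in> S (plus_obj M x a)" for f
    proof -
      note fh = subobject_hom[OF subfunctor_subobject[OF S M.plus_obj[OF x ab(1)]] f]
      note Fx\<phi> = cat_functor.map_hom[OF F x\<phi>]
      have "FArr D \<phi> \<cdot> NComp p a = NComp p b \<cdot> FArr F (plus_arr M (Idt M x) \<phi>)"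
        using natural_square[OF p \<phi>] by (simp add: tau_def)
      then have "(s \<cdot> FArr D \<phi>) \<cdot> (NComp p a \<cdot> f) =
          s \<cdot> (NComp p b \<cdot> (FArr F (plus_arr M (Idt M x) \<phi>) \<cdot> f))"
        using comp_assoc[OF comp_hom[OF fh pa[OF ab(1)]] D\<phi> s(1)] comp_assoc[OF fh pa[OF ab(1)] D\<phi>]
          comp_assoc[OF fh Fx\<phi> pa[OF ab(2)]] by simp
      then show ?thesis using s(2) subfunctor_closed[OF S x\<phi> f] by simp
    qed
    then have "zero_arrow A ((s \<cdot> FArr D \<phi>) \<cdot> g)"
      using g comp_hom[OF D\<phi> s(1)] ab(1) direct_image_iff[OF pa[OF ab(1)] gh]
      by (simp add: leading_def)
    then show "zero_arrow A (s \<cdot> (FArr D \<phi> \<cdot> g))" using comp_assoc[OF gh D\<phi> s(1)] by simp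
  qed
  then show "FArr D \<phi> \<cdot> g \<in> leading p x S b" using ab(2) by (simp add: leading_def)
qed

text \<open>The induction step of the basis theorem. \<open>G w n\<close> is the saturation of the \<open>n\<close>-th subfunctor along
  the word \<open>w\<close>, and \<open>L\<close> an index from which on the leading parts of all \<open>G w n\<close>, and their values at
  the unit, are constant. That \<open>G w n\<close> is constant at a sum of \<open>ks\<close> follows by induction on \<open>ks\<close>,
  moving its first letter to the end of \<open>w\<close>; the concatenation, which does not change, is kept sorted.\<close>

lemma acc_subfunctors_if_acc_delta:
  fixes t :: "nat \<Rightarrow> 'o"
  assumes F: "cat_functor M A F" and t: "\<And>k. k < r \<Longrightarrow> t k \<in> Obj M"
    and gen: "\<And>x. x \<in> Obj M \<Longrightarrow> \<exists>ks. set ks \<subseteq> {..<r} \<and> retract M x (finite_sum M (map t ks))"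
    and acc_delta: "\<And>k. k < r \<Longrightarrow> ascending_chain_condition (subfunctors (delta M A (t k) F))"
    and acc_unit: "ascending_chain_condition (subobjects (FObj F (unit_obj M)))"
  shows "ascending_chain_condition (subfunctors F)"
  unfolding ascending_chain_condition_def
proof (intro allI impI)
  fix s :: "nat \<Rightarrow> 'o \<Rightarrow> 'n set" assume s: "range s \<subseteq> subfunctors F \<and> mono s"
  have sS: "s n \<in> subfunctors F" for n using s by blast
  have s_mono: "m \<le> n \<Longrightarrow> s m \<le> s n" for m n using s by (simp add: monoD)
  define G where "G w n = iterated_saturation F t w (s n)" for w n
  have word_t: "t k \<in> Obj M" if "w \<in> sorted_words r" "k \<in> set w" for w k
    using that t by (auto simp: sorted_words_def)
  have G: "G w n \<in> subfunctors F" if "w \<in> sorted_words r" for w n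
    unfolding G_def using iterated_saturation_subfunctor[OF F word_t[OF that] sS] by simp
  have G_mono: "m \<le> n \<Longrightarrow> G w m \<le> G w n" for m n w
    unfolding G_def by (intro iterated_saturation_mono s_mono)
  have G_subseq: "G v n \<le> G w n" if "w \<in> sorted_words r" "subseq v w" for v w n
    unfolding G_def using iterated_saturation_subseq[OF F that(2) word_t[OF that(1)] sS] by simp
  have "\<forall>k. \<exists>p. k < r \<longrightarrow> p \<in> Hom (Fct M A) (tau M (t k) F) (delta M A (t k) F) \<and>
    (\<forall>y \<in> Obj M. \<forall>c. \<forall>g \<in> Hom A (FObj F (plus_obj M (t k) y)) c.
      zero_arrow A (g \<cdot> FArr F (summand (t k) y)) \<longrightarrow>
      (\<exists>h \<in> Hom A (FObj (delta M A (t k) F) y) c. h \<cdot> NComp p y = g))"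
  proof
    fix k
    show "\<exists>p. k < r \<longrightarrow> p \<in> Hom (Fct M A) (tau M (t k) F) (delta M A (t k) F) \<and>
      (\<forall>y \<in> Obj M. \<forall>c. \<forall>g \<in> Hom A (FObj F (plus_obj M (t k) y)) c.
        zero_arrow A (g \<cdot> FArr F (summand (t k) y)) \<longrightarrow>
        (\<exists>h \<in> Hom A (FObj (delta M A (t k) F) y) c. h \<cdot> NComp p y = g))"
    proof (cases "k < r")
      case True
      obtain p where "p \<in> Hom (Fct M A) (tau M (t k) F) (delta M A (t k) F)"
        "\<forall>y \<in> Obj M. epic A (NComp p y)"
        "\<forall>y \<in> Obj M. \<forall>c. \<forall>g \<in> Hom A (FObj F (plus_obj M (t k) y)) c.
          zero_arrow A (g \<cdot> FArr F (summand (t k) y)) \<longrightarrow>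
          (\<exists>h \<in> Hom A (FObj (delta M A (t k) F) y) c. h \<cdot> NComp p y = g)"
        using delta_projection_exists[OF F t[OF True]] .
      then show ?thesis by (intro exI[of _ p] impI conjI)
    qed simp
  qed
  from choice[OF this] obtain p where "\<forall>k. k < r \<longrightarrow>
    p k \<in> Hom (Fct M A) (tau M (t k) F) (delta M A (t k) F) \<and>
    (\<forall>y \<in> Obj M. \<forall>c. \<forall>g \<in> Hom A (FObj F (plus_obj M (t k) y)) c.
      zero_arrow A (g \<cdot> FArr F (summand (t k) y)) \<longrightarrow>
      (\<exists>h \<in> Hom A (FObj (delta M A (t k) F) y) c. h \<cdot> NComp (p k) y = g))" ..
  then have p: "p k \<in> Hom (Fct M A) (tau M (t k) F) (delta M A (t k) F)"
    and p_univ: "\<forall>y \<in> Obj M. \<forall>c. \<forall>g \<in> Hom A (FObj F (plus_obj M (t k) y)) c.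
      zero_arrow A (g \<cdot> FArr F (summand (t k) y)) \<longrightarrow>
      (\<exists>h \<in> Hom A (FObj (delta M A (t k) F) y) c. h \<cdot> NComp (p k) y = g)"
    if "k < r" for k using that by auto
  have "\<exists>N. \<forall>n \<ge> N. \<forall>w \<in> sorted_words r. leading (p k) (t k) (G w n) = leading (p k) (t k) (G w N)"
    if k: "k < r" for k
  proof (rule chains_indexed_by_sorted_words_stabilise[OF acc_delta[OF k]])
    show "leading (p k) (t k) (G w n) \<in> subfunctors (delta M A (t k) F)" if "w \<in> sorted_words r" for w n
      using leading_subfunctor[OF F t[OF k] p[OF k] G[OF that]] .
    show "leading (p k) (t k) (G w m) \<le> leading (p k) (t k) (G w n)" if "m \<le> n" for w m n
      using leading_mono[OF G_mono[OF that]] .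
    show "leading (p k) (t k) (G v n) \<le> leading (p k) (t k) (G w n)"
      if "w \<in> sorted_words r" "subseq v w" for v w n
      using leading_mono[OF G_subseq[OF that]] .
  qed
  then have "\<forall>k. \<exists>N. k < r \<longrightarrow>
      (\<forall>n \<ge> N. \<forall>w \<in> sorted_words r. leading (p k) (t k) (G w n) = leading (p k) (t k) (G w N))"
    by blast
  from choice[OF this] obtain N where "\<forall>k. k < r \<longrightarrow>
      (\<forall>n \<ge> N k. \<forall>w \<in> sorted_words r. leading (p k) (t k) (G w n) = leading (p k) (t k) (G w (N k)))" ..
  then have N: "leading (p k) (t k) (G w n) = leading (p k) (t k) (G w (N k))"
    if "k < r" "n \<ge> N k" "w \<in> sorted_words r" for k n w
    using that by blast
  have "\<exists>N. \<forall>n \<ge> N. \<forall>w \<in> sorted_words r. G w n (unit_obj M) = G w N (unit_obj M)"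
  proof (rule chains_indexed_by_sorted_words_stabilise[OF acc_unit])
    show "G w n (unit_obj M) \<in> subobjects (FObj F (unit_obj M))" if "w \<in> sorted_words r" for w n
      using subfunctor_subobject[OF G[OF that] M.unit_obj] .
    show "G w m (unit_obj M) \<subseteq> G w n (unit_obj M)" if "m \<le> n" for w m n
      using G_mono[OF that] by (simp add: le_fun_def)
    show "G v n (unit_obj M) \<subseteq> G w n (unit_obj M)" if "w \<in> sorted_words r" "subseq v w" for v w n
      using G_subseq[OF that] by (simp add: le_fun_def)
  qed
  then obtain N' where N': "G w n (unit_obj M) = G w N' (unit_obj M)"
    if "n \<ge> N'" "w \<in> sorted_words r" for n w
    by metis
  define L where "L = Max (insert N' (N ` {..<r}))"
  have L: "N' \<le> L" "k < r \<Longrightarrow> N k \<le> L" for k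
    unfolding L_def by simp_all
  have stable: "G w n (finite_sum M (map t ks)) = G w L (finite_sum M (map t ks))"
    if "w @ ks \<in> sorted_words r" "n \<ge> L" for w ks n
    using that
  proof (induction ks arbitrary: w)
    case Nil
    then have "G w n (unit_obj M) = G w L (unit_obj M)"
      using N'[of n w] N'[of L w] L(1) by simp
    then show ?case by (simp add: finite_sum_def)
  next
    case (Cons k ks)
    define y where "y = finite_sum M (map t ks)"
    have k: "k < r" and w: "w \<in> sorted_words r" and wk: "(w @ [k]) @ ks \<in> sorted_words r"
      using Cons.prems(1) by (auto simp: sorted_words_def sorted_append)
    have y: "y \<in> Obj M"
      unfolding y_def using word_t[OF wk] by (intro M.finite_sum_obj) auto
    note x = t[OF k]
    \<comment> \<open>the preimage at \<open>t\<^sub>k + y\<close> is the value at \<open>y\<close> of one more saturation\<close>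
    have sat: "preimage (FArr F (summand (t k) y)) (G w m (plus_obj M (t k) y)) = G (w @ [k]) m y" for m
      using y by (simp add: G_def iterated_saturation_def saturation_def)
    have lead: "direct_image (NComp (p k) y) (G w m (plus_obj M (t k) y)) = leading (p k) (t k) (G w m) y" for m
      using y by (simp add: leading_def)
    have pk: "NComp (p k) y \<in> Hom A (FObj F (plus_obj M (t k) y)) (FObj (delta M A (t k) F) y)"
      using natural_component[OF p[OF k] y] by (simp add: tau_def)
    note sub = subfunctor_subobject[OF G[OF w] M.plus_obj[OF x y]]
    have "G w n (plus_obj M (t k) y) \<subseteq> G w L (plus_obj M (t k) y)"
    proof (rule subobjects_compared_by_preimage_and_image[OF summand_map_hom[OF F x y] pk _ sub sub])
      show "\<exists>h \<in> Hom A (FObj (delta M A (t k) F) y) c. h \<cdot> NComp (p k) y = g"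
        if "g \<in> Hom A (FObj F (plus_obj M (t k) y)) c" "zero_arrow A (g \<cdot> FArr F (summand (t k) y))" for c g
        using p_univ[OF k] y that by blast
      show "G w L (plus_obj M (t k) y) \<subseteq> G w n (plus_obj M (t k) y)"
        using G_mono[OF Cons.prems(2)] by (simp add: le_fun_def)
      show "preimage (FArr F (summand (t k) y)) (G w n (plus_obj M (t k) y)) \<subseteq>
          preimage (FArr F (summand (t k) y)) (G w L (plus_obj M (t k) y))"
        unfolding sat using Cons.IH[OF wk Cons.prems(2)] by (simp add: y_def)
      show "direct_image (NComp (p k) y) (G w n (plus_obj M (t k) y)) \<subseteq>
          direct_image (NComp (p k) y) (G w L (plus_obj M (t k) y))"
        unfolding lead using N[OF k _ w, of n] N[OF k _ w, of L] L(2)[OF k] Cons.prems(2) by simp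
    qed
    moreover have "G w L (plus_obj M (t k) y) \<subseteq> G w n (plus_obj M (t k) y)"
      using G_mono[OF Cons.prems(2)] by (simp add: le_fun_def)
    ultimately show ?case by (simp add: finite_sum_def y_def)
  qed
  have "s n = s L" if n: "n \<ge> L" for n
  proof (rule antisym)
    show "s L \<le> s n" using s_mono[OF n] .
    \<comment> \<open>an arrow \<open>f\<close> into \<open>F a\<close> is recovered from its image in \<open>F z\<close>,
      where \<open>a\<close> is a retract of the sum \<open>z\<close>\<close>
    show "s n \<le> s L"
    proof (rule subfunctor_leI[OF sS])
      fix a assume a: "a \<in> Obj M"
      obtain ks where ks: "set ks \<subseteq> {..<r}" "retract M a (finite_sum M (map t ks))" using gen[OF a] by blast
      define z where "z = finite_sum M (map t (sort ks))"
      have "retract M (finite_sum M (map t ks)) z"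
        unfolding z_def using ks(1) t by (intro M.retract_finite_sum_sort) auto
      with ks(2) have "retract M a z" by (rule M.retract_trans)
      then obtain i q where iq: "i \<in> Hom M a z" "q \<in> Hom M z a" "q \<cdot>\<^bsub>M\<^esub> i = Idt M a"
        by (auto simp: retract_def)
      have "sort ks \<in> sorted_words r" using ks(1) by (simp add: sorted_words_def)
      then have sz: "s n z = s L z"
        using stable[of "[]" "sort ks" n] n by (simp add: G_def iterated_saturation_def z_def)
      show "s n a \<subseteq> s L a"
      proof
        fix f assume f: "f \<in> s n a"
        have "FArr F i \<cdot> f \<in> s L z" using subfunctor_closed[OF sS iq(1) f] sz by simp
        then have "FArr F q \<cdot> (FArr F i \<cdot> f) \<in> s L a" by (rule subfunctor_closed[OF sS iq(2)])
        moreover have "FArr F q \<cdot> (FArr F i \<cdot> f) = f"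
        proof -
          note fh = subobject_hom[OF subfunctor_subobject[OF sS a] f]
          show ?thesis
            using comp_assoc[OF fh cat_functor.map_hom[OF F iq(1)] cat_functor.map_hom[OF F iq(2)]]
              cat_functor.map_comp[OF F iq(1,2)] iq(3) cat_functor.map_idt[OF F a] idt_comp[OF fh] by simp
        qed
        ultimately show "f \<in> s L a" by simp
      qed
    qed
  qed
  then show "\<exists>N. \<forall>n \<ge> N. s n = s N" by blast
qed

text \<open>The number \<open>d\<close> of operators is one more than the polynomial degree, so that the induction starts
  with the zero functor. In \<^term>\<open>foldr (delta M A) as F\<close> the last letter of \<open>as\<close> is applied
  first, which makes \<^term>\<open>delta M A x F\<close> satisfy the hypothesis for \<open>d\<close> without commuting any \<open>\<delta>\<close>.\<close>

lemma acc_subfunctors_strongly_polynomial: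
  fixes t :: "nat \<Rightarrow> 'o"
  assumes t: "\<And>k. k < r \<Longrightarrow> t k \<in> Obj M"
    and gen: "\<And>x. x \<in> Obj M \<Longrightarrow> \<exists>ks. set ks \<subseteq> {..<r} \<and> retract M x (finite_sum M (map t ks))"
  assumes "cat_functor M A F" "\<And>c. c \<in> Obj M \<Longrightarrow> ascending_chain_condition (subobjects (FObj F c))"
    "\<And>as. length as = d \<Longrightarrow> set as \<subseteq> Obj M \<Longrightarrow> zero_object (Fct M A) (foldr (delta M A) as F)"
  shows "ascending_chain_condition (subfunctors F)"
  using assms(3-5)
proof (induction d arbitrary: F)
  case 0
  then have "zero_object (Fct M A) F" using "0.prems"(3)[of "[]"] by simp
  then show ?case by (rule acc_subfunctors_zero)
next
  case (Suc d)
  note F = Suc.prems(1)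
  have "ascending_chain_condition (subfunctors (delta M A x F))" if x: "x \<in> Obj M" for x
  proof (rule Suc.IH)
    obtain p where p: "p \<in> Hom (Fct M A) (tau M x F) (delta M A x F)"
      "\<forall>y \<in> Obj M. epic A (NComp p y)"
      "\<forall>y \<in> Obj M. \<forall>c. \<forall>g \<in> Hom A (FObj F (plus_obj M x y)) c. zero_arrow A (g \<cdot> FArr F (summand x y)) \<longrightarrow>
        (\<exists>h \<in> Hom A (FObj (delta M A x F) y) c. h \<cdot> NComp p y = g)"
      using delta_projection_exists[OF F x] .
    show "cat_functor M A (delta M A x F)" using natural_functors(2)[OF p(1)] .
    fix c assume c: "c \<in> Obj M"
    show "ascending_chain_condition (subobjects (FObj (delta M A x F) c))"
      using ascending_chain_condition_quotient[OF natural_component[OF p(1) c] bspec[OF p(2) c]]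
        Suc.prems(2)[OF M.plus_obj[OF x c]] by (simp add: tau_def)
  next
    fix as assume "length as = d" "set as \<subseteq> Obj M"
    then show "zero_object (Fct M A) (foldr (delta M A) as (delta M A x F))"
      using Suc.prems(3)[of "as @ [x]"] x by simp
  qed
  note acc_delta = this
  show ?case
    by (rule acc_subfunctors_if_acc_delta[OF F t gen acc_delta[OF t] Suc.prems(2)[OF M.unit_obj]])
qed

end

theorem proposition5p7:
  fixes M :: "('o, 'm) smcat"
    and A :: "('p, 'n) cat"
    and F :: "('o, 'm, 'p, 'n) ftor"
  assumes "infinite (UNIV :: 'u set)"
    and "small_category TYPE('u) M"
    and "symmetric_monoidal_category M"
    and "initial_object M (unit_obj M)"
    and "P0 M"
    and "grothendieck_category TYPE('u) A"
    and "cat_functor M A F"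
    and "strongly_polynomial M A F"
    and "pointwise_noetherian M A F"
  shows "noetherian_object (Fct M A) F"
proof -
  interpret symmetric_monoidal_category M by fact
  have "abelian A" using assms(6) by (simp add: grothendieck_category_def abelian_def)
  then interpret FA: monoidal_to_abelian M A
    using assms(3,4) category_axioms
    by (simp add: monoidal_to_abelian_def monoidal_to_abelian_axioms_def functors_to_abelian_def)
  obtain T where T: "finite T" "T \<subseteq> Obj M"
    "\<forall>x \<in> Obj M. \<exists>ts. set ts \<subseteq> T \<and> retract M x (finite_sum M ts)"
    using assms(5) by (auto simp: P0_def)
  obtain l where l: "set l = T" using finite_list[OF T(1)] by blast
  define t where "t k = l ! k" for k
  have T_eq: "T = t ` {..<length l}" using l by (auto simp: t_def set_conv_nth)
  have t: "t k \<in> Obj M" if "k < length l" for k using that T(2) T_eq by blast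
  have gen: "\<exists>ks. set ks \<subseteq> {..<length l} \<and> retract M x (finite_sum M (map t ks))"
    if x: "x \<in> Obj M" for x
  proof -
    obtain ts where ts: "set ts \<subseteq> T" "retract M x (finite_sum M ts)" using T(3) x by blast
    have "ts \<in> map t ` lists {..<length l}"
      using ts(1) unfolding T_eq lists_image[symmetric] by blast
    with ts(2) show ?thesis by blast
  qed
  obtain d where d: "\<forall>as. length as = d + 1 \<and> set as \<subseteq> Obj M \<longrightarrow>
      zero_object (Fct M A) (foldr (delta M A) as F)"
    using assms(8) by (auto simp: strongly_polynomial_def)
  have "ascending_chain_condition (FA.subfunctors F)"
  proof (rule FA.acc_subfunctors_strongly_polynomial[OF t gen assms(7)])
    show "ascending_chain_condition (FA.subobjects (FObj F c))" if "c \<in> Obj M" for c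
      using assms(9) that by (auto simp: pointwise_noetherian_def intro: FA.noetherian_object_subobjects)
    show "zero_object (Fct M A) (foldr (delta M A) as F)" if "length as = d + 1" "set as \<subseteq> Obj M" for as
      using d that by blast
  qed
  then show ?thesis by (rule FA.noetherian_functorI[OF assms(7)])
qed

end
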